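(* In the setting of the context (with $p\in\mathbb{N}^*$ and $\sigma,\gamma,D>0$ fixed), assume that the following hold. (A1) For every $m\in\mathcal{M}$: (i) $\omega_m>0$ and $\pi_m>0$ on $S_m$; (ii) $\pi_m$ is continuous on $S_m$; (iii) $\pi_m(x)\mathbf{1}_{S_m}(x)\to 0$ as $\|x\|\to\infty$. (A2) For every $m\in\mathcal{M}$ and every $s>0$, $\lim_{r\to\infty}\ \sup_{x\in S_m,\ \|x\|\ge r} \pi_m(x+s\,n(x))/\pi_m(x)=0$. (A3) There exist $b,R,\epsilon>0$ and $u\in(0,b)$ such that for every $m\in\mathcal{M}$, every $x\in S_m$ with $\|x\|\ge R$, and every $y\in S_m\cap W_m(x)$: $\pi_m(x-u\,n(x))\le \pi_m(y)$, where $$W_m(x)=\{(\|x\|-u)n(x)-s\zeta:\ s\in(0,b-u),\ \zeta\in S_m,\ \|\zeta\|=1,\ \|\zeta-n(x)\|\le\epsilon\}.$$ Then, for any $\Psi\in\{\Psi_1,\Psi_2\}$ and any $\beta\in(0,1)$, writing $V:\mathbb{R}^p\to[1,\infty)$, $V(x)=c_\beta\,\pi(x)^{-\beta}$ (with $c_\beta>0$ a constant such that $V\ge 1$), there exist $C>0$ and $\lambda\in(0,1)$ such that for any $n\ge 0$ and any $x\in\mathbb{R}^p$, $$\|P_\Psi^n(x,\cdot)-\pi\|_V\le C\,V(x)\,\lambda^n .$$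
   Context: Let $\mathcal{M}=\{0,1\}^p$. For $m=(m_1,\dots,m_p)\in\mathcal{M}$ let $I_m=\{i: m_i=1\}$, $|m|=\sum_i m_i$, and $S_m=\{z\in\mathbb{R}^p: z_i\ne 0 \text{ for } i\in I_m,\ z_j=0 \text{ for } j\notin I_m\}$; $\{S_m\}_{m\in\mathcal{M}}$ is a partition of $\mathbb{R}^p$. Let $\nu_m(dx)=\prod_{i\in I_m}dx_i\prod_{j\notin I_m}\delta_0(dx_j)$ and $\nu=\sum_{m\in\mathcal{M}}\nu_m$. $\|\cdot\|$ is the Euclidean norm and $n(x)=x/\|x\|$ for $x\neq 0$. Target: $\pi(dx)=\sum_{m\in\mathcal{M}}\omega_m\pi_m(x)\mathbf{1}_{S_m}(x)\nu_m(dx)$, where $(\omega_m)_{m\in\mathcal{M}}$ are probabilities on $\mathcal{M}$, $\pi_m(x)\nu_m(dx)$ is a probability distribution, and $\pi_m(x)\propto\exp(-U_m(x)-V_m(x))$ with $U_m:\mathbb{R}^p\to\mathbb{R}$ continuously differentiable and $V_m$ possibly non-smooth. The density of $\pi$ with respect to $\nu$ is also denoted $\pi(x)=\sum_m\omega_m\pi_m(x)\mathbf{1}_{S_m}(x)$. Thresholding operators: for $u\in\mathbb{R}^p$, $1\le i\le p$, $(\Psi_1(u))_i=u_i(1-\gamma/|u_i|)_+$ and $(\Psi_2(u))_i=u_i(1-\gamma^2/|u_i|^2)_+$, where $a_+=\max(a,0)$ (value $0$ when $u_i=0$). Drift: $h(x)=\sum_{m\in\mathcal{M}}\mathbf{1}_{S_m}(x)\frac{D\,\nabla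 U_m(x)}{\max(D,\|\nabla U_m(x)\|)}$ and $\mu(x)=x+\frac{\sigma^2}{2}h(x)$. Proposal: from $x$, propose $Z=\Psi(\mu(x)+\sigma\xi)$ with $\xi\sim\mathcal{N}_p(0,I)$. The law of $Z$ has density $q_\Psi(x,\cdot)$ with respect to $\nu$, where for $z\in S_m$, $q_\Psi(x,z)=\prod_{i\notin I_m}\rho(\mu_i(x))\prod_{i\in I_m}f_\Psi(\mu_i(x),z_i)$, with $\rho(c)=\mathbb{P}(|c+\sigma\zeta|\le\gamma)$, $\zeta\sim\mathcal{N}(0,1)$, and for $z\in\mathbb{R}\setminus\{0\}$, $f_{\Psi_1}(c,z)=(2\pi\sigma^2)^{-1/2}\exp\{-|(1+\gamma|z|^{-1})z-c|^2/(2\sigma^2)\}$, $f_{\Psi_2}(c,z)=(2\pi\sigma^2)^{-1/2}g(\gamma^2|z|^{-2})\tilde g(\gamma^2|z|^{-2})\exp\{-|g(\gamma^2|z|^{-2})z-c|^2/(2\sigma^2)\}$, $g(u)=\frac12(1+\sqrt{1+4u})$, $\tilde g(u)=1/\sqrt{1+4u}$ (here $2\pi$ involves the number $\pi$). Acceptance: $\alpha_\Psi(x,z)=1\wedge\frac{\pi(z)q_\Psi(z,x)}{\pi(x)q_\Psi(x,z)}$. The transition kernel is $P_\Psi(x,A)=\int_A\alpha_\Psi(x,z)q_\Psi(x,z)\nu(dz)+\delta_x(A)\int(1-\alpha_\Psi(x,z))q_\Psi(x,z)\nu(dz)$ for Borel $A\subset\mathbb{R}^p$, and $P_\Psi^n$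 is its $n$-th iterate. For a signed measure $\eta$ on $\mathbb{R}^p$ and $V\ge1$, $\|\eta\|_V=\sup_{|f|\le V}|\eta(f)|$ (supremum over measurable $f$). *)

theory Defs
  imports "HOL-Probability.Probability"
begin

text \<open>
  A model \<open>m \<in> {0,1}^p\<close> is represented by the set \<open>I_m = {i. m_i = 1}\<close>, i.e. by an element of
  \<open>'p set\<close>, where the finite index type \<open>'p\<close> plays the role of \<open>{1,...,p}\<close>. The direction
  \<open>n(x) = x / \<parallel>x\<parallel>\<close> is the library's \<open>sgn x\<close>.
\<close>

definition supp :: "real ^ 'p \<Rightarrow> 'p set" where
  "supp z = {i. z $ i \<noteq> 0}"

definition S :: "'p set \<Rightarrow> (real ^ 'p) set" where
  "S m = {z. (\<forall>i\<in>m. z $ i \<noteq> 0) \<and> (\<forall>j\<in>-m. z $ j = 0)}"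

lemma mem_S_iff: "z \<in> S m \<longleftrightarrow> supp z = m"
  by (auto simp: S_def supp_def)

text \<open>Here \<open>return borel 0\<close> is the Dirac mass at 0.\<close>

definition nu_m :: "'p::finite set \<Rightarrow> (real ^ 'p) measure" where
  "nu_m m = distr (\<Pi>\<^sub>M i\<in>UNIV. if i \<in> m then lborel else return borel 0) borel (\<lambda>f. \<chi> i. f i)"

definition sum_measure :: "('m::finite \<Rightarrow> 'a::topological_space measure) \<Rightarrow> 'a measure" where
  "sum_measure F = measure_of UNIV (sets borel) (\<lambda>A. \<Sum>m\<in>UNIV. emeasure (F m) A)"

definition nu :: "(real ^ 'p::finite) measure" where
  "nu = sum_measure nu_m"

definition target ::
  "('p::finite set \<Rightarrow> real) \<Rightarrow> ('p set \<Rightarrow> real ^ 'p \<Rightarrow> real) \<Rightarrow> (real ^ 'p) measure" where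
  "target \<omega> \<pi> = sum_measure (\<lambda>m. density (nu_m m) (\<lambda>x. ennreal (\<omega> m * \<pi> m x * indicator (S m) x)))"

definition target_dens ::
  "('p::finite set \<Rightarrow> real) \<Rightarrow> ('p set \<Rightarrow> real ^ 'p \<Rightarrow> real) \<Rightarrow> real ^ 'p \<Rightarrow> real" where
  "target_dens \<omega> \<pi> x = (\<Sum>m\<in>UNIV. \<omega> m * \<pi> m x * indicator (S m) x)"

definition grad :: "(real ^ 'p \<Rightarrow> real) \<Rightarrow> real ^ 'p \<Rightarrow> real ^ 'p::finite" where
  "grad f x = (\<chi> i. frechet_derivative f (at x) (axis i 1))"

definition C1 :: "(real ^ 'p::finite \<Rightarrow> real) \<Rightarrow> bool" where
  "C1 f \<longleftrightarrow> (\<forall>x. f differentiable (at x)) \<and> continuous_on UNIV (grad f)"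

definition drift :: "real \<Rightarrow> ('p::finite set \<Rightarrow> real ^ 'p \<Rightarrow> real) \<Rightarrow> real ^ 'p \<Rightarrow> real ^ 'p" where
  "drift D U x =
     (\<Sum>m\<in>UNIV. indicator (S m) x *\<^sub>R ((D / max D (norm (grad (U m) x))) *\<^sub>R grad (U m) x))"

definition mu ::
  "real \<Rightarrow> real \<Rightarrow> ('p::finite set \<Rightarrow> real ^ 'p \<Rightarrow> real) \<Rightarrow> real ^ 'p \<Rightarrow> real ^ 'p" where
  "mu \<sigma> D U x = x + (\<sigma>\<^sup>2 / 2) *\<^sub>R drift D U x"

datatype thresholding = Psi1 | Psi2

text \<open>The proposal is \<open>Z = thresh \<Psi> \<gamma> (\<mu>(x) + \<sigma>\<xi>)\<close> with \<open>\<xi>\<close> standard Gaussian. The operator acts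
  coordinatewise; the value at 0 is 0 because \<open>c / 0 = 0\<close> in HOL.\<close>

fun thresh1 :: "thresholding \<Rightarrow> real \<Rightarrow> real \<Rightarrow> real" where
  "thresh1 Psi1 \<gamma> t = t * max (1 - \<gamma> / \<bar>t\<bar>) 0"
| "thresh1 Psi2 \<gamma> t = t * max (1 - \<gamma>\<^sup>2 / \<bar>t\<bar>\<^sup>2) 0"

definition thresh :: "thresholding \<Rightarrow> real \<Rightarrow> real ^ 'p \<Rightarrow> real ^ 'p::finite" where
  "thresh \<Psi> \<gamma> u = (\<chi> i. thresh1 \<Psi> \<gamma> (u $ i))"

definition g :: "real \<Rightarrow> real" where
  "g u = (1 + sqrt (1 + 4 * u)) / 2"

definition g_tilde :: "real \<Rightarrow> real" where
  "g_tilde u = 1 / sqrt (1 + 4 * u)"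

definition rho :: "real \<Rightarrow> real \<Rightarrow> real \<Rightarrow> real" where
  "rho \<sigma> \<gamma> c = measure (density lborel (\<lambda>t. ennreal (std_normal_density t))) {t. \<bar>c + \<sigma> * t\<bar> \<le> \<gamma>}"

fun unthresh1 :: "thresholding \<Rightarrow> real \<Rightarrow> real \<Rightarrow> real" where
  "unthresh1 Psi1 \<gamma> z = (1 + \<gamma> / \<bar>z\<bar>) * z"
| "unthresh1 Psi2 \<gamma> z = g (\<gamma>\<^sup>2 / \<bar>z\<bar>\<^sup>2) * z"

text \<open>Recall that \<open>normal_density c \<sigma> t = (2 pi \<sigma>\<^sup>2)\<^sup>-\<^sup>1\<^sup>/\<^sup>2 exp (- (t - c)\<^sup>2 / (2 \<sigma>\<^sup>2))\<close>.\<close>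

fun f_Psi :: "thresholding \<Rightarrow> real \<Rightarrow> real \<Rightarrow> real \<Rightarrow> real \<Rightarrow> real" where
  "f_Psi Psi1 \<sigma> \<gamma> c z = normal_density c \<sigma> (unthresh1 Psi1 \<gamma> z)"
| "f_Psi Psi2 \<sigma> \<gamma> c z =
     g (\<gamma>\<^sup>2 / \<bar>z\<bar>\<^sup>2) * g_tilde (\<gamma>\<^sup>2 / \<bar>z\<bar>\<^sup>2) * normal_density c \<sigma> (unthresh1 Psi2 \<gamma> z)"

text \<open>The next two facts tie the densities to the operators: \<open>rho\<close> is the mass of the atom at 0, and
  \<open>unthresh1\<close> inverts \<open>thresh1\<close> away from it.\<close>

lemma thresh1_eq_0_iff:
  assumes "\<gamma> > 0"
  shows "thresh1 \<Psi> \<gamma> t = 0 \<longleftrightarrow> \<bar>t\<bar> \<le> \<gamma>"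
proof (cases "t = 0")
  case False
  have "(\<gamma>\<^sup>2 / \<bar>t\<bar>\<^sup>2 \<ge> 1) \<longleftrightarrow> \<gamma>\<^sup>2 \<ge> \<bar>t\<bar>\<^sup>2"
    using False by (simp add: le_divide_eq)
  also have "\<dots> \<longleftrightarrow> \<bar>t\<bar> \<le> \<gamma>"
    using assms by (simp add: abs_le_square_iff [symmetric])
  finally show ?thesis
    using False assms by (cases \<Psi>) (auto simp: le_divide_eq max_def)
qed (use assms in \<open>cases \<Psi>; simp\<close>)

lemma thresh1_unthresh1:
  assumes "\<gamma> > 0" "z \<noteq> 0"
  shows "thresh1 \<Psi> \<gamma> (unthresh1 \<Psi> \<gamma> z) = z"
proof (cases \<Psi>)
  case Psi1
  define k where "k = 1 + \<gamma> / \<bar>z\<bar>"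
  have k: "k > 0" using assms by (simp add: k_def add_pos_nonneg)
  have "\<gamma> = (k - 1) * \<bar>z\<bar>" using assms by (simp add: k_def)
  then have "\<gamma> / \<bar>k * z\<bar> = (k - 1) / k"
    using assms k by (simp add: abs_mult)
  then have "1 - \<gamma> / \<bar>k * z\<bar> = 1 / k"
    using k by (simp add: field_simps)
  then show ?thesis
    unfolding Psi1 thresh1.simps unthresh1.simps k_def [symmetric]
    using k by (simp add: max_def)
next
  case Psi2
  define w where "w = \<gamma>\<^sup>2 / \<bar>z\<bar>\<^sup>2"
  have w: "w > 0" using assms by (simp add: w_def)
  have g1: "g w > 0" using w by (simp add: g_def add_pos_nonneg)
  have gq: "g w * g w = g w + w"
    using w real_sqrt_pow2[of "1 + 4 * w"] by (simp add: g_def field_simps power2_eq_square)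
  have "\<gamma>\<^sup>2 / \<bar>g w * z\<bar>\<^sup>2 = w / (g w)\<^sup>2"
    by (simp add: w_def power_mult_distrib)
  moreover have "w = (g w)\<^sup>2 - g w"
    using gq by (simp add: power2_eq_square)
  then have "w / (g w)\<^sup>2 = ((g w)\<^sup>2 - g w) / (g w)\<^sup>2"
    by (rule arg_cong)
  ultimately have "1 - \<gamma>\<^sup>2 / \<bar>g w * z\<bar>\<^sup>2 = 1 / g w"
    using g1 by (simp add: diff_divide_distrib power2_eq_square)
  then show ?thesis
    unfolding Psi2 thresh1.simps unthresh1.simps w_def [symmetric]
    using g1 by (simp add: max_def)
qed

text \<open>For \<open>z \<in> S m\<close> the index set \<open>I_m\<close> is \<open>supp z\<close>.\<close>

definition q_Psi ::
  "thresholding \<Rightarrow> real \<Rightarrow> real \<Rightarrow> real \<Rightarrow> ('p::finite set \<Rightarrow> real ^ 'p \<Rightarrow> real)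
     \<Rightarrow> real ^ 'p \<Rightarrow> real ^ 'p \<Rightarrow> real" where
  "q_Psi \<Psi> \<sigma> \<gamma> D U x z =
     (\<Prod>i\<in>- supp z. rho \<sigma> \<gamma> (mu \<sigma> D U x $ i)) *
     (\<Prod>i\<in>supp z. f_Psi \<Psi> \<sigma> \<gamma> (mu \<sigma> D U x $ i) (z $ i))"

definition alpha_Psi ::
  "thresholding \<Rightarrow> real \<Rightarrow> real \<Rightarrow> real \<Rightarrow> ('p::finite set \<Rightarrow> real) \<Rightarrow>
     ('p set \<Rightarrow> real ^ 'p \<Rightarrow> real) \<Rightarrow> ('p set \<Rightarrow> real ^ 'p \<Rightarrow> real) \<Rightarrow> real ^ 'p \<Rightarrow> real ^ 'p \<Rightarrow> real" where
  "alpha_Psi \<Psi> \<sigma> \<gamma> D \<omega> \<pi> U x z =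
     min 1 ((target_dens \<omega> \<pi> z * q_Psi \<Psi> \<sigma> \<gamma> D U z x) /
            (target_dens \<omega> \<pi> x * q_Psi \<Psi> \<sigma> \<gamma> D U x z))"

definition P_Psi ::
  "thresholding \<Rightarrow> real \<Rightarrow> real \<Rightarrow> real \<Rightarrow> ('p::finite set \<Rightarrow> real) \<Rightarrow>
     ('p set \<Rightarrow> real ^ 'p \<Rightarrow> real) \<Rightarrow> ('p set \<Rightarrow> real ^ 'p \<Rightarrow> real) \<Rightarrow> real ^ 'p \<Rightarrow> (real ^ 'p) measure" where
  "P_Psi \<Psi> \<sigma> \<gamma> D \<omega> \<pi> U x = measure_of UNIV (sets borel) (\<lambda>A.
     (\<integral>\<^sup>+ z \<in> A. ennreal (alpha_Psi \<Psi> \<sigma> \<gamma> D \<omega> \<pi> U x z * q_Psi \<Psi> \<sigma> \<gamma> D U x z) \<partial>nu) +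
     indicator A x *
       (\<integral>\<^sup>+ z. ennreal ((1 - alpha_Psi \<Psi> \<sigma> \<gamma> D \<omega> \<pi> U x z) * q_Psi \<Psi> \<sigma> \<gamma> D U x z) \<partial>nu))"

fun iter_kernel :: "('a::topological_space \<Rightarrow> 'a measure) \<Rightarrow> nat \<Rightarrow> 'a \<Rightarrow> 'a measure" where
  "iter_kernel K 0 x = return borel x"
| "iter_kernel K (Suc n) x = bind (K x) (iter_kernel K n)"

definition W :: "real \<Rightarrow> real \<Rightarrow> real \<Rightarrow> 'p::finite set \<Rightarrow> real ^ 'p \<Rightarrow> (real ^ 'p) set" where
  "W b u \<epsilon> m x = {(norm x - u) *\<^sub>R sgn x - s *\<^sub>R \<zeta> | s \<zeta>.
     s \<in> {0<..<b - u} \<and> \<zeta> \<in> S m \<and> norm \<zeta> = 1 \<and> norm (\<zeta> - sgn x) \<le> \<epsilon>}"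

definition lyapunov ::
  "real \<Rightarrow> real \<Rightarrow> ('p::finite set \<Rightarrow> real) \<Rightarrow> ('p set \<Rightarrow> real ^ 'p \<Rightarrow> real) \<Rightarrow> real ^ 'p \<Rightarrow> real" where
  "lyapunov c \<beta> \<omega> \<pi> x = c * target_dens \<omega> \<pi> x powr (- \<beta>)"

text \<open>
  \<open>V_norm_diff V M N\<close> is \<open>\<parallel>M - N\<parallel>\<^sub>V\<close> for finite Borel measures \<open>M\<close>, \<open>N\<close> (signed measures are not in
  the library), with values in \<open>[0,\<infinity>]\<close>. The value \<open>\<eta>(f)\<close> for \<open>\<eta> = M - N\<close> is only meaningful for
  integrable \<open>f\<close>. This restriction loses nothing: if \<open>V\<close> is not integrable for the total variation
  of \<open>M - N\<close>, bounded truncations of \<open>\<plusminus>V\<close> already make the supremum infinite.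
\<close>

definition V_norm_diff ::
  "('a::topological_space \<Rightarrow> real) \<Rightarrow> 'a measure \<Rightarrow> 'a measure \<Rightarrow> ennreal" where
  "V_norm_diff V M N =
     (SUP f \<in> {f. f \<in> borel_measurable borel \<and> (\<forall>x. \<bar>f x\<bar> \<le> V x) \<and> integrable M f \<and> integrable N f}.
        ennreal \<bar>(\<integral>x. f x \<partial>M) - (\<integral>x. f x \<partial>N)\<bar>)"

end

theory Submission
  imports Defs
begin

text \<open>
  The kernel is a Metropolis--Hastings kernel with respect to \<open>nu\<close>, so \<open>target\<close> is invariant by detailed
  balance, and by the theorem of Harris (in the form of Hairer and Mattingly) it suffices to find a
  drift inequality for \<open>V = c \<pi>\<^sup>-\<^sup>\<beta>\<close> and a minorization on the sublevel sets of \<open>V\<close>. The latter is easy: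
  these sets are bounded and every point of a bounded set jumps to the atom \<open>0\<close> with probability
  bounded below.

  For the drift, the proposal density satisfies \<open>q(x,z) \<le> C exp(-a |z - x|\<^sup>2)\<close> and is bounded below for
  bounded \<open>z - x\<close>, whatever the models of \<open>x\<close> and \<open>z\<close>. Hence only \<open>|z - x| \<le> K\<close> matters, and there the
  contribution of \<open>z\<close> to \<open>PV(x)/V(x)\<close> is negligible if \<open>\<pi>(z) \<ge> L \<pi>(x)\<close> and at most about \<open>q(x,z)\<close> if
  \<open>\<pi>(z) \<le> \<pi>(x)/L\<close>. The layer in between has small measure (by (A2) for large \<open>x\<close>), and the first region
  has proposal probability bounded below (by (A3) for large \<open>x\<close>). As \<open>\<pi>\<close> may vanish at the boundary
  of \<open>S_m\<close>, bounded \<open>x\<close> with small \<open>\<pi>(x)\<close> have to be treated too; for those nearly all the mass near \<open>x\<close>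
  has \<open>\<pi>(z) \<ge> L \<pi>(x)\<close>.
\<close>

section \<open>The reference measure\<close>

text \<open>Truncating the gradient at \<open>D\<close> keeps each coordinate of \<open>mu\<close>
  within \<sigma>^2 D / 2 of that of x, and undoing a thresholding displaces it by at most \<gamma>.
  The proposal is thus comparable with a Gaussian random walk, uniformly in x; as densities are
  taken relative to \<open>nu\<close>, a coordinate entering or leaving the model costs a bounded
  factor. The obstacle is the layer where p(z) is comparable with p(x). It meets all models at once,
  nothing is known about the shape of level sets, and (A2) controls \<open>p\<close> only along
  rays. Dilations fit this: they move points along rays, preserve every \<open>S m\<close>, and
  scale each \<open>nu_m\<close> by a power of the ratio. The order of choices matters. The mass
  \<eta> of favourable proposals has to be fixed before all else: the radius K comes from a Gaussian
  tail small against \<eta>, the bound M on q(z,x)/q(x,z) depends on K, the level factor L on M and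
  \<eta>, and the threshold \<delta> for p(x) on all of these.\<close>

lemma space_sum_measure [simp]: "space (sum_measure F) = UNIV"
  by (simp add: sum_measure_def space_measure_of_conv)

lemma sets_sum_measure [simp, measurable_cong]: "sets (sum_measure F) = sets borel"
  by (simp add: sum_measure_def sets_measure_of_conv sigma_algebra.sigma_sets_eq
      sets.sigma_algebra_axioms) (metis sets.sigma_sets_eq space_borel)

text \<open>\<open>measure_of\<close> yields the null measure unless its set function is a measure,
  so countable additivity has to be verified before the formula can be read off.\<close>

lemma emeasure_sum_measure:
  assumes F: "\<And>m. sets (F m) = sets borel" and A: "A \<in> sets borel"
  shows "emeasure (sum_measure F) A = (\<Sum>m\<in>UNIV. emeasure (F m) A)"
  unfolding sum_measure_def
proof (rule emeasure_measure_of_sigma)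
  show "sigma_algebra UNIV (sets borel)"
    by (metis sets.sigma_algebra_axioms space_borel)
  show "countably_additive (sets borel) (\<lambda>A. \<Sum>m\<in>UNIV. emeasure (F m) A)"
  proof (rule countably_additiveI)
    fix A :: "nat \<Rightarrow> 'b set"
    assume A: "range A \<subseteq> sets borel" "disjoint_family A"
    have "(\<Sum>i. \<Sum>m\<in>UNIV. emeasure (F m) (A i)) = (\<Sum>m\<in>UNIV. \<Sum>i. emeasure (F m) (A i))"
      by (rule suminf_sum) auto
    also have "\<dots> = (\<Sum>m\<in>UNIV. emeasure (F m) (\<Union>i. A i))"
      using A by (intro sum.cong refl suminf_emeasure) (auto simp: F)
    finally show "(\<Sum>i. \<Sum>m\<in>UNIV. emeasure (F m) (A i)) = (\<Sum>m\<in>UNIV. emeasure (F m) (\<Union> (range A)))" .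
  qed
qed (use A in \<open>auto simp: positive_def\<close>)

lemma nn_integral_sum_measure:
  assumes F: "\<And>m. sets (F m) = sets borel" and f: "f \<in> borel_measurable borel"
  shows "(\<integral>\<^sup>+x. f x \<partial>sum_measure F) = (\<Sum>m\<in>UNIV. \<integral>\<^sup>+x. f x \<partial>F m)"
  using f
proof induct
  case (cong f g)
  then show ?case by (metis ext space_borel UNIV_I)
next
  case (set A)
  then show ?case by (simp add: emeasure_sum_measure F)
next
  case (mult u c)
  have "u \<in> borel_measurable (sum_measure F)" "\<And>m. u \<in> borel_measurable (F m)"
    using mult(2) by (simp_all add: measurable_cong_sets[OF F refl] measurable_cong_sets[OF sets_sum_measure refl])
  then show ?case
    using mult by (simp add: nn_integral_cmult sum_distrib_left)
next
  case (add u v)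
  have "u \<in> borel_measurable (sum_measure F)" "\<And>m. u \<in> borel_measurable (F m)"
     "v \<in> borel_measurable (sum_measure F)" "\<And>m. v \<in> borel_measurable (F m)"
    using add(1,4) by (simp_all add: measurable_cong_sets[OF F refl] measurable_cong_sets[OF sets_sum_measure refl])
  then show ?case
    using add by (simp add: nn_integral_add sum.distrib)
next
  case (seq U)
  have m: "U i \<in> borel_measurable (sum_measure F)" "\<And>m. U i \<in> borel_measurable (F m)" for i
    using seq(1) by (simp_all add: measurable_cong_sets[OF F refl] measurable_cong_sets[OF sets_sum_measure refl])
  have "(\<integral>\<^sup>+x. (SUP i. U i) x \<partial>sum_measure F) = (SUP i. \<integral>\<^sup>+x. U i x \<partial>sum_measure F)"
    using seq(4) m by (simp add: image_comp nn_integral_monotone_convergence_SUP)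
  also have "\<dots> = (SUP i. \<Sum>m\<in>UNIV. \<integral>\<^sup>+x. U i x \<partial>F m)"
    using seq by simp
  also have "\<dots> = (\<Sum>m\<in>UNIV. SUP i. \<integral>\<^sup>+x. U i x \<partial>F m)"
    using seq(4) by (intro ennreal_SUP_sum) (auto simp: incseq_def le_fun_def intro!: nn_integral_mono)
  also have "\<dots> = (\<Sum>m\<in>UNIV. \<integral>\<^sup>+x. (SUP i. U i) x \<partial>F m)"
    using seq(4) m by (simp add: image_comp nn_integral_monotone_convergence_SUP)
  finally show ?case .
qed

section \<open>The product structure of \<open>nu_m\<close> and of \<open>nu\<close>\<close>

lemma space_nu_m [simp]: "space (nu_m m) = UNIV"
  and sets_nu_m [simp, measurable_cong]: "sets (nu_m m) = sets borel"
  by (auto simp: nu_m_def)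

lemma space_nu [simp]: "space nu = UNIV"
  and sets_nu [simp, measurable_cong]: "sets nu = sets borel"
  by (auto simp: nu_def)

abbreviation coord_measure :: "'p set \<Rightarrow> 'p \<Rightarrow> real measure" where
  "coord_measure m i \<equiv> (if i \<in> m then lborel else return borel 0)"

lemma product_sigma_finite_coord: "product_sigma_finite (coord_measure m)"
proof -
  interpret P: prob_space "return borel (0::real)"
    by (rule prob_space_return) simp
  show ?thesis
    unfolding product_sigma_finite_def
    by (simp add: P.sigma_finite_measure_axioms lborel.sigma_finite_measure_axioms)
qed

lemma vec_of_fun_measurable:
  "(\<lambda>f. \<chi> i. f i) \<in> Pi\<^sub>M UNIV (coord_measure m) \<rightarrow>\<^sub>M (borel :: (real ^ 'p::finite) measure)"
proof -
  have "(\<lambda>f. f i) \<in> borel_measurable (Pi\<^sub>M UNIV (coord_measure m))" for i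
    using measurable_component_singleton[of i UNIV "coord_measure m"]
    by (cases "i \<in> m") (simp_all cong: measurable_cong_sets)
  then show ?thesis
    by (subst borel_measurable_euclidean_space) (auto simp: Basis_vec_def inner_axis)
qed

lemma nn_integral_nu_m_prod:
  fixes h :: "'p::finite \<Rightarrow> real \<Rightarrow> ennreal"
  assumes [measurable]: "\<And>i. h i \<in> borel_measurable borel"
  shows "(\<integral>\<^sup>+z. (\<Prod>i\<in>UNIV. h i (z $ i)) \<partial>nu_m m) =
    (\<Prod>i\<in>m. \<integral>\<^sup>+t. h i t \<partial>lborel) * (\<Prod>i\<in>-m. h i 0)"
proof -
  interpret product_sigma_finite "coord_measure m" by (rule product_sigma_finite_coord)
  have "(\<integral>\<^sup>+z. (\<Prod>i\<in>UNIV. h i (z $ i)) \<partial>nu_m m) =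
     (\<integral>\<^sup>+x. (\<Prod>i\<in>UNIV. h i (x i)) \<partial>Pi\<^sub>M UNIV (coord_measure m))"
    unfolding nu_m_def by (subst nn_integral_distr[OF vec_of_fun_measurable]) auto
  also have "\<dots> = (\<Prod>i\<in>UNIV. integral\<^sup>N (coord_measure m i) (h i))"
    by (rule product_nn_integral_prod) (auto cong: measurable_cong_sets)
  also have "\<dots> = (\<Prod>i\<in>m. integral\<^sup>N (coord_measure m i) (h i)) * (\<Prod>i\<in>-m. integral\<^sup>N (coord_measure m i) (h i))"
    by (subst prod.union_disjoint[symmetric]) auto
  finally show ?thesis by (simp add: nn_integral_return)
qed

lemma emeasure_nu:
  "A \<in> sets borel \<Longrightarrow> emeasure nu A = (\<Sum>m\<in>UNIV. emeasure (nu_m m) A)"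
  unfolding nu_def by (rule emeasure_sum_measure) simp_all

lemma nn_integral_nu:
  "f \<in> borel_measurable borel \<Longrightarrow> (\<integral>\<^sup>+x. f x \<partial>nu) = (\<Sum>m\<in>UNIV. \<integral>\<^sup>+x. f x \<partial>nu_m m)"
  unfolding nu_def by (rule nn_integral_sum_measure) simp_all

text \<open>Expanding the product on the right over subsets of coordinates gives the sum over
  models. Hence \<open>nu\<close> behaves like the product of p copies of Lebesgue measure plus the
  Dirac mass at 0, and the proposal can be treated coordinate by coordinate.\<close>

lemma nn_integral_nu_prod:
  fixes h :: "'p::finite \<Rightarrow> real \<Rightarrow> ennreal"
  assumes [measurable]: "\<And>i. h i \<in> borel_measurable borel"
  shows "(\<integral>\<^sup>+z. (\<Prod>i\<in>UNIV. h i (z $ i)) \<partial>nu) = (\<Prod>i\<in>UNIV. (\<integral>\<^sup>+t. h i t \<partial>lborel) + h i 0)"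
  by (subst nn_integral_nu) (simp_all add: nn_integral_nu_m_prod prod_add Compl_eq_Diff_UNIV)

lemma indicator_vec_box:
  "(\<Prod>i\<in>UNIV. indicator (A i) (z $ i) :: ennreal) = indicator {z :: real^'p::finite. \<forall>i. z $ i \<in> A i} z"
  by (auto simp: indicator_def)

lemma vec_box_borel [measurable]:
  assumes [measurable]: "\<And>i. A i \<in> sets borel"
  shows "{z :: real^'p::finite. \<forall>i. z $ i \<in> A i} \<in> sets borel"
  by measurable

lemma emeasure_nu_m_box:
  assumes [measurable]: "\<And>i. A i \<in> sets borel"
  shows "emeasure (nu_m m) {z :: real^'p::finite. \<forall>i. z $ i \<in> A i} =
     (\<Prod>i\<in>m. emeasure lborel (A i)) * (\<Prod>i\<in>-m. indicator (A i) 0)"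
  using nn_integral_nu_m_prod[of "\<lambda>i. indicator (A i)" m] by (simp add: indicator_vec_box)

lemma S_borel [measurable]: "S m \<in> sets borel"
proof -
  have "S m = {z. \<forall>i. z $ i \<in> (if i \<in> m then -{0} else {0})}"
    by (auto simp: S_def)
  then show ?thesis by (simp add: vec_box_borel)
qed

text \<open>The \<open>nu_m\<close> live on disjoint pieces. This allows the target, which is a sum
  with a separate density for each model, to be rewritten with the single density
  \<open>target_dens\<close> relative to \<open>nu\<close>.\<close>

lemma AE_nu_m_S: "AE z in nu_m m. z \<in> S m"
proof -
  have "AE z in nu_m m. z $ i \<noteq> 0" if "i \<in> m" for i
  proof (rule AE_I)
    show "emeasure (nu_m m) {z. \<forall>j. z $ j \<in> (if j = i then {0} else UNIV)} = 0"
      using that by (subst emeasure_nu_m_box) (auto intro!: prod_zero exI[of _ i])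
  qed (auto intro!: vec_box_borel split: if_splits)
  moreover have "AE z in nu_m m. z $ i = 0" if "i \<notin> m" for i
  proof (rule AE_I)
    show "emeasure (nu_m m) {z. \<forall>j. z $ j \<in> (if j = i then -{0} else UNIV)} = 0"
      using that by (subst emeasure_nu_m_box) (auto intro!: prod_zero exI[of _ i])
  qed (auto intro!: vec_box_borel split: if_splits)
  ultimately have "AE z in nu_m m. \<forall>i\<in>UNIV. if i \<in> m then z $ i \<noteq> 0 else z $ i = 0"
    by (intro AE_finite_allI) (auto split: if_splits)
  then show ?thesis
    by eventually_elim (auto simp: S_def split: if_splits)
qed

lemma sigma_finite_nu: "sigma_finite_measure (nu :: (real^'p::finite) measure)"
proof
  let ?A = "\<lambda>n::nat. {z :: real^'p. \<forall>i. z $ i \<in> {- real n..real n}}"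
  have "indicator {- real n..real n} 0 = (1 :: ennreal)" for n by simp
  then have "emeasure nu (?A n) \<noteq> \<infinity>" for n
    by (subst emeasure_nu)
      (auto simp: emeasure_nu_m_box ennreal_power ennreal_mult_eq_top_iff simp del: atLeastAtMost_iff)
  moreover have "\<exists>n. z \<in> ?A n" for z :: "real^'p"
  proof -
    obtain n where n: "norm z \<le> real n" using real_arch_simple by blast
    have "\<bar>z $ i\<bar> \<le> real n" for i using component_le_norm_cart[of z i] n by simp
    then show ?thesis by (auto simp: abs_le_iff intro!: exI[of _ n]) (metis minus_le_iff)+
  qed
  ultimately show "\<exists>A::(real^'p) set set. countable A \<and> A \<subseteq> sets nu \<and> \<Union> A = space nu \<and> (\<forall>a\<in>A. emeasure nu a \<noteq> \<infinity>)"
    by (intro exI[of _ "range ?A"]) auto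
qed

text \<open>A dilation acts on each coordinate separately: it rescales Lebesgue measure in the
  coordinates of \<open>m\<close> and fixes the Dirac mass at 0 in the others. The equality of
  measures is checked on boxes.\<close>

lemma nn_integral_nu_m_scale:
  fixes f :: "real^'p::finite \<Rightarrow> ennreal"
  assumes r: "r > 0" and f [measurable]: "f \<in> borel_measurable borel"
  shows "(\<integral>\<^sup>+z. f z \<partial>nu_m m) = ennreal (r ^ card m) * (\<integral>\<^sup>+z. f (r *\<^sub>R z) \<partial>nu_m m)"
proof -
  interpret product_sigma_finite "coord_measure m" by (rule product_sigma_finite_coord)
  let ?P = "Pi\<^sub>M UNIV (coord_measure m)"
  let ?s = "\<lambda>x::'p \<Rightarrow> real. \<lambda>i. r * x i"
  have s [measurable]: "?s \<in> ?P \<rightarrow>\<^sub>M ?P"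
  proof (rule measurable_PiM_single')
    fix i
    have "(\<lambda>f. f i) \<in> borel_measurable ?P"
      using measurable_component_singleton[of i UNIV "coord_measure m"]
      by (cases "i \<in> m") (simp_all cong: measurable_cong_sets)
    then have "(\<lambda>f. r * f i) \<in> borel_measurable ?P" by measurable
    then show "(\<lambda>f. r * f i) \<in> ?P \<rightarrow>\<^sub>M coord_measure m i"
      by (simp cong: measurable_cong_sets)
  qed auto
  have eq: "density (distr ?P ?P ?s) (\<lambda>_. ennreal (r ^ card m)) = ?P"
  proof (rule PiM_eqI)
    fix A :: "'p \<Rightarrow> real set" assume "\<And>i. i \<in> UNIV \<Longrightarrow> A i \<in> sets (coord_measure m i)"
    then have A [measurable]: "\<And>i. A i \<in> sets borel" by (metis UNIV_I sets_lborel sets_return)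
    have A': "(*) r -` A i \<in> sets borel" for i
      using measurable_sets[of "(*) r" borel borel "A i"] by simp
    have sc: "emeasure lborel (A i) = ennreal r * emeasure lborel ((*) r -` A i)" for i
    proof -
      have "emeasure lborel (A i) = (\<integral>\<^sup>+x. indicator (A i) x \<partial>lborel)" by simp
      also have "\<dots> = r * (\<integral>\<^sup>+x. indicator (A i) (0 + r * x) \<partial>lborel)"
        using r by (subst nn_integral_real_affine[of _ r 0]) auto
      also have "(\<integral>\<^sup>+x. indicator (A i) (0 + r * x) \<partial>lborel) = (\<integral>\<^sup>+x. indicator ((*) r -` A i) x \<partial>lborel)"
        by (intro nn_integral_cong) (auto simp: indicator_def)
      finally show ?thesis using A' by simp
    qed
    have vi: "?s -` Pi\<^sub>E UNIV A \<inter> space ?P = Pi\<^sub>E UNIV (\<lambda>i. (*) r -` A i)"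
      by (auto simp: space_PiM PiE_def)
    have PA: "Pi\<^sub>E UNIV A \<in> sets ?P"
      by (rule sets_PiM_I_finite) (auto split: if_splits)
    have "emeasure (density (distr ?P ?P ?s) (\<lambda>_. ennreal (r ^ card m))) (Pi\<^sub>E UNIV A) =
        ennreal (r ^ card m) * emeasure ?P (Pi\<^sub>E UNIV (\<lambda>i. (*) r -` A i))"
      using PA by (simp add: emeasure_density nn_integral_cmult emeasure_distr vi)
    also have "\<dots> = ennreal (r ^ card m) * (\<Prod>i\<in>UNIV. emeasure (coord_measure m i) ((*) r -` A i))"
      using A' by (subst emeasure_PiM) (auto split: if_splits)
    also have "\<dots> = (\<Prod>i\<in>UNIV. if i \<in> m then ennreal r else 1) * (\<Prod>i\<in>UNIV. emeasure (coord_measure m i) ((*) r -` A i))"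
      using r by (simp add: prod.If_cases ennreal_power)
    also have "\<dots> = (\<Prod>i\<in>UNIV. emeasure (coord_measure m i) (A i))"
      unfolding prod.distrib[symmetric]
      using A' by (intro prod.cong) (auto simp: sc indicator_def)
    finally show "emeasure (density (distr ?P ?P ?s) (\<lambda>_. ennreal (r ^ card m))) (Pi\<^sub>E UNIV A) =
       (\<Prod>i\<in>UNIV. emeasure (coord_measure m i) (A i))" .
  qed auto
  note [measurable] = vec_of_fun_measurable[of m]
  have "(\<integral>\<^sup>+z. f z \<partial>nu_m m) = (\<integral>\<^sup>+x. f (\<chi> i. x i) \<partial>?P)"
    unfolding nu_m_def by (subst nn_integral_distr) auto
  also have "\<dots> = (\<integral>\<^sup>+x. f (\<chi> i. x i) \<partial>density (distr ?P ?P ?s) (\<lambda>_. ennreal (r ^ card m)))"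
    by (simp only: eq)
  also have "\<dots> = ennreal (r ^ card m) * (\<integral>\<^sup>+x. f (\<chi> i. x i) \<partial>distr ?P ?P ?s)"
    by (subst nn_integral_density) (auto simp: nn_integral_cmult)
  also have "(\<integral>\<^sup>+x. f (\<chi> i. x i) \<partial>distr ?P ?P ?s) = (\<integral>\<^sup>+x. f (\<chi> i. r * x i) \<partial>?P)"
    by (subst nn_integral_distr) auto
  also have "\<dots> = (\<integral>\<^sup>+x. f (r *\<^sub>R (\<chi> i. x i)) \<partial>?P)"
    by (intro nn_integral_cong arg_cong[of _ _ f]) (simp add: vec_eq_iff)
  also have "\<dots> = (\<integral>\<^sup>+z. f (r *\<^sub>R z) \<partial>nu_m m)"
    unfolding nu_m_def by (subst nn_integral_distr) auto
  finally show ?thesis .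
qed

section \<open>The one-dimensional proposal density\<close>

text \<open>The density of one coordinate of the proposal with respect to \<open>lborel\<close> plus the Dirac mass at 0.\<close>

definition phi :: "thresholding \<Rightarrow> real \<Rightarrow> real \<Rightarrow> real \<Rightarrow> real \<Rightarrow> real" where
  "phi \<Psi> \<sigma> \<gamma> c z = (if z = 0 then rho \<sigma> \<gamma> c else f_Psi \<Psi> \<sigma> \<gamma> c z)"

text \<open>\<open>half\<close> is \<open>unthresh1\<close> on \<open>[0,\<infinity>)\<close>, extended smoothly to \<open>0\<close>.\<close>

fun half :: "thresholding \<Rightarrow> real \<Rightarrow> real \<Rightarrow> real" where
  "half Psi1 \<gamma> z = z + \<gamma>"
| "half Psi2 \<gamma> z = (z + sqrt (z\<^sup>2 + 4 * \<gamma>\<^sup>2)) / 2"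

fun half' :: "thresholding \<Rightarrow> real \<Rightarrow> real \<Rightarrow> real" where
  "half' Psi1 \<gamma> z = 1"
| "half' Psi2 \<gamma> z = (1 + z / sqrt (z\<^sup>2 + 4 * \<gamma>\<^sup>2)) / 2"

section \<open>The inverse thresholdings and the change of variables\<close>

lemma sqrt_scale:
  assumes "z \<noteq> 0"
  shows "sqrt (1 + 4 * (\<gamma>\<^sup>2 / \<bar>z\<bar>\<^sup>2)) = sqrt (z\<^sup>2 + 4 * \<gamma>\<^sup>2) / \<bar>z\<bar>"
proof -
  have "1 + 4 * (\<gamma>\<^sup>2 / \<bar>z\<bar>\<^sup>2) = (z\<^sup>2 + 4 * \<gamma>\<^sup>2) / \<bar>z\<bar>\<^sup>2"
    using assms by (simp add: field_simps)
  then show ?thesis by (simp only: real_sqrt_divide) simp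
qed

lemma unthresh1_half:
  assumes "z \<noteq> 0"
  shows "unthresh1 \<Psi> \<gamma> z = sgn z * half \<Psi> \<gamma> \<bar>z\<bar>"
proof (cases \<Psi>)
  case Psi1
  then show ?thesis using assms by (simp add: field_simps sgn_if)
next
  case Psi2
  have "unthresh1 Psi2 \<gamma> z = (1 + sqrt (z\<^sup>2 + 4 * \<gamma>\<^sup>2) / \<bar>z\<bar>) / 2 * z"
    by (simp only: unthresh1.simps g_def sqrt_scale[OF assms])
  also have "\<dots> = sgn z * half Psi2 \<gamma> \<bar>z\<bar>"
    using assms by (cases "z > 0") (simp_all add: field_simps sgn_if)
  finally show ?thesis using Psi2 by simp
qed

text \<open>The factor \<open>g * g_tilde\<close> in \<open>f_Psi\<close> for \<open>Psi2\<close> is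
  the derivative of \<open>half\<close>. So in both cases \<open>f_Psi\<close> is the Gaussian
  density times the Jacobian of the inverse thresholding.\<close>

lemma f_Psi_half:
  assumes "z \<noteq> 0" "\<gamma> > 0"
  shows "f_Psi \<Psi> \<sigma> \<gamma> c z = half' \<Psi> \<gamma> \<bar>z\<bar> * normal_density c \<sigma> (sgn z * half \<Psi> \<gamma> \<bar>z\<bar>)"
proof (cases \<Psi>)
  case Psi1
  then show ?thesis using assms unthresh1_half[of z Psi1 \<gamma>] by simp
next
  case Psi2
  have s: "sqrt (z\<^sup>2 + 4 * \<gamma>\<^sup>2) > 0"
    using assms by (simp add: add_pos_pos)
  have "g (\<gamma>\<^sup>2 / \<bar>z\<bar>\<^sup>2) * g_tilde (\<gamma>\<^sup>2 / \<bar>z\<bar>\<^sup>2) = half' Psi2 \<gamma> \<bar>z\<bar>"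
    using assms s unfolding g_def g_tilde_def sqrt_scale[OF assms(1)]
    by (simp add: field_simps)
  then show ?thesis using Psi2 by (simp only: f_Psi.simps unthresh1_half[OF assms(1)])
qed

text \<open>For \<open>Psi2\<close> the square root lies between z and z + 2\<gamma>. Together with
  the bounds 1/2 and 1 on the Jacobian this is how the two thresholdings enter all later
  estimates.\<close>

lemma half_bounds:
  assumes "z \<ge> 0" "\<gamma> > 0"
  shows "z \<le> half \<Psi> \<gamma> z" "half \<Psi> \<gamma> z \<le> z + \<gamma>"
proof -
  have "z \<le> sqrt (z\<^sup>2 + 4 * \<gamma>\<^sup>2)" by (rule real_le_rsqrt) simp
  moreover have "sqrt (z\<^sup>2 + 4 * \<gamma>\<^sup>2) \<le> z + 2 * \<gamma>"
    using assms by (intro real_le_lsqrt) (auto simp: power2_eq_square algebra_simps)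
  ultimately show "z \<le> half \<Psi> \<gamma> z" "half \<Psi> \<gamma> z \<le> z + \<gamma>"
    using assms by (cases \<Psi>; simp)+
qed

lemma half'_bounds:
  assumes "z \<ge> 0" "\<gamma> > 0"
  shows "1/2 \<le> half' \<Psi> \<gamma> z" "half' \<Psi> \<gamma> z \<le> 1"
proof -
  have "z \<le> sqrt (z\<^sup>2 + 4 * \<gamma>\<^sup>2)" by (rule real_le_rsqrt) simp
  moreover have "sqrt (z\<^sup>2 + 4 * \<gamma>\<^sup>2) > 0"
    using assms by (simp add: add_nonneg_pos)
  ultimately show "1/2 \<le> half' \<Psi> \<gamma> z" "half' \<Psi> \<gamma> z \<le> 1"
    using assms by (cases \<Psi>; simp add: field_simps)+
qed

lemma half_deriv:
  assumes "\<gamma> > 0"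
  shows "(half \<Psi> \<gamma> has_real_derivative half' \<Psi> \<gamma> z) (at z)"
proof (cases \<Psi>)
  case Psi1
  have "((\<lambda>z. z + \<gamma>) has_real_derivative 1) (at z)"
    by (auto intro!: derivative_eq_intros)
  then show ?thesis using Psi1 by (simp add: half.simps[abs_def])
next
  case Psi2
  have "z\<^sup>2 + 4 * \<gamma>\<^sup>2 > 0" using assms by (simp add: add_nonneg_pos)
  then have "((\<lambda>z. (z + sqrt (z\<^sup>2 + 4 * \<gamma>\<^sup>2)) / 2) has_real_derivative
      (1 + z / sqrt (z\<^sup>2 + 4 * \<gamma>\<^sup>2)) / 2) (at z)"
    by (auto intro!: derivative_eq_intros simp: field_simps)
  then show ?thesis using Psi2 by (simp add: half.simps[abs_def])
qed

lemma half'_cont: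
  assumes "\<gamma> > 0"
  shows "continuous_on A (half' \<Psi> \<gamma>)"
proof (cases \<Psi>)
  case Psi2
  have "z\<^sup>2 + 4 * \<gamma>\<^sup>2 > 0" for z using assms by (simp add: add_nonneg_pos)
  then have "z\<^sup>2 + 4 * \<gamma>\<^sup>2 \<noteq> 0" for z by (metis less_irrefl)
  then have "continuous_on A (\<lambda>z. (1 + z / sqrt (z\<^sup>2 + 4 * \<gamma>\<^sup>2)) / 2)"
    by (intro continuous_intros) (simp_all only: real_sqrt_eq_0_iff, simp_all)
  then show ?thesis using Psi2 by (simp add: half'.simps[abs_def])
next
  case Psi1
  then show ?thesis by (simp add: half'.simps[abs_def])
qed

lemma half_measurable [measurable]:
  "half \<Psi> \<gamma> \<in> borel_measurable borel" "half' \<Psi> \<gamma> \<in> borel_measurable borel"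
  by (cases \<Psi>; simp add: half.simps[abs_def] half'.simps[abs_def])+

text \<open>The substitution t = \<open>half \<Psi> \<gamma> z\<close> is made on [0,n], which
  \<open>half\<close> maps onto the interval from \<open>half \<Psi> \<gamma> 0\<close> = \<gamma>
  to \<open>half \<Psi> \<gamma> n\<close>; both sides are then monotone limits in n.\<close>

lemma nn_integral_half_subst:
  fixes f :: "real \<Rightarrow> real"
  assumes \<gamma>: "\<gamma> > 0" and [measurable]: "f \<in> borel_measurable borel" and f: "\<And>t. f t \<ge> 0"
  shows "(\<integral>\<^sup>+z. ennreal (half' \<Psi> \<gamma> z * f (half \<Psi> \<gamma> z)) * indicator {0..} z \<partial>lborel) =
    (\<integral>\<^sup>+t. ennreal (f t) * indicator {\<gamma>..} t \<partial>lborel)"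
proof -
  let ?G = "half \<Psi> \<gamma>" and ?G' = "half' \<Psi> \<gamma>"
  have G0: "?G 0 = \<gamma>" using \<gamma> by (cases \<Psi>) (simp_all add: real_sqrt_mult)
  have Gm: "?G a \<le> ?G b" if "0 \<le> a" "a \<le> b" for a b
  proof (rule DERIV_nonneg_imp_nondecreasing[OF that(2)])
    fix x assume "a \<le> x"
    then have "0 \<le> ?G' x" using half'_bounds(1)[OF _ \<gamma>, of x \<Psi>] that by simp
    then show "\<exists>y. (?G has_real_derivative y) (at x) \<and> 0 \<le> y"
      using half_deriv[OF \<gamma>, of \<Psi> x] by blast
  qed
  have Gi: "indicator {\<gamma>..?G (real m)} t \<le> (indicator {\<gamma>..?G (real n)} t :: ennreal)" if "m \<le> n" for m n t
    using Gm[of "real m" "real n"] that by (auto simp: indicator_def)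
  have ind: "ennreal (a * indicator A t) = ennreal a * indicator A t" for a A and t :: real
    by (simp add: indicator_def)
  have ind1: "(SUP n. indicator {0..real n} z :: ennreal) = indicator {0..} z" for z
  proof (rule antisym)
    show "indicator {0..} z \<le> (SUP n. indicator {0..real n} z :: ennreal)"
    proof (cases "z \<ge> 0")
      case True
      obtain n where "z \<le> real n" using real_arch_simple by blast
      then show ?thesis using True by (intro SUP_upper2[of n]) auto
    qed simp
  qed (auto intro!: SUP_least split: split_indicator)
  have ind2: "(SUP n. indicator {\<gamma>..?G (real n)} z :: ennreal) = indicator {\<gamma>..} z" for z
  proof (rule antisym)
    show "indicator {\<gamma>..} z \<le> (SUP n. indicator {\<gamma>..?G (real n)} z :: ennreal)"
    proof (cases "z \<ge> \<gamma>")
      case True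
      obtain n where "z \<le> real n" using real_arch_simple by blast
      then show ?thesis using True half_bounds[of "real n" \<gamma> \<Psi>] \<gamma> by (intro SUP_upper2[of n]) auto
    qed simp
  qed (auto intro!: SUP_least split: split_indicator)
  have "(\<integral>\<^sup>+z. ennreal (?G' z * f (?G z)) * indicator {0..} z \<partial>lborel) =
     (\<integral>\<^sup>+z. (SUP n. ennreal (?G' z * f (?G z)) * indicator {0..real n} z) \<partial>lborel)"
    by (simp add: ind1 flip: SUP_mult_left_ennreal)
  also have "\<dots> = (SUP n. \<integral>\<^sup>+z. ennreal (?G' z * f (?G z)) * indicator {0..real n} z \<partial>lborel)"
    by (intro nn_integral_monotone_convergence_SUP)
       (auto simp: incseq_def le_fun_def intro!: mult_left_mono split: split_indicator)
  also have "\<dots> = (SUP n. \<integral>\<^sup>+t. ennreal (f t) * indicator {\<gamma>..?G (real n)} t \<partial>lborel)"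
  proof (intro SUP_cong refl)
    fix n
    have "(\<integral>\<^sup>+t. ennreal (f t * indicator {?G 0..?G (real n)} t) \<partial>lborel) =
       (\<integral>\<^sup>+z. ennreal (f (?G z) * ?G' z * indicator {0..real n} z) \<partial>lborel)"
      using half_deriv[OF \<gamma>] half'_cont[OF \<gamma>] half'_bounds[OF _ \<gamma>, of _ \<Psi>]
      by (intro nn_integral_substitution) (auto simp: set_borel_measurable_def intro: order_trans[of 0 "1/2"])
    then show "(\<integral>\<^sup>+z. ennreal (?G' z * f (?G z)) * indicator {0..real n} z \<partial>lborel) =
      (\<integral>\<^sup>+t. ennreal (f t) * indicator {\<gamma>..?G (real n)} t \<partial>lborel)"
      by (simp only: G0 ind mult.commute[of "f _" "?G' _"])
  qed
  also have "\<dots> = (\<integral>\<^sup>+t. (SUP n. ennreal (f t) * indicator {\<gamma>..?G (real n)} t) \<partial>lborel)"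
    by (intro nn_integral_monotone_convergence_SUP[symmetric])
       (auto simp: incseq_def le_fun_def intro!: mult_left_mono Gi)
  also have "\<dots> = (\<integral>\<^sup>+t. ennreal (f t) * indicator {\<gamma>..} t \<partial>lborel)"
    by (simp add: ind2 flip: SUP_mult_left_ennreal)
  finally show ?thesis .
qed

text \<open>An affine change of variables. It puts the atom at 0 on the same footing as the
  continuous part: both are integrals of one Gaussian density with mean c.\<close>

lemma rho_eq_nn_integral:
  assumes \<sigma>: "\<sigma> > 0"
  shows "ennreal (rho \<sigma> \<gamma> c) = (\<integral>\<^sup>+t. ennreal (normal_density c \<sigma> t) * indicator {-\<gamma>..\<gamma>} t \<partial>lborel)"
proof -
  let ?D = "density lborel (\<lambda>t. ennreal (std_normal_density t))"
  interpret P: prob_space ?D by (rule prob_space_normal_density) simp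
  have "(\<integral>\<^sup>+t. ennreal (normal_density c \<sigma> t) * indicator {-\<gamma>..\<gamma>} t \<partial>lborel) =
    \<sigma> * (\<integral>\<^sup>+t. ennreal (normal_density c \<sigma> (c + \<sigma> * t)) * indicator {-\<gamma>..\<gamma>} (c + \<sigma> * t) \<partial>lborel)"
    using \<sigma> by (subst nn_integral_real_affine[of _ \<sigma> c]) auto
  also have "\<dots> = (\<integral>\<^sup>+t. ennreal \<sigma> * (ennreal (normal_density c \<sigma> (c + \<sigma> * t)) * indicator {-\<gamma>..\<gamma>} (c + \<sigma> * t)) \<partial>lborel)"
    by (subst nn_integral_cmult) auto
  also have "\<dots> = (\<integral>\<^sup>+t. ennreal (std_normal_density t) * indicator {t. \<bar>c + \<sigma> * t\<bar> \<le> \<gamma>} t \<partial>lborel)"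
  proof (intro nn_integral_cong)
    fix t
    have "\<sigma> * normal_density c \<sigma> (c + \<sigma> * t) = std_normal_density t"
      using \<sigma> by (simp add: normal_density_def real_sqrt_mult field_simps power2_eq_square)
    then show "ennreal \<sigma> * (ennreal (normal_density c \<sigma> (c + \<sigma> * t)) * indicator {-\<gamma>..\<gamma>} (c + \<sigma> * t)) =
      ennreal (std_normal_density t) * indicator {t. \<bar>c + \<sigma> * t\<bar> \<le> \<gamma>} t"
      using \<sigma> by (auto simp: indicator_def simp flip: ennreal_mult')
  qed
  also have "\<dots> = emeasure ?D {t. \<bar>c + \<sigma> * t\<bar> \<le> \<gamma>}"
    by (subst emeasure_density) auto
  also have "\<dots> = ennreal (rho \<sigma> \<gamma> c)"
    by (simp add: rho_def P.emeasure_eq_measure)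
  finally show ?thesis by simp
qed

text \<open>The positive z carry the Gaussian mass of [\<gamma>,\<infinity>), the negative z that of
  (-\<infinity>,-\<gamma>], and the atom that of [-\<gamma>,\<gamma>]; these intervals overlap only
  in null sets.\<close>

lemma phi_mass:
  assumes \<sigma>: "\<sigma> > 0" and \<gamma>: "\<gamma> > 0"
  shows "(\<integral>\<^sup>+z. ennreal (phi \<Psi> \<sigma> \<gamma> c z) \<partial>lborel) + ennreal (phi \<Psi> \<sigma> \<gamma> c 0) = 1"
proof -
  let ?n = "normal_density c \<sigma>" and ?G = "half \<Psi> \<gamma>" and ?G' = "half' \<Psi> \<gamma>"
  have nz: "AE z in lborel. z \<noteq> (a::real)" for a by (rule AE_lborel_singleton)
  have "(\<integral>\<^sup>+z. ennreal (phi \<Psi> \<sigma> \<gamma> c z) \<partial>lborel) =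
    (\<integral>\<^sup>+z. ennreal (?G' z * ?n (?G z)) * indicator {0..} z +
      ennreal (?G' (- z) * ?n (- ?G (- z))) * indicator {0..} (- z) \<partial>lborel)"
    by (intro nn_integral_cong_AE, use nz[of 0] in eventually_elim)
       (auto simp: phi_def f_Psi_half \<gamma> sgn_if indicator_def)
  also have "\<dots> = (\<integral>\<^sup>+z. ennreal (?G' z * ?n (?G z)) * indicator {0..} z \<partial>lborel) +
      (\<integral>\<^sup>+z. ennreal (?G' (- z) * ?n (- ?G (- z))) * indicator {0..} (- z) \<partial>lborel)"
    by (rule nn_integral_add) auto
  also have "(\<integral>\<^sup>+z. ennreal (?G' (- z) * ?n (- ?G (- z))) * indicator {0..} (- z) \<partial>lborel) =
     (\<integral>\<^sup>+z. ennreal (?G' z * ?n (- ?G z)) * indicator {0..} z \<partial>lborel)"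
    by (subst nn_integral_real_affine[of _ "-1" 0]) auto
  also have "\<dots> = (\<integral>\<^sup>+t. ennreal (?n (- t)) * indicator {\<gamma>..} t \<partial>lborel)"
    using \<gamma> by (intro nn_integral_half_subst) auto
  also have "\<dots> = (\<integral>\<^sup>+t. ennreal (?n t) * indicator {\<gamma>..} (- t) \<partial>lborel)"
    by (subst nn_integral_real_affine[of _ "-1" 0]) auto
  also have "(\<integral>\<^sup>+z. ennreal (?G' z * ?n (?G z)) * indicator {0..} z \<partial>lborel) =
    (\<integral>\<^sup>+t. ennreal (?n t) * indicator {\<gamma>..} t \<partial>lborel)"
    using \<gamma> by (intro nn_integral_half_subst) auto
  finally have "(\<integral>\<^sup>+z. ennreal (phi \<Psi> \<sigma> \<gamma> c z) \<partial>lborel) + ennreal (phi \<Psi> \<sigma> \<gamma> c 0) =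
    (\<integral>\<^sup>+t. ennreal (?n t) * indicator {\<gamma>..} t \<partial>lborel) + (\<integral>\<^sup>+t. ennreal (?n t) * indicator {\<gamma>..} (- t) \<partial>lborel)
     + (\<integral>\<^sup>+t. ennreal (?n t) * indicator {-\<gamma>..\<gamma>} t \<partial>lborel)"
    using \<sigma> by (simp add: phi_def rho_eq_nn_integral)
  also have "\<dots> = (\<integral>\<^sup>+t. ennreal (?n t) * indicator {\<gamma>..} t + ennreal (?n t) * indicator {\<gamma>..} (- t) +
      ennreal (?n t) * indicator {-\<gamma>..\<gamma>} t \<partial>lborel)"
    by (subst nn_integral_add[symmetric], simp, simp)+ simp
  also have "\<dots> = (\<integral>\<^sup>+t. ennreal (?n t) \<partial>lborel)"
    by (intro nn_integral_cong_AE, use nz[of \<gamma>] nz[of "-\<gamma>"] in eventually_elim)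
       (use \<gamma> in \<open>auto simp: indicator_def\<close>)
  also have "\<dots> = 1"
  proof -
    interpret P: prob_space "density lborel (\<lambda>t. ennreal (?n t))" using \<sigma> by (rule prob_space_normal_density)
    show ?thesis using P.emeasure_space_1 by (simp add: emeasure_density)
  qed
  finally show ?thesis .
qed

lemma phi_measurable [measurable]:
  assumes \<sigma>: "\<sigma> > 0" and \<gamma>: "\<gamma> > 0"
  shows "(\<lambda>(c, z). phi \<Psi> \<sigma> \<gamma> c z) \<in> borel_measurable (borel \<Otimes>\<^sub>M borel)"
proof -
  have "(\<lambda>c. \<integral>\<^sup>+t. ennreal (normal_density c \<sigma> t) * indicator {-\<gamma>..\<gamma>} t \<partial>lborel) \<in> borel_measurable borel"
    unfolding normal_density_def by measurable
  then have "(\<lambda>c. ennreal (rho \<sigma> \<gamma> c)) \<in> borel_measurable borel"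
    by (simp add: rho_eq_nn_integral \<sigma>)
  then have "(\<lambda>c. enn2real (ennreal (rho \<sigma> \<gamma> c))) \<in> borel_measurable borel" by measurable
  moreover have "rho \<sigma> \<gamma> = (\<lambda>c. enn2real (ennreal (rho \<sigma> \<gamma> c)))"
    by (auto simp: rho_def fun_eq_iff)
  ultimately have [measurable]: "rho \<sigma> \<gamma> \<in> borel_measurable borel"
    by simp
  have "(\<lambda>(c, z). phi \<Psi> \<sigma> \<gamma> c z) = (\<lambda>(c, z). if z = 0 then rho \<sigma> \<gamma> c else
     half' \<Psi> \<gamma> \<bar>z\<bar> * normal_density c \<sigma> (sgn z * half \<Psi> \<gamma> \<bar>z\<bar>))"
    using f_Psi_half[OF _ \<gamma>] by (auto simp: phi_def fun_eq_iff)
  also have "\<dots> \<in> borel_measurable (borel \<Otimes>\<^sub>M borel)"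
    unfolding normal_density_def by measurable
  finally show ?thesis .
qed

text \<open>The vectors t - c and z - x differ by some d with |d| at most \<gamma> + B, and (z -
  x)^2 \<le> 2 (t - c)^2 + 2 d^2. Comparing the exponents through this inequality doubles the
  variance, hence 4 \<sigma>^2 in place of 2 \<sigma>^2.\<close>

lemma normal_density_upper:
  assumes \<sigma>: "\<sigma> > 0" and "\<bar>t - z\<bar> \<le> \<gamma>" "\<bar>c - x\<bar> \<le> B"
  shows "normal_density c \<sigma> t \<le>
    1 / sqrt (2 * pi * \<sigma>\<^sup>2) * exp ((\<gamma> + B)\<^sup>2 / (2 * \<sigma>\<^sup>2)) * exp (- (z - x)\<^sup>2 / (4 * \<sigma>\<^sup>2))"
proof -
  define d where "d = (t - c) - (z - x)"
  have "\<bar>d\<bar> \<le> \<gamma> + B" using assms by (auto simp: d_def)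
  then have "d\<^sup>2 \<le> (\<gamma> + B)\<^sup>2" by (metis abs_le_square_iff abs_of_nonneg abs_ge_zero order_trans)
  moreover have "(z - x)\<^sup>2 \<le> 2 * (t - c)\<^sup>2 + 2 * d\<^sup>2"
    using zero_le_power2[of "(t - c) + d"] by (simp add: d_def power2_eq_square algebra_simps)
  ultimately have "- (t - c)\<^sup>2 / (2 * \<sigma>\<^sup>2) \<le> (\<gamma> + B)\<^sup>2 / (2 * \<sigma>\<^sup>2) + - (z - x)\<^sup>2 / (4 * \<sigma>\<^sup>2)"
    using \<sigma> by (simp add: field_simps)
  then have "exp (- (t - c)\<^sup>2 / (2 * \<sigma>\<^sup>2)) \<le> exp ((\<gamma> + B)\<^sup>2 / (2 * \<sigma>\<^sup>2)) * exp (- (z - x)\<^sup>2 / (4 * \<sigma>\<^sup>2))"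
    by (simp add: flip: exp_add)
  then show ?thesis
    unfolding normal_density_def mult.assoc by (rule mult_left_mono) simp
qed

lemma normal_density_lower:
  assumes \<sigma>: "\<sigma> > 0" and "\<bar>t - z\<bar> \<le> \<gamma>" "\<bar>c - x\<bar> \<le> B" "\<bar>z - x\<bar> \<le> K"
  shows "1 / sqrt (2 * pi * \<sigma>\<^sup>2) * exp (- (\<gamma> + B + K)\<^sup>2 / (2 * \<sigma>\<^sup>2)) \<le> normal_density c \<sigma> t"
proof -
  have "\<bar>t - c\<bar> \<le> \<gamma> + B + K" using assms by auto
  then have "(t - c)\<^sup>2 \<le> (\<gamma> + B + K)\<^sup>2" by (metis abs_le_square_iff abs_of_nonneg abs_ge_zero order_trans)
  then show ?thesis
    unfolding normal_density_def using \<sigma> by (intro mult_left_mono) (auto simp: divide_right_mono)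
qed

lemma rho_bounds:
  assumes \<sigma>: "\<sigma> > 0" and \<gamma>: "\<gamma> > 0" and "a \<ge> 0"
    and "\<And>t. \<bar>t\<bar> \<le> \<gamma> \<Longrightarrow> a \<le> normal_density c \<sigma> t" "\<And>t. \<bar>t\<bar> \<le> \<gamma> \<Longrightarrow> normal_density c \<sigma> t \<le> b"
  shows "2 * \<gamma> * a \<le> rho \<sigma> \<gamma> c" "rho \<sigma> \<gamma> c \<le> 2 * \<gamma> * b"
proof -
  have b: "b \<ge> 0" using order_trans[OF normal_density_nonneg assms(5)[of 0]] \<gamma> by simp
  have c: "(\<integral>\<^sup>+t. ennreal k * indicator {-\<gamma>..\<gamma>} t \<partial>lborel) = ennreal (2 * \<gamma> * k)" if "k \<ge> 0" for k
    using \<gamma> that by (simp add: nn_integral_cmult ennreal_mult' mult.commute)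
  have "ennreal (2 * \<gamma> * a) \<le> ennreal (rho \<sigma> \<gamma> c)"
    unfolding c[OF \<open>a \<ge> 0\<close>, symmetric] rho_eq_nn_integral[OF \<sigma>]
    by (intro nn_integral_mono) (auto simp: indicator_def intro!: ennreal_leI assms(4))
  then show "2 * \<gamma> * a \<le> rho \<sigma> \<gamma> c" by (simp add: rho_def ennreal_le_iff)
  have "ennreal (rho \<sigma> \<gamma> c) \<le> ennreal (2 * \<gamma> * b)"
    unfolding c[OF b, symmetric] rho_eq_nn_integral[OF \<sigma>]
    by (intro nn_integral_mono) (auto simp: indicator_def intro!: ennreal_leI assms(5))
  then show "rho \<sigma> \<gamma> c \<le> 2 * \<gamma> * b" using b \<gamma> by (simp add: ennreal_le_iff)
qed

text \<open>The factor \<open>max 1 (2 * \<gamma>)\<close> serves both cases: off 0 the Jacobian is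
  at most 1, and at 0 the Gaussian is integrated over an interval of length 2\<gamma> all of whose
  points are within \<gamma> of 0. The factor \<open>min (1/2) (2 * \<gamma>)\<close> of the lower
  bound arises in the same way.\<close>

lemma phi_upper:
  assumes \<sigma>: "\<sigma> > 0" and \<gamma>: "\<gamma> > 0" and cx: "\<bar>c - x\<bar> \<le> B"
  shows "phi \<Psi> \<sigma> \<gamma> c z \<le> max 1 (2 * \<gamma>) / sqrt (2 * pi * \<sigma>\<^sup>2) * exp ((\<gamma> + B)\<^sup>2 / (2 * \<sigma>\<^sup>2)) *
     exp (- (z - x)\<^sup>2 / (4 * \<sigma>\<^sup>2))"
proof (cases "z = 0")
  case True
  have "rho \<sigma> \<gamma> c \<le> 2 * \<gamma> * (1 / sqrt (2 * pi * \<sigma>\<^sup>2) * exp ((\<gamma> + B)\<^sup>2 / (2 * \<sigma>\<^sup>2)) * exp (- (z - x)\<^sup>2 / (4 * \<sigma>\<^sup>2)))"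
    by (rule rho_bounds(2)[OF \<sigma> \<gamma> order_refl])
      (use True normal_density_upper[OF \<sigma> _ cx, of _ z] in auto)
  also have "\<dots> \<le> max 1 (2 * \<gamma>) * (1 / sqrt (2 * pi * \<sigma>\<^sup>2) * exp ((\<gamma> + B)\<^sup>2 / (2 * \<sigma>\<^sup>2)) * exp (- (z - x)\<^sup>2 / (4 * \<sigma>\<^sup>2)))"
    by (intro mult_right_mono) auto
  finally show ?thesis using True by (simp add: phi_def)
next
  case False
  let ?t = "sgn z * half \<Psi> \<gamma> \<bar>z\<bar>"
  have t: "\<bar>?t - z\<bar> \<le> \<gamma>"
    using half_bounds[of "\<bar>z\<bar>" \<gamma> \<Psi>] \<gamma> False by (auto simp: sgn_if)
  have "phi \<Psi> \<sigma> \<gamma> c z \<le> 1 * normal_density c \<sigma> ?t"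
    using False half'_bounds[of "\<bar>z\<bar>" \<gamma> \<Psi>] \<gamma> unfolding phi_def f_Psi_half[OF False \<gamma>]
    by (simp only: if_False) (intro mult_right_mono, auto)
  also have "\<dots> \<le> max 1 (2 * \<gamma>) * normal_density c \<sigma> ?t"
    by (intro mult_right_mono) auto
  also have "\<dots> \<le> max 1 (2 * \<gamma>) * (1 / sqrt (2 * pi * \<sigma>\<^sup>2) * exp ((\<gamma> + B)\<^sup>2 / (2 * \<sigma>\<^sup>2)) * exp (- (z - x)\<^sup>2 / (4 * \<sigma>\<^sup>2)))"
    using normal_density_upper[OF \<sigma> t cx] by (intro mult_left_mono) auto
  finally show ?thesis by simp
qed

lemma phi_lower:
  assumes \<sigma>: "\<sigma> > 0" and \<gamma>: "\<gamma> > 0" and cx: "\<bar>c - x\<bar> \<le> B" and zx: "\<bar>z - x\<bar> \<le> K"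
  shows "min (1/2) (2 * \<gamma>) / sqrt (2 * pi * \<sigma>\<^sup>2) * exp (- (\<gamma> + B + K)\<^sup>2 / (2 * \<sigma>\<^sup>2)) \<le> phi \<Psi> \<sigma> \<gamma> c z"
proof (cases "z = 0")
  case True
  have "min (1/2) (2 * \<gamma>) * (1 / sqrt (2 * pi * \<sigma>\<^sup>2) * exp (- (\<gamma> + B + K)\<^sup>2 / (2 * \<sigma>\<^sup>2))) \<le>
    2 * \<gamma> * (1 / sqrt (2 * pi * \<sigma>\<^sup>2) * exp (- (\<gamma> + B + K)\<^sup>2 / (2 * \<sigma>\<^sup>2)))"
    by (intro mult_right_mono) auto
  also have "\<dots> \<le> rho \<sigma> \<gamma> c"
    by (rule rho_bounds(1)[OF \<sigma> \<gamma>])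
      (use True normal_density_lower[OF \<sigma> _ cx zx] normal_density_upper[OF \<sigma> _ cx, of _ z \<gamma>] in auto)
  finally show ?thesis using True by (simp add: phi_def)
next
  case False
  let ?t = "sgn z * half \<Psi> \<gamma> \<bar>z\<bar>"
  have t: "\<bar>?t - z\<bar> \<le> \<gamma>"
    using half_bounds[of "\<bar>z\<bar>" \<gamma> \<Psi>] \<gamma> False by (auto simp: sgn_if)
  have "min (1/2) (2 * \<gamma>) * (1 / sqrt (2 * pi * \<sigma>\<^sup>2) * exp (- (\<gamma> + B + K)\<^sup>2 / (2 * \<sigma>\<^sup>2))) \<le>
    min (1/2) (2 * \<gamma>) * normal_density c \<sigma> ?t"
    using normal_density_lower[OF \<sigma> t cx zx] \<gamma> by (intro mult_left_mono) auto
  also have "\<dots> \<le> half' \<Psi> \<gamma> \<bar>z\<bar> * normal_density c \<sigma> ?t"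
    using half'_bounds[of "\<bar>z\<bar>" \<gamma> \<Psi>] \<gamma> by (intro mult_right_mono) auto
  also have "\<dots> = phi \<Psi> \<sigma> \<gamma> c z"
    using False by (simp only: phi_def f_Psi_half[OF False \<gamma>] if_False)
  finally show ?thesis by simp
qed

section \<open>Harris' theorem\<close>

lemma (in prob_space) nn_integral_le_imp_integrable:
  assumes "f \<in> borel_measurable M" "\<And>x. 0 \<le> f x" "(\<integral>\<^sup>+x. ennreal (f x) \<partial>M) \<le> ennreal B" "0 \<le> B"
  shows "integrable M f" "integral\<^sup>L M f \<le> B"
proof -
  show i: "integrable M f"
    using assms by (intro integrableI_nonneg) (auto intro: le_less_trans)
  show "integral\<^sup>L M f \<le> B"
    using assms by (simp add: nn_integral_eq_integral[OF i] ennreal_le_iff)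
qed

text \<open>Every lower bound -\<phi>(y) - (1 + b V(y)) for an admissible constant lies below every
  upper bound 1 + b V(x) - \<phi>(x), so the infimum of the upper bounds is admissible. This is the
  duality between the weighted oscillation and the weighted sup norm modulo constants.\<close>

lemma oscillation_shift:
  fixes \<phi> V :: "'a \<Rightarrow> real"
  assumes osc: "\<And>x y. \<bar>\<phi> x - \<phi> y\<bar> \<le> 2 + b * V x + b * V y"
  obtains k where "\<And>x. \<bar>\<phi> x + k\<bar> \<le> 1 + b * V x"
proof
  let ?h = "\<lambda>x. 1 + b * V x - \<phi> x"
  have lower: "- \<phi> y - (1 + b * V y) \<le> ?h x" for x y
    using osc[of x y] by (simp add: abs_le_iff)
  then have bdd: "bdd_below (range ?h)" by (intro bdd_belowI2[of _ "- \<phi> y - (1 + b * V y)" for y])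
  show "\<bar>\<phi> x + Inf (range ?h)\<bar> \<le> 1 + b * V x" for x
  proof -
    have "Inf (range ?h) \<le> ?h x" by (rule cInf_lower[OF _ bdd]) simp
    moreover have "- \<phi> x - (1 + b * V x) \<le> Inf (range ?h)"
      by (rule cInf_greatest) (use lower in auto)
    ultimately show ?thesis by (simp add: abs_le_iff)
  qed
qed

section \<open>Markov kernels, their iterates and the contraction of oscillations\<close>

context
  fixes P :: "'a::t1_space \<Rightarrow> 'a measure"
  assumes P_kernel: "P \<in> borel \<rightarrow>\<^sub>M subprob_algebra borel"
    and P_prob: "\<And>x. prob_space (P x)"
begin

lemma sets_P: "sets (P x) = sets borel"
  using sets_kernel[OF P_kernel] by simp

lemma iter_kernel_measurable: "iter_kernel P n \<in> borel \<rightarrow>\<^sub>M subprob_algebra borel"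
proof (induction n)
  case 0
  have "iter_kernel P 0 = return borel" by (auto simp: fun_eq_iff)
  then show ?case by simp
next
  case (Suc n)
  have "iter_kernel P (Suc n) = (\<lambda>x. bind (P x) (iter_kernel P n))" by (auto simp: fun_eq_iff)
  then show ?case by (simp add: measurable_bind2[OF P_kernel Suc])
qed

lemma sets_iter_kernel: "sets (iter_kernel P n x) = sets borel"
  using sets_kernel[OF iter_kernel_measurable] by simp

lemma nn_integral_iter_kernel_Suc:
  assumes "f \<in> borel_measurable borel"
  shows "(\<integral>\<^sup>+y. f y \<partial>iter_kernel P (Suc n) x) = (\<integral>\<^sup>+y. \<integral>\<^sup>+z. f z \<partial>iter_kernel P n y \<partial>P x)"
proof -
  have "iter_kernel P n \<in> P x \<rightarrow>\<^sub>M subprob_algebra borel"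
    using iter_kernel_measurable by (simp add: measurable_cong_sets[OF sets_P refl])
  then show ?thesis using assms by (simp add: nn_integral_bind)
qed

lemma nn_integral_iter_kernel_measurable:
  assumes "f \<in> borel_measurable borel"
  shows "(\<lambda>x. \<integral>\<^sup>+y. f y \<partial>iter_kernel P n x) \<in> borel_measurable borel"
  using measurable_compose[OF iter_kernel_measurable nn_integral_measurable_subprob_algebra[OF assms]] .

lemma nn_integral_iter_kernel_le:
  assumes V: "V \<in> borel_measurable borel" and "\<And>x. 0 \<le> V x" "0 \<le> B"
    and drift: "\<And>x. (\<integral>\<^sup>+y. ennreal (V y) \<partial>P x) \<le> ennreal (B * V x)"
  shows "(\<integral>\<^sup>+y. ennreal (V y) \<partial>iter_kernel P n x) \<le> ennreal (B ^ n * V x)"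
proof (induction n arbitrary: x)
  case 0
  then show ?case using V by (simp add: nn_integral_return)
next
  case (Suc n)
  note V' = V[unfolded measurable_cong_sets[OF sets_P refl, symmetric]]
  have "(\<integral>\<^sup>+y. ennreal (V y) \<partial>iter_kernel P (Suc n) x) \<le> (\<integral>\<^sup>+y. ennreal (B ^ n) * ennreal (V y) \<partial>P x)"
    using V by (subst nn_integral_iter_kernel_Suc)
      (auto intro!: nn_integral_mono Suc simp: assms simp flip: ennreal_mult')
  also have "\<dots> = ennreal (B ^ n) * (\<integral>\<^sup>+y. ennreal (V y) \<partial>P x)"
    using V by (intro nn_integral_cmult) (simp add: measurable_cong_sets[OF sets_P refl])
  also have "\<dots> \<le> ennreal (B ^ n) * ennreal (B * V x)"
    by (intro mult_left_mono drift) simp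
  finally show ?case using assms by (simp add: mult_ac flip: ennreal_mult')
qed

text \<open>Where \<open>V\<close> is large, the contraction comes from the drift; where \<open>V\<close> is small, from the mass that
  \<open>P x\<close> puts on \<open>a\<close>.\<close>

lemma weighted_oscillation_contraction:
  assumes V [measurable]: "V \<in> borel_measurable borel" and V1: "\<And>x. 1 \<le> V x"
    and drift: "\<And>x. (\<integral>\<^sup>+y. ennreal (V y) \<partial>P x) \<le> ennreal (l * V x + K)"
    and l: "0 \<le> l" "l < 1" and K: "K > 0"
    and minor: "\<And>R. \<exists>e>0. \<forall>x. V x \<le> R \<longrightarrow> e \<le> measure (P x) {a}"
  obtains b r where "b > 0" "0 < r" "r < 1"
    "\<And>\<phi> A x y. \<phi> \<in> borel_measurable borel \<Longrightarrow> A > 0 \<Longrightarrow>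
       (\<And>x y. \<bar>\<phi> x - \<phi> y\<bar> \<le> A * (2 + b * V x + b * V y)) \<Longrightarrow>
       \<bar>(\<integral>z. \<phi> z \<partial>P x) - (\<integral>z. \<phi> z \<partial>P y)\<bar> \<le> r * A * (2 + b * V x + b * V y)"
proof -
  \<comment> \<open>If V(x) + V(y) is at least \<open>R\<close>, then 2K is at most half of (1 -
    l)(V(x) + V(y)), so the drift factor \<open>l\<close> worsens only to \<open>k\<close>. The
    weight \<open>b\<close> satisfies 2 b K = e, so that for small V the additive constant of the
    drift uses up only half of the gain 2e from the common mass at \<open>a\<close>. In
    \<open>r\<close> the entry 1/2 ensures positivity.\<close>
  define R where "R = 4 * K / (1 - l)"
  obtain e where e: "e > 0" "\<And>x. V x \<le> R \<Longrightarrow> e \<le> measure (P x) {a}" using minor[of R] by auto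
  define b where "b = e / (2 * K)"
  define k where "k = (1 + l) / 2"
  define r where "r = Max {1/2, 1 - e/2, l, (2 + b * R * k) / (2 + b * R)}"
  have R: "R > 0" using K l by (simp add: R_def)
  have b: "b > 0" using e K by (simp add: b_def)
  have k: "k < 1" using l by (simp add: k_def)
  have bR: "2 + b * R > 0" using b R by (simp add: add_pos_pos)
  have r: "1/2 \<le> r" "1 - e/2 \<le> r" "l \<le> r" "(2 + b * R * k) / (2 + b * R) \<le> r"
    by (auto simp: r_def)
  have "(2 + b * R * k) / (2 + b * R) < 1"
    using bR b R k by simp
  then have r1: "r < 1" using e l by (simp add: r_def)
  have le: "(\<integral>z. \<psi> z \<partial>P x) - (\<integral>z. \<psi> z \<partial>P y) \<le> r * (2 + b * V x + b * V y)"
    if \<psi> [measurable]: "\<psi> \<in> borel_measurable borel" and bd: "\<And>x. \<bar>\<psi> x\<bar> \<le> 1 + b * V x" for \<psi> x y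
  proof -
    let ?h = "\<lambda>x. 1 + b * V x"
    have hp: "0 \<le> ?h x" for x using b V1[of x] by simp
    have int: "integrable (P x) ?h" "(\<integral>z. ?h z \<partial>P x) \<le> 1 + b * (l * V x + K)"
      "integrable (P x) \<psi>" for x
    proof -
      interpret prob_space "P x" by (rule P_prob)
      have Vx: "V \<in> borel_measurable (P x)" "\<psi> \<in> borel_measurable (P x)"
        by (simp_all add: measurable_cong_sets[OF sets_P refl])
      have i: "integrable (P x) V" "integral\<^sup>L (P x) V \<le> l * V x + K"
        using nn_integral_le_imp_integrable[OF Vx(1) _ drift] V1 l K
        by (auto intro: order_trans[OF zero_le_one])
      show ih: "integrable (P x) ?h" using i by simp
      show "(\<integral>z. ?h z \<partial>P x) \<le> 1 + b * (l * V x + K)"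
        using i b by (simp add: prob_space)
      show "integrable (P x) \<psi>"
        by (rule Bochner_Integration.integrable_bound[OF ih Vx(2)]) (use bd hp in auto)
    qed
    show ?thesis
    proof (cases "V x + V y \<ge> R")
      case True
      have "(\<integral>z. \<psi> z \<partial>P x) \<le> (\<integral>z. ?h z \<partial>P x)"
        using bd int by (intro integral_mono) (auto simp: abs_le_iff)
      moreover have "(\<integral>z. - ?h z \<partial>P y) \<le> (\<integral>z. \<psi> z \<partial>P y)"
      proof (rule integral_mono)
        show "- ?h z \<le> \<psi> z" for z using bd[of z] by (simp add: abs_le_iff)
      qed (use int in \<open>auto intro!: Bochner_Integration.integrable_minus simp del: minus_add_distrib\<close>)
      ultimately have "(\<integral>z. \<psi> z \<partial>P x) - (\<integral>z. \<psi> z \<partial>P y) \<le> (\<integral>z. ?h z \<partial>P x) + (\<integral>z. ?h z \<partial>P y)"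
        by (simp only: Bochner_Integration.integral_minus)
      also have "\<dots> \<le> 2 + b * (l * (V x + V y) + 2 * K)"
        using int(2)[of x] int(2)[of y] by (simp add: algebra_simps)
      also have "\<dots> \<le> 2 + b * (k * (V x + V y))"
      proof -
        have "2 * K \<le> (1 - l) / 2 * (V x + V y)"
          using True l by (simp add: R_def field_simps)
        then have "l * (V x + V y) + 2 * K \<le> k * (V x + V y)"
          by (simp add: k_def field_simps)
        then show ?thesis using b by simp
      qed
      \<comment> \<open>For k < 1 the quotient (2 + b k s) / (2 + b s) decreases in s, so its value
        at s = R is the worst case.\<close>
      also have "\<dots> \<le> (2 + b * R * k) / (2 + b * R) * (2 + b * (V x + V y))"
      proof -
        have "(V x + V y - R) * (1 - k) * b \<ge> 0" using True k b by simp
        then show ?thesis using bR by (simp add: field_simps)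
      qed
      also have "\<dots> \<le> r * (2 + b * (V x + V y))"
        using r(4) b V1[of x] V1[of y] by (intro mult_right_mono) (auto intro!: add_nonneg_nonneg)
      finally show ?thesis by (simp add: algebra_simps)
    next
      case False
      have low: "e * u a \<le> (\<integral>z. u z \<partial>P w)"
        if "\<And>z. 0 \<le> u z" "integrable (P w) u" "V w \<le> R" for u w
      proof -
        interpret prob_space "P w" by (rule P_prob)
        have m: "{a} \<in> sets (P w)" by (simp add: sets_P)
        have "e * u a \<le> measure (P w) {a} * u a"
          using e(2)[OF that(3)] that(1) by (intro mult_right_mono)
        also have "\<dots> = (\<integral>z. u a * indicator {a} z \<partial>P w)"
          using m by simp
        also have "\<dots> \<le> (\<integral>z. u z \<partial>P w)"
        proof (rule integral_mono)
          have "integrable (P w) (indicator {a} :: _ \<Rightarrow> real)"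
            using m by (rule integrable_real_indicator) (simp add: less_top[symmetric])
          then show "integrable (P w) (\<lambda>z. u a * indicator {a} z)"
            by (rule integrable_mult_right)
        qed (use that in \<open>auto simp: indicator_def\<close>)
        finally show ?thesis .
      qed
      have Vle: "V x \<le> R" "V y \<le> R" using False V1[of x] V1[of y] by auto
      \<comment> \<open>The mass at \<open>a\<close> is exploited for the nonnegative functions h -
        \<psi> under \<open>P x\<close> and h + \<psi> under \<open>P y\<close>. On adding the two,
        \<psi>(a) cancels and the gain 2 e h(a) remains.\<close>
      have "e * (?h a - \<psi> a) \<le> (\<integral>z. ?h z - \<psi> z \<partial>P x)"
        using bd int Vle by (intro low) (auto simp: abs_le_iff)
      moreover have "e * (?h a + \<psi> a) \<le> (\<integral>z. ?h z + \<psi> z \<partial>P y)"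
        using int Vle
      proof (intro low)
        show "0 \<le> ?h z + \<psi> z" for z using bd[of z] by (simp add: abs_le_iff)
      qed auto
      ultimately have "(\<integral>z. \<psi> z \<partial>P x) - (\<integral>z. \<psi> z \<partial>P y) \<le> (\<integral>z. ?h z \<partial>P x) + (\<integral>z. ?h z \<partial>P y) - 2 * e * ?h a"
        using int by (simp only: Bochner_Integration.integral_diff Bochner_Integration.integral_add) (simp add: algebra_simps)
      also have "\<dots> \<le> 2 + b * (l * (V x + V y) + 2 * K) - 2 * e"
      proof -
        have "e * 1 \<le> e * ?h a" using e b V1[of a] by (intro mult_left_mono) auto
        then show ?thesis using int(2)[of x] int(2)[of y] by (simp add: algebra_simps)
      qed
      also have "\<dots> = 2 * (1 - e / 2) + l * (b * (V x + V y))"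
        using K by (simp add: b_def field_simps)
      also have "\<dots> \<le> 2 * r + r * (b * (V x + V y))"
        using r b V1[of x] V1[of y] by (intro add_mono mult_right_mono mult_left_mono) auto
      finally show ?thesis by (simp add: algebra_simps)
    qed
  qed
  show thesis
  proof (rule that[of b r])
    fix \<phi> A x y
    assume \<phi> [measurable]: "\<phi> \<in> borel_measurable borel" and A: "A > 0"
      and osc: "\<And>x y. \<bar>\<phi> x - \<phi> y\<bar> \<le> A * (2 + b * V x + b * V y)"
    have "\<bar>\<phi> x / A - \<phi> y / A\<bar> \<le> 2 + b * V x + b * V y" for x y
      using osc[of x y] A by (simp add: field_simps abs_le_iff)
    then obtain k where k: "\<And>x. \<bar>\<phi> x / A + k\<bar> \<le> 1 + b * V x"
      using oscillation_shift[of "\<lambda>x. \<phi> x / A" b V] by blast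
    define \<psi> where "\<psi> = (\<lambda>x. \<phi> x / A + k)"
    have \<psi>: "\<psi> \<in> borel_measurable borel" "\<And>x. \<bar>\<psi> x\<bar> \<le> 1 + b * V x"
      using k by (auto simp: \<psi>_def)
    have eq: "(\<integral>z. \<psi> z \<partial>P x) = (\<integral>z. \<phi> z \<partial>P x) / A + k" for x
    proof -
      interpret prob_space "P x" by (rule P_prob)
      have Vx: "V \<in> borel_measurable (P x)" "\<phi> \<in> borel_measurable (P x)"
        by (simp_all add: measurable_cong_sets[OF sets_P refl])
      have i: "integrable (P x) V"
        using nn_integral_le_imp_integrable[OF Vx(1) _ drift] V1 l K
        by (auto intro: order_trans[OF zero_le_one])
      have "integrable (P x) (\<lambda>z. A * (1 + b * V z) + A * \<bar>k\<bar>)" using i by simp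
      then have "integrable (P x) \<phi>"
      proof (rule Bochner_Integration.integrable_bound[OF _ Vx(2)])
        have "\<bar>\<phi> z / A\<bar> \<le> 1 + b * V z + \<bar>k\<bar>" for z using k[of z] by arith
        then have "\<bar>\<phi> z\<bar> \<le> A * (1 + b * V z) + A * \<bar>k\<bar>" for z
          using A by (simp add: field_simps)
        then show "AE z in P x. norm (\<phi> z) \<le> norm (A * (1 + b * V z) + A * \<bar>k\<bar>)"
          by (intro AE_I2) (auto intro: order_trans abs_ge_self)
      qed
      then show ?thesis by (simp add: \<psi>_def prob_space)
    qed
    have "\<bar>(\<integral>z. \<psi> z \<partial>P x) - (\<integral>z. \<psi> z \<partial>P y)\<bar> \<le> r * (2 + b * V x + b * V y)"
      using le[OF \<psi>, of x y] le[OF \<psi>, of y x] by (simp add: abs_le_iff algebra_simps)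
    then show "\<bar>(\<integral>z. \<phi> z \<partial>P x) - (\<integral>z. \<phi> z \<partial>P y)\<bar> \<le> r * A * (2 + b * V x + b * V y)"
    proof -
      assume "\<bar>(\<integral>z. \<psi> z \<partial>P x) - (\<integral>z. \<psi> z \<partial>P y)\<bar> \<le> r * (2 + b * V x + b * V y)"
      moreover have "(\<integral>z. \<psi> z \<partial>P x) - (\<integral>z. \<psi> z \<partial>P y) = ((\<integral>z. \<phi> z \<partial>P x) - (\<integral>z. \<phi> z \<partial>P y)) / A"
        unfolding eq by (simp add: diff_divide_distrib)
      ultimately show ?thesis using A by (simp add: pos_divide_le_eq mult_ac)
    qed
  qed (use b r r1 in auto)
qed

text \<open>Invariance applied to the truncation \<open>min V N\<close> makes the drift inequality integrable.\<close>

lemma invariant_integrable_drift: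
  assumes M: "prob_space M" "sets M = sets borel"
    and inv: "\<And>f. f \<in> borel_measurable borel \<Longrightarrow> (\<integral>\<^sup>+x. \<integral>\<^sup>+y. f y \<partial>P x \<partial>M) = (\<integral>\<^sup>+x. f x \<partial>M)"
    and V [measurable]: "V \<in> borel_measurable borel" and V1: "\<And>x. 1 \<le> V x"
    and drift: "\<And>x. (\<integral>\<^sup>+y. ennreal (V y) \<partial>P x) \<le> ennreal (l * V x + K)"
    and l: "0 \<le> l" "l < 1" and K: "K > 0"
  shows "integrable M V"
proof -
  interpret M: prob_space M by fact
  note [measurable_cong] = M(2)
  have V0: "0 \<le> V x" for x using V1[of x] by simp
  have bound: "(\<integral>\<^sup>+x. ennreal (V x) * indicator {x. V x \<le> real N} x \<partial>M) \<le> ennreal (K / (1 - l))" for N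
  proof -
    let ?f = "\<lambda>x. min (V x) (real N)" and ?g = "\<lambda>x. min (real N) (l * V x + K)"
    have g0: "0 \<le> ?g x" for x using V0 l K by simp
    have i: "integrable M ?f" "integrable M ?g"
      using V0 g0 by (auto intro!: M.integrable_const_bound[where B="real N"])
    have "ennreal (\<integral>x. ?f x \<partial>M) = (\<integral>\<^sup>+x. ennreal (?f x) \<partial>M)"
      using V0 i by (intro nn_integral_eq_integral[symmetric]) auto
    also have "\<dots> = (\<integral>\<^sup>+x. \<integral>\<^sup>+y. ennreal (?f y) \<partial>P x \<partial>M)"
      by (rule inv[symmetric]) simp
    also have "\<dots> \<le> (\<integral>\<^sup>+x. ennreal (?g x) \<partial>M)"
    proof (intro nn_integral_mono)
      fix x
      interpret prob_space "P x" by (rule P_prob)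
      have "(\<integral>\<^sup>+y. ennreal (?f y) \<partial>P x) \<le> (\<integral>\<^sup>+y. ennreal (real N) \<partial>P x)"
        by (intro nn_integral_mono ennreal_leI) simp
      moreover have "(\<integral>\<^sup>+y. ennreal (?f y) \<partial>P x) \<le> (\<integral>\<^sup>+y. ennreal (V y) \<partial>P x)"
        by (intro nn_integral_mono ennreal_leI) simp
      ultimately have "(\<integral>\<^sup>+y. ennreal (?f y) \<partial>P x) \<le> ennreal (real N)"
        "(\<integral>\<^sup>+y. ennreal (?f y) \<partial>P x) \<le> ennreal (l * V x + K)"
        using drift[of x] by (auto simp: emeasure_space_1 intro: order_trans)
      then show "(\<integral>\<^sup>+y. ennreal (?f y) \<partial>P x) \<le> ennreal (?g x)"
        by (cases "real N \<le> l * V x + K") (simp_all only: min_def if_True if_False)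
    qed
    also have "\<dots> = ennreal (\<integral>x. ?g x \<partial>M)"
      using g0 i by (intro nn_integral_eq_integral) auto
    finally have "(\<integral>x. ?f x \<partial>M) \<le> (\<integral>x. ?g x \<partial>M)"
      using g0 by (simp add: ennreal_le_iff integral_nonneg)
    then have "(\<integral>x. ?f x - ?g x \<partial>M) \<le> 0" using i by simp
    moreover have ii: "integrable M (\<lambda>x. V x * indicator {x. V x \<le> real N} x)"
      using V0 by (intro M.integrable_const_bound[where B="real N"]) (auto simp: indicator_def)
    have "(\<integral>x. (1 - l) * (V x * indicator {x. V x \<le> real N} x) - K \<partial>M) \<le> (\<integral>x. ?f x - ?g x \<partial>M)"
    proof (rule integral_mono)
      \<comment> \<open>Where V exceeds N, the truncation equals N, which is at least the right-hand
        truncation, so the difference is nonnegative there. On the sublevel set it is at least (1 -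
        l) V - K.\<close>
      show "(1 - l) * (V x * indicator {x. V x \<le> real N} x) - K \<le> ?f x - ?g x" for x
        using K by (auto simp: indicator_def min_def algebra_simps)
    qed (use ii i in auto)
    ultimately have "(1 - l) * (\<integral>x. V x * indicator {x. V x \<le> real N} x \<partial>M) - K \<le> 0"
      using ii by (simp add: M.prob_space)
    then have "(\<integral>x. V x * indicator {x. V x \<le> real N} x \<partial>M) \<le> K / (1 - l)"
      using l by (simp add: field_simps)
    then have "(\<integral>\<^sup>+x. ennreal (V x * indicator {x. V x \<le> real N} x) \<partial>M) \<le> ennreal (K / (1 - l))"
      using V0 by (subst nn_integral_eq_integral[OF ii]) (auto intro: ennreal_leI)
    moreover have "ennreal (V x * indicator {x. V x \<le> real N} x) = ennreal (V x) * indicator {x. V x \<le> real N} x" for x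
      by (simp add: indicator_def)
    ultimately show ?thesis by simp
  qed
  have sup: "(SUP N. ennreal (V x) * indicator {x. V x \<le> real N} x) = ennreal (V x)" for x
  proof (rule antisym)
    obtain N where "V x \<le> real N" using real_arch_simple by blast
    then show "ennreal (V x) \<le> (SUP N. ennreal (V x) * indicator {x. V x \<le> real N} x)"
      by (intro SUP_upper2[of N]) auto
  qed (auto intro!: SUP_least simp: indicator_def)
  have "(\<integral>\<^sup>+x. ennreal (V x) \<partial>M) = (\<integral>\<^sup>+x. (SUP N. ennreal (V x) * indicator {x. V x \<le> real N} x) \<partial>M)"
    by (simp only: sup)
  also have "\<dots> = (SUP N. \<integral>\<^sup>+x. ennreal (V x) * indicator {x. V x \<le> real N} x \<partial>M)"
    by (intro nn_integral_monotone_convergence_SUP)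
       (auto simp: incseq_def le_fun_def indicator_def)
  also have "\<dots> \<le> ennreal (K / (1 - l))" by (intro SUP_least bound)
  finally show ?thesis
    using V0 K l by (intro M.nn_integral_le_imp_integrable(1)[where B="K / (1 - l)"]) auto
qed

lemma iter_kernel_invariant:
  assumes "sets M = sets borel"
    and inv: "\<And>f. f \<in> borel_measurable borel \<Longrightarrow> (\<integral>\<^sup>+x. \<integral>\<^sup>+y. f y \<partial>P x \<partial>M) = (\<integral>\<^sup>+x. f x \<partial>M)"
    and f: "f \<in> borel_measurable borel"
  shows "(\<integral>\<^sup>+x. \<integral>\<^sup>+y. f y \<partial>iter_kernel P n x \<partial>M) = (\<integral>\<^sup>+x. f x \<partial>M)"
proof (induction n)
  case 0
  then show ?case using f by (simp add: nn_integral_return)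
next
  case (Suc n)
  then show ?case
    using inv[OF nn_integral_iter_kernel_measurable[OF f, of n]] by (simp only: nn_integral_iter_kernel_Suc[OF f])
qed

text \<open>The oscillation of \<open>P^n f\<close> relative to the weight 2 + b V(x) + b V(y)
  shrinks by \<open>r\<close> at each step. By invariance \<open>P^n f\<close> and f have the same
  mean under \<open>M\<close>, so the deviation of \<open>P^n f\<close> at x from M(f) is an average
  over y of its oscillation between x and y, which is finite as V is integrable under
  \<open>M\<close>.\<close>

lemma harris_theorem:
  assumes M: "prob_space M" "sets M = sets borel"
    and inv: "\<And>f. f \<in> borel_measurable borel \<Longrightarrow> (\<integral>\<^sup>+x. \<integral>\<^sup>+y. f y \<partial>P x \<partial>M) = (\<integral>\<^sup>+x. f x \<partial>M)"
    and V [measurable]: "V \<in> borel_measurable borel" and V1: "\<And>x. 1 \<le> V x"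
    and drift: "\<And>x. (\<integral>\<^sup>+y. ennreal (V y) \<partial>P x) \<le> ennreal (l * V x + K)"
    and l: "0 \<le> l" "l < 1" and K: "K > 0"
    and minor: "\<And>R. \<exists>e>0. \<forall>x. V x \<le> R \<longrightarrow> e \<le> measure (P x) {a}"
  shows "\<exists>C>0. \<exists>r\<in>{0<..<1}. \<forall>n x. V_norm_diff V (iter_kernel P n x) M \<le> ennreal (C * V x * r ^ n)"
proof -
  obtain b r where b: "b > 0" and r: "0 < r" "r < 1" and contr:
    "\<And>\<phi> A x y. \<phi> \<in> borel_measurable borel \<Longrightarrow> A > 0 \<Longrightarrow>
       (\<And>x y. \<bar>\<phi> x - \<phi> y\<bar> \<le> A * (2 + b * V x + b * V y)) \<Longrightarrow>
       \<bar>(\<integral>z. \<phi> z \<partial>P x) - (\<integral>z. \<phi> z \<partial>P y)\<bar> \<le> r * A * (2 + b * V x + b * V y)"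
    using weighted_oscillation_contraction[OF V V1 drift l K minor] by blast
  interpret M: prob_space M by fact
  note [measurable_cong] = M(2)
  have V0: "0 \<le> V x" for x using V1[of x] by simp
  have VM: "integrable M V"
    by (rule invariant_integrable_drift[OF M inv V V1 drift l K])
  \<comment> \<open>Since V \<ge> 1, the additive constant is absorbed into a multiple of V. The
    resulting powers of \<open>B\<close> may grow with n; they serve only to guarantee
    integrability.\<close>
  define B where "B = l + K"
  have B: "0 \<le> B" using l K by (simp add: B_def)
  have drift': "(\<integral>\<^sup>+y. ennreal (V y) \<partial>P x) \<le> ennreal (B * V x)" for x
  proof -
    have "l * V x + K \<le> B * V x" using K V1[of x] by (simp add: B_def algebra_simps)
    then show ?thesis using drift[of x] by (meson ennreal_leI order_trans)
  qed
  have Vn: "(\<integral>\<^sup>+y. ennreal (V y) \<partial>iter_kernel P n x) \<le> ennreal (B ^ n * V x)" for n x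
    by (rule nn_integral_iter_kernel_le[OF V V0 B drift'])
  \<comment> \<open>By V \<ge> 1, \<open>X\<close> times V(x) dominates 2 + b V(x) + b M(V). In
    \<open>C\<close>, the 1/b is the initial oscillation of a function between 0 and V, and the 2
    accounts for positive and negative parts.\<close>
  define X where "X = 2 + b + b * integral\<^sup>L M V"
  define C where "C = 2 * X / b"
  have intV: "0 \<le> integral\<^sup>L M V" using V0 by (simp add: integral_nonneg)
  have C: "C > 0" using b intV by (simp add: C_def X_def add_pos_nonneg)
  text \<open>It suffices to treat \<open>0 \<le> f \<le> V\<close>, where all integrals are those of \<open>ennreal\<close>-valued functions.\<close>
  have nonneg: "\<bar>(\<integral>y. f y \<partial>iter_kernel P n x) - (\<integral>y. f y \<partial>M)\<bar> \<le> C / 2 * V x * r ^ n"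
    if f [measurable]: "f \<in> borel_measurable borel" and f0: "\<And>x. 0 \<le> f x" and fV: "\<And>x. f x \<le> V x" for f n x
  proof -
    define \<phi> where "\<phi> n x = (\<integral>y. f y \<partial>iter_kernel P n x)" for n x
    have fi: "f \<in> borel_measurable (iter_kernel P n x)" for n x
      by (simp add: measurable_cong_sets[OF sets_iter_kernel refl])
    have le: "(\<integral>\<^sup>+y. ennreal (f y) \<partial>iter_kernel P n x) \<le> ennreal (B ^ n * V x)" for n x
      by (rule order_trans[OF nn_integral_mono Vn]) (simp add: fV ennreal_leI)
    have \<phi>: "ennreal (\<phi> n x) = (\<integral>\<^sup>+y. ennreal (f y) \<partial>iter_kernel P n x)" for n x
    proof -
      have "integrable (iter_kernel P n x) f"
        using fi f0 le[of n x] by (intro integrableI_nonneg) (auto intro: le_less_trans)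
      then show ?thesis using f0 by (simp add: \<phi>_def nn_integral_eq_integral)
    qed
    have \<phi>0: "0 \<le> \<phi> n x" for n x using f0 by (simp add: \<phi>_def integral_nonneg)
    have \<phi>le: "\<phi> n x \<le> B ^ n * V x" for n x
      using le[of n x] B V0 unfolding \<phi>[symmetric] by (subst (asm) ennreal_le_iff) auto
    have \<phi>m [measurable]: "\<phi> n \<in> borel_measurable borel" for n
    proof -
      have "(\<lambda>x. enn2real (\<integral>\<^sup>+y. ennreal (f y) \<partial>iter_kernel P n x)) \<in> borel_measurable borel"
        using nn_integral_iter_kernel_measurable[of "\<lambda>x. ennreal (f x)" n] by measurable
      then show ?thesis using \<phi>0 by (simp flip: \<phi>)
    qed
    have \<phi>Suc: "\<phi> (Suc n) x = (\<integral>y. \<phi> n y \<partial>P x)" for n x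
    proof -
      have Suc: "ennreal (\<phi> (Suc n) x) = (\<integral>\<^sup>+y. ennreal (\<phi> n y) \<partial>P x)"
        unfolding \<phi> by (rule nn_integral_iter_kernel_Suc) simp
      moreover have "integrable (P x) (\<phi> n)"
        using \<phi>0 by (intro integrableI_nonneg)
          (auto simp: measurable_cong_sets[OF sets_P refl] simp flip: Suc)
      ultimately have "ennreal (\<phi> (Suc n) x) = ennreal (\<integral>y. \<phi> n y \<partial>P x)"
        using \<phi>0 by (simp add: nn_integral_eq_integral)
      then show ?thesis using \<phi>0 by (simp add: integral_nonneg)
    qed
    have osc: "\<bar>\<phi> n x - \<phi> n y\<bar> \<le> (r ^ n / b) * (2 + b * V x + b * V y)" for n x y
    proof (induction n arbitrary: x y)
      case 0
      have "\<phi> 0 x = f x" for x by (simp add: \<phi>_def integral_return)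
      moreover have "\<bar>f x - f y\<bar> \<le> V x + V y" using f0 fV by (smt (verit))
      moreover have "V x + V y \<le> (1 / b) * (2 + b * V x + b * V y)"
        using b by (simp add: field_simps)
      ultimately show ?case by simp
    next
      case (Suc n)
      have "\<bar>\<phi> (Suc n) x - \<phi> (Suc n) y\<bar> \<le> r * (r ^ n / b) * (2 + b * V x + b * V y)"
        unfolding \<phi>Suc by (rule contr) (use Suc b r in auto)
      then show ?case by simp
    qed
    have \<phi>M: "integrable M (\<phi> n)"
      using \<phi>0 \<phi>le B V0
      by (intro Bochner_Integration.integrable_bound[OF integrable_mult_right[OF VM, of "B ^ n"]]) auto
    have fM: "integrable M f"
      using f0 fV V0 by (intro Bochner_Integration.integrable_bound[OF VM]) auto
    have "ennreal (\<integral>y. \<phi> n y \<partial>M) = ennreal (\<integral>y. f y \<partial>M)"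
      using \<phi>0 f0 iter_kernel_invariant[OF M(2) inv, of "\<lambda>x. ennreal (f x)" n]
      by (simp add: \<phi> flip: nn_integral_eq_integral[OF \<phi>M] nn_integral_eq_integral[OF fM])
    then have eq: "(\<integral>y. \<phi> n y \<partial>M) = (\<integral>y. f y \<partial>M)"
      using \<phi>0 f0 by (simp add: integral_nonneg)
    have "\<phi> n x - (\<integral>y. f y \<partial>M) = (\<integral>y. \<phi> n x - \<phi> n y \<partial>M)"
      using \<phi>M by (simp add: eq M.prob_space)
    also have "\<bar>\<dots>\<bar> \<le> (\<integral>y. \<bar>\<phi> n x - \<phi> n y\<bar> \<partial>M)" by (rule integral_abs_bound)
    also have "\<dots> \<le> (\<integral>y. (r ^ n / b) * (2 + b * V x + b * V y) \<partial>M)"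
      using \<phi>M VM by (intro integral_mono osc) auto
    also have "\<dots> = (r ^ n / b) * (2 + b * V x + b * integral\<^sup>L M V)"
      using VM by (simp add: M.prob_space)
    also have "\<dots> \<le> (r ^ n / b) * (X * V x)"
    proof (intro mult_left_mono)
      have "2 * 1 + b * integral\<^sup>L M V * 1 \<le> 2 * V x + b * integral\<^sup>L M V * V x"
        using V1[of x] b intV by (intro add_mono mult_left_mono) auto
      then show "2 + b * V x + b * integral\<^sup>L M V \<le> X * V x"
        by (simp add: X_def algebra_simps)
    qed (use r b in auto)
    also have "\<dots> = C / 2 * V x * r ^ n" by (simp add: C_def)
    finally show ?thesis by (simp add: \<phi>_def)
  qed
  have "V_norm_diff V (iter_kernel P n x) M \<le> ennreal (C * V x * r ^ n)" for n x
    unfolding V_norm_diff_def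
  proof (rule SUP_least)
    fix f assume "f \<in> {f \<in> borel_measurable borel. (\<forall>x. \<bar>f x\<bar> \<le> V x) \<and> integrable (iter_kernel P n x) f \<and> integrable M f}"
    then have f [measurable]: "f \<in> borel_measurable borel" and fV: "\<And>x. \<bar>f x\<bar> \<le> V x"
      and i: "integrable (iter_kernel P n x) f" "integrable M f" by auto
    let ?p = "\<lambda>x. max 0 (f x)" and ?m = "\<lambda>x. max 0 (- f x)"
    have ip: "integrable (iter_kernel P n x) ?p" "integrable (iter_kernel P n x) ?m" "integrable M ?p" "integrable M ?m"
      using i by auto
    have f': "f = (\<lambda>x. ?p x - ?m x)" by (auto simp: fun_eq_iff max_def)
    have eq: "(\<integral>y. f y \<partial>N) = (\<integral>y. ?p y \<partial>N) - (\<integral>y. ?m y \<partial>N)" if "integrable N ?p" "integrable N ?m" for N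
      using that by (subst f') (rule Bochner_Integration.integral_diff)
    have "\<bar>(\<integral>y. ?p y \<partial>iter_kernel P n x) - (\<integral>y. ?p y \<partial>M)\<bar> \<le> C / 2 * V x * r ^ n"
      using fV V0 by (intro nonneg) (auto simp: abs_le_iff)
    moreover have "\<bar>(\<integral>y. ?m y \<partial>iter_kernel P n x) - (\<integral>y. ?m y \<partial>M)\<bar> \<le> C / 2 * V x * r ^ n"
    proof (rule nonneg)
      show "?m z \<le> V z" for z using fV[of z] V0[of z] by (simp add: abs_le_iff)
    qed auto
    ultimately show "ennreal \<bar>integral\<^sup>L (iter_kernel P n x) f - integral\<^sup>L M f\<bar> \<le> ennreal (C * V x * r ^ n)"
      unfolding eq[OF ip(1,2)] eq[OF ip(3,4)] by (intro ennreal_leI) arith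
  qed
  then show ?thesis using C r by (intro exI[of _ C] conjI bexI[of _ r]) auto
qed

end

section \<open>Metropolis--Hastings kernels\<close>

locale metropolis_hastings = sigma_finite_measure N
  for N :: "'a::t1_space measure" +
  fixes p :: "'a \<Rightarrow> real" and q :: "'a \<Rightarrow> 'a \<Rightarrow> real"
  assumes sets_N [measurable_cong]: "sets N = sets borel"
    and p_measurable [measurable]: "p \<in> borel_measurable borel"
    and p_pos: "\<And>x. 0 < p x"
    and p_mass: "(\<integral>\<^sup>+x. ennreal (p x) \<partial>N) = 1"
    and q_measurable [measurable]: "(\<lambda>(x, z). q x z) \<in> borel_measurable (borel \<Otimes>\<^sub>M borel)"
    and q_pos: "\<And>x z. 0 < q x z"
    and q_mass: "\<And>x. (\<integral>\<^sup>+z. ennreal (q x z) \<partial>N) = 1"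
begin

definition accept :: "'a \<Rightarrow> 'a \<Rightarrow> real" where
  "accept x z = min 1 ((p z * q z x) / (p x * q x z))"

text \<open>The density of accepted moves. In this form p(x) times the density is visibly the
  symmetric minimum of p(x) q(x,z) and p(z) q(z,x).\<close>

definition move :: "'a \<Rightarrow> 'a \<Rightarrow> real" where
  "move x z = min (q x z) (p z / p x * q z x)"

definition stay :: "'a \<Rightarrow> ennreal" where
  "stay x = (\<integral>\<^sup>+z. ennreal (q x z - move x z) \<partial>N)"

text \<open>The accepted moves and the rejected mass at x are the two terms of a sum over the
  booleans, so that the integral formula for \<open>sum_measure\<close> applies.\<close>

definition kernel :: "'a \<Rightarrow> 'a measure" where
  "kernel x = sum_measure (\<lambda>b. if b then density N (\<lambda>z. ennreal (move x z))
     else density (return borel x) (\<lambda>_. stay x))"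

lemma accept_mult_q: "accept x z * q x z = move x z"
  using p_pos[of x] q_pos[of x z] by (simp add: accept_def move_def min_mult_distrib_right)

lemma move_bounds: "0 < move x z" "move x z \<le> q x z"
  using p_pos q_pos by (auto simp: move_def)

lemma detailed_balance: "p x * move x z = p z * move z x"
proof -
  have "p x * move x z = min (p x * q x z) (p z * q z x)" for x z
    using p_pos[of x] by (simp add: move_def min_mult_distrib_left)
  then show ?thesis by (simp add: min.commute)
qed

lemma move_measurable [measurable]: "(\<lambda>(x, z). move x z) \<in> borel_measurable (borel \<Otimes>\<^sub>M borel)"
  unfolding move_def by measurable

lemma stay_measurable [measurable]: "stay \<in> borel_measurable borel"
  unfolding stay_def[abs_def] by measurable

lemma move_stay: "(\<integral>\<^sup>+z. ennreal (move x z) \<partial>N) + stay x = 1"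
proof -
  have "(\<integral>\<^sup>+z. ennreal (move x z) \<partial>N) + stay x = (\<integral>\<^sup>+z. ennreal (move x z) + ennreal (q x z - move x z) \<partial>N)"
    unfolding stay_def by (subst nn_integral_add) auto
  also have "\<dots> = (\<integral>\<^sup>+z. ennreal (q x z) \<partial>N)"
    using move_bounds[of x] by (intro nn_integral_cong) (simp add: less_imp_le flip: ennreal_plus)
  finally show ?thesis by (simp add: q_mass)
qed

lemma kernel_eq_measure_of:
  "measure_of UNIV (sets borel) (\<lambda>A.
     (\<integral>\<^sup>+z\<in>A. ennreal (accept x z * q x z) \<partial>N) +
     indicator A x * (\<integral>\<^sup>+z. ennreal ((1 - accept x z) * q x z) \<partial>N)) = kernel x"
  unfolding kernel_def sum_measure_def
proof (rule measure_of_eq)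
  fix A :: "'a set" assume "A \<in> sigma_sets UNIV (sets borel)"
  then have [measurable]: "A \<in> sets borel" by (metis sets.sigma_sets_eq space_borel)
  have "(1 - accept x z) * q x z = q x z - move x z" for z
    by (simp add: left_diff_distrib accept_mult_q)
  moreover have "emeasure (density (return borel x) (\<lambda>_. stay x)) A = indicator A x * stay x"
    by (simp add: emeasure_density nn_integral_cmult mult.commute[of _ "stay x"])
  moreover have "emeasure (density N (\<lambda>z. ennreal (move x z))) A = (\<integral>\<^sup>+z\<in>A. ennreal (move x z) \<partial>N)"
    by (rule emeasure_density) measurable
  ultimately show "(\<integral>\<^sup>+z\<in>A. ennreal (accept x z * q x z) \<partial>N) +
     indicator A x * (\<integral>\<^sup>+z. ennreal ((1 - accept x z) * q x z) \<partial>N) =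
     (\<Sum>b\<in>UNIV. emeasure (if b then density N (\<lambda>z. ennreal (move x z)) else density (return borel x) (\<lambda>_. stay x)) A)"
    by (simp add: UNIV_bool accept_mult_q stay_def[symmetric] add.commute)
qed simp

lemma nn_integral_kernel:
  assumes [measurable]: "f \<in> borel_measurable borel"
  shows "(\<integral>\<^sup>+z. f z \<partial>kernel x) = (\<integral>\<^sup>+z. ennreal (move x z) * f z \<partial>N) + stay x * f x"
proof -
  have "(\<integral>\<^sup>+z. f z \<partial>kernel x) = (\<Sum>b\<in>UNIV. \<integral>\<^sup>+z. f z \<partial>(if b then density N (\<lambda>z. ennreal (move x z))
      else density (return borel x) (\<lambda>_. stay x)))"
    unfolding kernel_def by (rule nn_integral_sum_measure) (auto simp: sets_N)
  then show ?thesis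
    by (simp add: UNIV_bool nn_integral_density nn_integral_return add.commute)
qed

lemma sets_kernel: "sets (kernel x) = sets borel" and space_kernel: "space (kernel x) = UNIV"
  by (simp_all add: kernel_def)

lemma prob_space_kernel: "prob_space (kernel x)"
proof
  have "emeasure (kernel x) (space (kernel x)) = (\<integral>\<^sup>+z. 1 \<partial>kernel x)" by simp
  also have "\<dots> = 1" by (subst nn_integral_kernel) (simp_all add: move_stay)
  finally show "emeasure (kernel x) (space (kernel x)) = 1" .
qed

lemma kernel_measurable: "kernel \<in> borel \<rightarrow>\<^sub>M subprob_algebra borel"
proof (rule measurable_subprob_algebra)
  fix A :: "'a set" assume [measurable]: "A \<in> sets borel"
  have "emeasure (kernel x) A = (\<integral>\<^sup>+z. ennreal (move x z) * indicator A z \<partial>N) + stay x * indicator A x" for x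
    using nn_integral_kernel[of "indicator A" x] by (simp add: sets_kernel)
  then show "(\<lambda>x. emeasure (kernel x) A) \<in> borel_measurable borel" by simp
qed (auto simp: sets_kernel prob_space_kernel prob_space_imp_subprob_space)

text \<open>Fubini and detailed balance turn the contribution of the moves into the integral of p(z)
  f(z) times the total probability of moving away from z. The stay term supplies exactly the
  complement to 1.\<close>

lemma invariant:
  assumes [measurable]: "f \<in> borel_measurable borel"
  shows "(\<integral>\<^sup>+x. \<integral>\<^sup>+y. f y \<partial>kernel x \<partial>density N (\<lambda>x. ennreal (p x))) = (\<integral>\<^sup>+x. f x \<partial>density N (\<lambda>x. ennreal (p x)))"
proof -
  interpret pair_sigma_finite N N ..
  have "(\<integral>\<^sup>+x. \<integral>\<^sup>+y. f y \<partial>kernel x \<partial>density N (\<lambda>x. ennreal (p x))) =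
     (\<integral>\<^sup>+x. ennreal (p x) * ((\<integral>\<^sup>+z. ennreal (move x z) * f z \<partial>N) + stay x * f x) \<partial>N)"
    by (simp add: nn_integral_kernel nn_integral_density)
  also have "\<dots> = (\<integral>\<^sup>+x. (\<integral>\<^sup>+z. ennreal (p x * move x z) * f z \<partial>N) + ennreal (p x) * stay x * f x \<partial>N)"
  proof (intro nn_integral_cong)
    fix x
    have "(\<integral>\<^sup>+z. ennreal (p x * move x z) * f z \<partial>N) = ennreal (p x) * (\<integral>\<^sup>+z. ennreal (move x z) * f z \<partial>N)"
      using p_pos[of x] by (subst nn_integral_cmult[symmetric]) (auto simp: ennreal_mult' mult.assoc)
    then show "ennreal (p x) * ((\<integral>\<^sup>+z. ennreal (move x z) * f z \<partial>N) + stay x * f x) =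
       (\<integral>\<^sup>+z. ennreal (p x * move x z) * f z \<partial>N) + ennreal (p x) * stay x * f x"
      by (simp add: distrib_left mult.assoc)
  qed
  also have "\<dots> = (\<integral>\<^sup>+x. \<integral>\<^sup>+z. ennreal (p x * move x z) * f z \<partial>N \<partial>N) + (\<integral>\<^sup>+x. ennreal (p x) * stay x * f x \<partial>N)"
    by (rule nn_integral_add) auto
  also have "(\<integral>\<^sup>+x. \<integral>\<^sup>+z. ennreal (p x * move x z) * f z \<partial>N \<partial>N) = (\<integral>\<^sup>+z. \<integral>\<^sup>+x. ennreal (p x * move x z) * f z \<partial>N \<partial>N)"
    by (rule Fubini'[symmetric]) measurable
  also have "\<dots> = (\<integral>\<^sup>+z. ennreal (p z) * (\<integral>\<^sup>+x. ennreal (move z x) \<partial>N) * f z \<partial>N)"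
  proof (intro nn_integral_cong)
    fix z
    have "(\<integral>\<^sup>+x. ennreal (p x * move x z) * f z \<partial>N) = (\<integral>\<^sup>+x. (ennreal (p z) * f z) * ennreal (move z x) \<partial>N)"
      using p_pos[of z] by (intro nn_integral_cong) (simp add: detailed_balance[of _ z] ennreal_mult' mult_ac)
    also have "\<dots> = (ennreal (p z) * f z) * (\<integral>\<^sup>+x. ennreal (move z x) \<partial>N)"
      by (rule nn_integral_cmult) measurable
    finally show "(\<integral>\<^sup>+x. ennreal (p x * move x z) * f z \<partial>N) = ennreal (p z) * (\<integral>\<^sup>+x. ennreal (move z x) \<partial>N) * f z"
      by (simp add: mult_ac)
  qed
  also have "\<dots> + (\<integral>\<^sup>+x. ennreal (p x) * stay x * f x \<partial>N) =
     (\<integral>\<^sup>+z. ennreal (p z) * ((\<integral>\<^sup>+x. ennreal (move z x) \<partial>N) + stay z) * f z \<partial>N)"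
    by (subst nn_integral_add[symmetric]) (auto simp: distrib_left distrib_right)
  also have "\<dots> = (\<integral>\<^sup>+x. f x \<partial>density N (\<lambda>x. ennreal (p x)))"
    by (simp add: move_stay nn_integral_density)
  finally show ?thesis .
qed

lemma kernel_atom_lower:
  assumes "1 \<le> emeasure N {a}"
  shows "move x a \<le> measure (kernel x) {a}"
proof -
  interpret K: prob_space "kernel x" by (rule prob_space_kernel)
  have "ennreal (move x a) * 1 \<le> ennreal (move x a) * emeasure N {a}"
    by (intro mult_left_mono assms) simp
  also have "\<dots> = (\<integral>\<^sup>+z. ennreal (move x a) * indicator {a} z \<partial>N)"
    by (simp add: nn_integral_cmult sets_N)
  also have "\<dots> = (\<integral>\<^sup>+z. ennreal (move x z) * indicator {a} z \<partial>N)"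
    by (intro nn_integral_cong) (auto simp: indicator_def)
  also have "\<dots> \<le> (\<integral>\<^sup>+z. indicator {a} z \<partial>kernel x)"
    by (subst nn_integral_kernel) auto
  also have "\<dots> = ennreal (measure (kernel x) {a})"
    by (simp add: sets_kernel K.emeasure_eq_measure)
  finally show ?thesis by (simp add: ennreal_le_iff)
qed

end

section \<open>Bounds for the proposal density\<close>

lemma sum_indicator_S:
  fixes F :: "'p::finite set \<Rightarrow> 'b::real_vector"
  shows "(\<Sum>m\<in>UNIV. indicator (S m) x *\<^sub>R F m) = F (supp x)"
proof -
  have "(\<Sum>m\<in>UNIV. indicator (S m) x *\<^sub>R F m) = (\<Sum>m\<in>UNIV. if m = supp x then F m else 0)"
    by (intro sum.cong) (auto simp: mem_S_iff indicator_def)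
  then show ?thesis by simp
qed

lemma target_dens_supp: "target_dens \<omega> \<pi> x = \<omega> (supp x) * \<pi> (supp x) x"
  using sum_indicator_S[of x "\<lambda>m. \<omega> m * \<pi> m x"] by (simp add: target_dens_def mult.commute)

lemma norm_drift_le:
  assumes "D > 0"
  shows "norm (drift D U x) \<le> D"
  using assms unfolding drift_def sum_indicator_S
  by (simp add: max_def field_simps)

text \<open>The truncation makes the bound independent of x and of the gradients, so the estimates
  of the proposal depend on z - x alone.\<close>

lemma mu_component_close:
  assumes "D > 0"
  shows "\<bar>mu \<sigma> D U x $ i - x $ i\<bar> \<le> \<sigma>\<^sup>2 / 2 * D"
proof -
  have "\<bar>(mu \<sigma> D U x - x) $ i\<bar> \<le> norm (mu \<sigma> D U x - x)" by (rule component_le_norm_cart)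
  also have "\<dots> = \<sigma>\<^sup>2 / 2 * norm (drift D U x)" by (simp add: mu_def)
  also have "\<dots> \<le> \<sigma>\<^sup>2 / 2 * D" by (intro mult_left_mono norm_drift_le assms) auto
  finally show ?thesis by simp
qed

section \<open>Gaussian integrals against \<open>nu\<close>\<close>

lemma norm_vec_squared: "(norm (x :: real^'p::finite))\<^sup>2 = (\<Sum>i\<in>UNIV. (x $ i)\<^sup>2)"
  unfolding norm_vec_def L2_set_def by (simp add: sum_nonneg)

text \<open>Each coordinate contributes the Gaussian integral sqrt(pi/a) from Lebesgue measure and
  at most 1 from the Dirac mass; the bound does not depend on x.\<close>

lemma nn_integral_nu_gaussian_le:
  fixes x :: "real^'p::finite"
  assumes a: "a > 0"
  shows "(\<integral>\<^sup>+z. ennreal (exp (- a * (norm (z - x))\<^sup>2)) \<partial>nu) \<le> ennreal ((sqrt (pi / a) + 1) ^ CARD('p))"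
proof -
  define s where "s = 1 / sqrt (2 * a)"
  have s: "s > 0" "2 * s\<^sup>2 = 1 / a" using a by (simp_all add: s_def power_divide)
  have nd: "exp (- a * (t - c)\<^sup>2) = sqrt (pi / a) * normal_density c s t" for t c
  proof -
    have "2 * pi * s\<^sup>2 = pi / a" using s(2) by (simp add: field_simps)
    moreover have "- (t - c)\<^sup>2 / (2 * s\<^sup>2) = - a * (t - c)\<^sup>2" unfolding s(2) by simp
    moreover have "sqrt (pi / a) > 0" using a by simp
    ultimately show ?thesis using a by (simp add: normal_density_def)
  qed
  have int: "(\<integral>\<^sup>+t. ennreal (exp (- a * (t - c)\<^sup>2)) \<partial>lborel) = ennreal (sqrt (pi / a))" for c
  proof -
    interpret prob_space "density lborel (\<lambda>t. ennreal (normal_density c s t))"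
      using s by (intro prob_space_normal_density)
    have "(\<integral>\<^sup>+t. ennreal (normal_density c s t) \<partial>lborel) = 1"
      using emeasure_space_1 by (simp add: emeasure_density)
    then show ?thesis
      using a by (simp only: nd ennreal_mult'' normal_density_nonneg) (simp add: nn_integral_cmult)
  qed
  have "(\<integral>\<^sup>+z. ennreal (exp (- a * (norm (z - x))\<^sup>2)) \<partial>nu) =
    (\<integral>\<^sup>+z. (\<Prod>i\<in>UNIV. ennreal (exp (- a * (z $ i - x $ i)\<^sup>2))) \<partial>nu)"
    by (simp add: prod_ennreal norm_vec_squared sum_distrib_left sum_negf flip: exp_sum)
  also have "\<dots> = (\<Prod>i\<in>UNIV. (\<integral>\<^sup>+t. ennreal (exp (- a * (t - x $ i)\<^sup>2)) \<partial>lborel) + ennreal (exp (- a * (0 - x $ i)\<^sup>2)))"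
    by (rule nn_integral_nu_prod[of "\<lambda>i t. ennreal (exp (- a * (t - x $ i)\<^sup>2))"]) simp
  also have "\<dots> \<le> (\<Prod>i\<in>(UNIV::'p set). ennreal (sqrt (pi / a) + 1))"
  proof (rule prod_mono_ennreal)
    fix i
    have "ennreal (exp (- a * (0 - x $ i)\<^sup>2)) \<le> ennreal 1" using a by (intro ennreal_leI) simp
    then show "(\<integral>\<^sup>+t. ennreal (exp (- a * (t - x $ i)\<^sup>2)) \<partial>lborel) + ennreal (exp (- a * (0 - x $ i)\<^sup>2)) \<le> ennreal (sqrt (pi / a) + 1)"
      unfolding int using a by (subst ennreal_plus) (auto intro: add_left_mono)
  qed
  also have "\<dots> = ennreal ((sqrt (pi / a) + 1) ^ CARD('p))"
    using a by (simp only: prod_constant) (subst ennreal_power, auto)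
  finally show ?thesis .
qed

text \<open>The indicator of the ball is at most exp(K^2) exp(-|z - x|^2), which gives a bound
  uniform in the centre.\<close>

lemma nu_cball_bounded:
  obtains B where "B > 0" "\<And>x :: real^'p::finite. emeasure nu (cball x K) \<le> ennreal B"
proof
  let ?B = "exp (K\<^sup>2) * (sqrt (pi / 1) + 1) ^ CARD('p)"
  show "?B > 0" by (simp add: add_pos_nonneg)
  fix x :: "real^'p"
  have "emeasure nu (cball x K) = (\<integral>\<^sup>+z. indicator (cball x K) z \<partial>nu)" by simp
  also have "\<dots> \<le> (\<integral>\<^sup>+z. ennreal (exp (K\<^sup>2)) * ennreal (exp (- 1 * (norm (z - x))\<^sup>2)) \<partial>nu)"
  proof (intro nn_integral_mono)
    fix z
    have "1 \<le> exp (K\<^sup>2) * exp (- 1 * (norm (z - x))\<^sup>2)" if "z \<in> cball x K"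
      using that by (simp add: dist_norm norm_minus_commute power_mono flip: exp_add)
    then have "ennreal 1 \<le> ennreal (exp (K\<^sup>2)) * ennreal (exp (- 1 * (norm (z - x))\<^sup>2))" if "z \<in> cball x K"
      using that by (subst ennreal_mult[symmetric]) (auto intro!: ennreal_leI)
    then show "indicator (cball x K) z \<le> ennreal (exp (K\<^sup>2)) * ennreal (exp (- 1 * (norm (z - x))\<^sup>2))"
      by (auto simp: indicator_def)
  qed
  also have "\<dots> = ennreal (exp (K\<^sup>2)) * (\<integral>\<^sup>+z. ennreal (exp (- 1 * (norm (z - x))\<^sup>2)) \<partial>nu)"
    by (rule nn_integral_cmult) simp
  also have "\<dots> \<le> ennreal (exp (K\<^sup>2)) * ennreal ((sqrt (pi / 1) + 1) ^ CARD('p))"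
    by (intro mult_left_mono nn_integral_nu_gaussian_le) auto
  also have "\<dots> = ennreal ?B" by (simp add: ennreal_mult')
  finally show "emeasure nu (cball x K) \<le> ennreal ?B" .
qed

text \<open>The exponent is split in two halves: outside the ball one of them is at most exp(-a K^2
  / 2), and the other has integral at most G whatever x is.\<close>

lemma nu_gaussian_tail:
  assumes a: "a > 0" and \<epsilon>: "\<epsilon> > 0"
  obtains K0 where "K0 > 0" "\<And>K x :: real^'p::finite. K \<ge> K0 \<Longrightarrow>
    (\<integral>\<^sup>+z. ennreal (exp (- a * (norm (z - x))\<^sup>2)) * indicator (- cball x K) z \<partial>nu) \<le> ennreal \<epsilon>"
proof -
  define G where "G = (sqrt (pi / (a / 2)) + 1) ^ CARD('p)"
  have G: "G > 0" using a by (simp add: G_def add_nonneg_pos)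
  have "((\<lambda>K::real. exp (- (a / 2) * K\<^sup>2)) \<longlongrightarrow> 0) at_top"
    using a by real_asymp
  then have "eventually (\<lambda>K. exp (- (a / 2) * K\<^sup>2) < \<epsilon> / G) at_top"
    using G \<epsilon> by (intro order_tendstoD) auto
  then obtain K1 where K1: "\<And>K. K \<ge> K1 \<Longrightarrow> exp (- (a / 2) * K\<^sup>2) < \<epsilon> / G"
    by (auto simp: eventually_at_top_linorder)
  show thesis
  proof (rule that[of "max 1 K1"])
    fix K and x :: "real^'p" assume K: "K \<ge> max 1 K1"
    have "(\<integral>\<^sup>+z. ennreal (exp (- a * (norm (z - x))\<^sup>2)) * indicator (- cball x K) z \<partial>nu) \<le>
      (\<integral>\<^sup>+z. ennreal (\<epsilon> / G) * ennreal (exp (- (a/2) * (norm (z - x))\<^sup>2)) \<partial>nu)"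
    proof (intro nn_integral_mono)
      fix z
      have "exp (- a * (norm (z - x))\<^sup>2) \<le> (\<epsilon> / G) * exp (- (a/2) * (norm (z - x))\<^sup>2)" if "z \<notin> cball x K"
      proof -
        have "K\<^sup>2 \<le> (norm (z - x))\<^sup>2"
          using that K by (intro power_mono) (auto simp: dist_norm norm_minus_commute)
        then have "- a * (norm (z - x))\<^sup>2 \<le> - (a/2) * K\<^sup>2 + - (a/2) * (norm (z - x))\<^sup>2"
          using a by (simp add: field_simps)
        then have "exp (- a * (norm (z - x))\<^sup>2) \<le> exp (- (a/2) * K\<^sup>2) * exp (- (a/2) * (norm (z - x))\<^sup>2)"
          by (simp only: exp_add[symmetric] exp_le_cancel_iff)
        also have "\<dots> \<le> (\<epsilon> / G) * exp (- (a/2) * (norm (z - x))\<^sup>2)"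
          using K1[of K] K by (intro mult_right_mono) auto
        finally show ?thesis .
      qed
      then show "ennreal (exp (- a * (norm (z - x))\<^sup>2)) * indicator (- cball x K) z \<le>
        ennreal (\<epsilon> / G) * ennreal (exp (- (a/2) * (norm (z - x))\<^sup>2))"
        using \<epsilon> G by (auto simp: indicator_def simp flip: ennreal_mult' intro!: ennreal_leI)
    qed
    also have "\<dots> = ennreal (\<epsilon> / G) * (\<integral>\<^sup>+z. ennreal (exp (- (a/2) * (norm (z - x))\<^sup>2)) \<partial>nu)"
      by (rule nn_integral_cmult) simp
    also have "\<dots> \<le> ennreal (\<epsilon> / G) * ennreal G"
      unfolding G_def using a by (intro mult_left_mono nn_integral_nu_gaussian_le) auto
    also have "\<dots> = ennreal \<epsilon>" using G \<epsilon> by (simp flip: ennreal_mult')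
    finally show "(\<integral>\<^sup>+z. ennreal (exp (- a * (norm (z - x))\<^sup>2)) * indicator (- cball x K) z \<partial>nu) \<le> ennreal \<epsilon>" .
  qed simp
qed

section \<open>Uniform two-sided bounds for the full proposal density\<close>

locale thresholded_langevin =
  fixes \<Psi> :: thresholding and \<sigma> \<gamma> D :: real and U :: "'p::finite set \<Rightarrow> real ^ 'p \<Rightarrow> real"
  assumes \<sigma>: "\<sigma> > 0" and \<gamma>: "\<gamma> > 0" and D: "D > 0"
    and U_C1: "\<And>m. C1 (U m)"
begin

abbreviation q :: "real ^ 'p \<Rightarrow> real ^ 'p \<Rightarrow> real" where "q \<equiv> q_Psi \<Psi> \<sigma> \<gamma> D U"

lemma q_prod: "q x z = (\<Prod>i\<in>UNIV. phi \<Psi> \<sigma> \<gamma> (mu \<sigma> D U x $ i) (z $ i))"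
proof -
  have "(\<Prod>i\<in>UNIV. phi \<Psi> \<sigma> \<gamma> (mu \<sigma> D U x $ i) (z $ i)) =
    (\<Prod>i\<in>- supp z. phi \<Psi> \<sigma> \<gamma> (mu \<sigma> D U x $ i) (z $ i)) *
    (\<Prod>i\<in>supp z. phi \<Psi> \<sigma> \<gamma> (mu \<sigma> D U x $ i) (z $ i))"
    by (subst prod.union_disjoint[symmetric]) (auto intro: arg_cong2[where f=prod])
  also have "\<dots> = q x z"
    unfolding q_Psi_def by (intro arg_cong2[where f="(*)"] prod.cong) (auto simp: phi_def supp_def)
  finally show ?thesis by simp
qed

lemma mu_measurable [measurable]: "mu \<sigma> D U \<in> borel_measurable borel"
proof -
  have [measurable]: "grad (U m) \<in> borel_measurable borel" for m
    using U_C1[of m] by (intro borel_measurable_continuous_onI) (simp add: C1_def)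
  show ?thesis unfolding mu_def drift_def by measurable
qed

lemma q_measurable [measurable]: "(\<lambda>(x, z). q x z) \<in> borel_measurable (borel \<Otimes>\<^sub>M borel)"
proof -
  have "(\<lambda>y. case y of (x, z) \<Rightarrow> phi \<Psi> \<sigma> \<gamma> (mu \<sigma> D U x $ i) (z $ i)) \<in> borel_measurable (borel \<Otimes>\<^sub>M borel)" for i
  proof -
    have [measurable]: "(\<lambda>x::real^'p. x $ i) \<in> borel_measurable borel"
      by (intro borel_measurable_continuous_onI continuous_intros)
    have "(\<lambda>y. (case y of (x, z) \<Rightarrow> (mu \<sigma> D U x $ i, z $ i)) :: real \<times> real) \<in> borel \<Otimes>\<^sub>M borel \<rightarrow>\<^sub>M borel \<Otimes>\<^sub>M borel"
      by measurable
    from measurable_compose[OF this phi_measurable[OF \<sigma> \<gamma>, of \<Psi>]] show ?thesis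
      by (simp add: case_prod_beta)
  qed
  then show ?thesis
    unfolding q_prod case_prod_beta by (intro borel_measurable_prod) auto
qed

lemma phi_measurable_snd [measurable]: "phi \<Psi> \<sigma> \<gamma> c \<in> borel_measurable borel"
  using measurable_compose[OF measurable_Pair1' phi_measurable[OF \<sigma> \<gamma>, of \<Psi>], of c] by simp

lemma q_mass: "(\<integral>\<^sup>+z. ennreal (q x z) \<partial>nu) = 1"
proof -
  have "phi \<Psi> \<sigma> \<gamma> c z \<ge> 0" for c z
    by (cases \<Psi>) (auto simp: phi_def rho_def g_def g_tilde_def)
  then have "(\<integral>\<^sup>+z. ennreal (q x z) \<partial>nu) =
      (\<integral>\<^sup>+z. (\<Prod>i\<in>UNIV. ennreal (phi \<Psi> \<sigma> \<gamma> (mu \<sigma> D U x $ i) (z $ i))) \<partial>nu)"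
    unfolding q_prod by (simp add: prod_ennreal)
  also have "\<dots> = 1"
    by (subst nn_integral_nu_prod[of "\<lambda>i t. ennreal (phi \<Psi> \<sigma> \<gamma> (mu \<sigma> D U x $ i) t)"])
      (simp_all add: phi_mass \<sigma> \<gamma>)
  finally show ?thesis .
qed

text \<open>The constant depends on \<open>K\<close> but neither on x nor on the supports of x and
  z, because \<open>phi_lower\<close> treats the atom and the continuous part alike. Jumps between
  models are therefore covered as well.\<close>

lemma q_lower:
  obtains \<kappa> where "\<kappa> > 0" "\<And>x z. norm (z - x) \<le> K \<Longrightarrow> \<kappa> \<le> q x z"
proof
  let ?k = "min (1/2) (2 * \<gamma>) / sqrt (2 * pi * \<sigma>\<^sup>2) * exp (- (\<gamma> + \<sigma>\<^sup>2 / 2 * D + K)\<^sup>2 / (2 * \<sigma>\<^sup>2))"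
  have k: "?k > 0" using \<sigma> \<gamma> by (intro mult_pos_pos divide_pos_pos) auto
  then show "?k ^ CARD('p) > 0" by (rule zero_less_power)
  fix x z :: "real^'p" assume xz: "norm (z - x) \<le> K"
  have "(\<Prod>i\<in>(UNIV::'p set). ?k) \<le> q x z"
    unfolding q_prod
  proof (rule prod_mono, intro conjI)
    fix i
    have "\<bar>(z - x) $ i\<bar> \<le> K" using component_le_norm_cart[of "z - x" i] xz by linarith
    then show "?k \<le> phi \<Psi> \<sigma> \<gamma> (mu \<sigma> D U x $ i) (z $ i)"
      by (intro phi_lower[OF \<sigma> \<gamma> mu_component_close[OF D]]) simp
  qed (use k in simp)
  then show "?k ^ CARD('p) \<le> q x z" by simp
qed

lemma q_pos: "q x z > 0"
  using q_lower[of "norm (z - x)"] by (metis less_le_trans order_refl)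

lemma q_upper:
  obtains C a where "C > 0" "a > 0" "\<And>x z. q x z \<le> C * exp (- a * (norm (z - x))\<^sup>2)"
proof
  let ?C = "max 1 (2 * \<gamma>) / sqrt (2 * pi * \<sigma>\<^sup>2) * exp ((\<gamma> + \<sigma>\<^sup>2 / 2 * D)\<^sup>2 / (2 * \<sigma>\<^sup>2))"
  have C: "?C > 0" using \<sigma> by (intro mult_pos_pos divide_pos_pos) auto
  then show "?C ^ CARD('p) > 0" by (rule zero_less_power)
  show "1 / (4 * \<sigma>\<^sup>2) > 0" using \<sigma> by simp
  fix x z :: "real^'p"
  have phi0: "phi \<Psi> \<sigma> \<gamma> c z \<ge> 0" for c z
    by (cases \<Psi>) (auto simp: phi_def rho_def g_def g_tilde_def)
  have "q x z \<le> (\<Prod>i\<in>UNIV. ?C * exp (- (z $ i - x $ i)\<^sup>2 / (4 * \<sigma>\<^sup>2)))"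
    unfolding q_prod by (intro prod_mono conjI phi_upper[OF \<sigma> \<gamma> mu_component_close[OF D]] phi0)
  also have "\<dots> = ?C ^ CARD('p) * (\<Prod>i\<in>UNIV. exp (- (z $ i - x $ i)\<^sup>2 / (4 * \<sigma>\<^sup>2)))"
    by (simp only: prod.distrib prod_constant power_mult_distrib)
  also have "(\<Prod>i\<in>UNIV. exp (- (z $ i - x $ i)\<^sup>2 / (4 * \<sigma>\<^sup>2))) = exp (- (1 / (4 * \<sigma>\<^sup>2)) * (norm (z - x))\<^sup>2)"
    by (simp add: norm_vec_squared sum_negf sum_divide_distrib flip: exp_sum)
  finally show "q x z \<le> ?C ^ CARD('p) * exp (- (1 / (4 * \<sigma>\<^sup>2)) * (norm (z - x))\<^sup>2)" .
qed

end

section \<open>The target\<close>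

lemma S_scaleR: "x \<in> S m \<Longrightarrow> r \<noteq> 0 \<Longrightarrow> r *\<^sub>R x \<in> S m"
  by (auto simp: S_def)

lemma add_scaleR_sgn: "x + s *\<^sub>R sgn x = (1 + s / norm x) *\<^sub>R x"
  for x :: "'a::real_normed_vector"
  by (simp add: sgn_div_norm divide_inverse algebra_simps)

locale shrinkage_target = thresholded_langevin \<Psi> \<sigma> \<gamma> D U
  for \<Psi> :: thresholding and \<sigma> \<gamma> D :: real and U :: "'p::finite set \<Rightarrow> real ^ 'p \<Rightarrow> real" +
  fixes \<omega> :: "'p set \<Rightarrow> real" and \<pi> :: "'p set \<Rightarrow> real ^ 'p \<Rightarrow> real" and \<beta> c :: real
  assumes \<omega>_sum: "(\<Sum>m\<in>UNIV. \<omega> m) = 1" and \<omega>_pos: "\<And>m. \<omega> m > 0"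
    and dens_meas [measurable]: "\<And>m. \<pi> m \<in> borel_measurable borel"
    and dens_prob: "\<And>m. prob_space (density (nu_m m) (\<lambda>x. ennreal (\<pi> m x)))"
    and \<pi>_pos: "\<And>m x. x \<in> S m \<Longrightarrow> \<pi> m x > 0"
    and A1_iii: "\<And>m. ((\<lambda>x. \<pi> m x * indicator (S m) x) \<longlongrightarrow> 0) at_infinity"
    and A2: "\<And>m s. s > 0 \<Longrightarrow>
      ((\<lambda>r::real. SUP x \<in> {x \<in> S m. norm x \<ge> r}. ennreal (\<pi> m (x + s *\<^sub>R sgn x) / \<pi> m x)) \<longlongrightarrow> 0) at_top"
    and A3: "\<exists>b>0. \<exists>R>0. \<exists>\<epsilon>>0. \<exists>u\<in>{0<..<b}. \<forall>m. \<forall>x\<in>S m. norm x \<ge> R \<longrightarrow>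
      (\<forall>y\<in>S m \<inter> W b u \<epsilon> m x. \<pi> m (x - u *\<^sub>R sgn x) \<le> \<pi> m y)"
    and \<beta>: "0 < \<beta>" "\<beta> < 1"
    and c: "c > 0" "\<And>x. lyapunov c \<beta> \<omega> \<pi> x \<ge> 1"
begin

abbreviation p :: "real ^ 'p \<Rightarrow> real" where "p \<equiv> target_dens \<omega> \<pi>"
abbreviation V :: "real ^ 'p \<Rightarrow> real" where "V \<equiv> lyapunov c \<beta> \<omega> \<pi>"

lemma p_S: "x \<in> S m \<Longrightarrow> p x = \<omega> m * \<pi> m x"
  by (simp add: target_dens_supp mem_S_iff)

lemma p_pos: "p x > 0"
  unfolding target_dens_supp by (intro mult_pos_pos \<omega>_pos \<pi>_pos) (simp add: mem_S_iff)

lemma p_measurable [measurable]: "p \<in> borel_measurable borel"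
  unfolding target_dens_def[abs_def] by measurable

lemma V_measurable [measurable]: "V \<in> borel_measurable borel"
  unfolding lyapunov_def[abs_def] by measurable

lemma V_pos: "V x > 0"
  using c(1) p_pos[of x] by (simp add: lyapunov_def)

lemma target_eq_density: "target \<omega> \<pi> = density nu (\<lambda>x. ennreal (p x))"
proof (rule measure_eqI)
  fix A assume "A \<in> sets (target \<omega> \<pi>)"
  then have [measurable]: "A \<in> sets borel" by (simp add: target_def)
  have "emeasure (target \<omega> \<pi>) A =
     (\<Sum>m\<in>UNIV. \<integral>\<^sup>+x. ennreal (\<omega> m * \<pi> m x * indicator (S m) x) * indicator A x \<partial>nu_m m)"
    unfolding target_def by (subst emeasure_sum_measure) (auto intro!: sum.cong emeasure_density)
  also have "\<dots> = (\<Sum>m\<in>UNIV. \<integral>\<^sup>+x. ennreal (p x) * indicator A x \<partial>nu_m m)"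
  proof (intro sum.cong refl nn_integral_cong_AE)
    fix m
    show "AE x in nu_m m. ennreal (\<omega> m * \<pi> m x * indicator (S m) x) * indicator A x = ennreal (p x) * indicator A x"
      using AE_nu_m_S[of m] by eventually_elim (simp add: p_S)
  qed
  also have "\<dots> = emeasure (density nu (\<lambda>x. ennreal (p x))) A"
    by (simp add: emeasure_density nn_integral_nu)
  finally show "emeasure (target \<omega> \<pi>) A = emeasure (density nu (\<lambda>x. ennreal (p x))) A" .
qed (simp add: target_def)

lemma p_mass: "(\<integral>\<^sup>+x. ennreal (p x) \<partial>nu) = 1"
proof -
  have "(\<integral>\<^sup>+x. ennreal (p x) \<partial>nu_m m) = ennreal (\<omega> m)" for m
  proof -
    interpret prob_space "density (nu_m m) (\<lambda>x. ennreal (\<pi> m x))" by (rule dens_prob)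
    have "(\<integral>\<^sup>+x. ennreal (\<pi> m x) \<partial>nu_m m) = 1"
      using emeasure_space_1 by (simp add: emeasure_density)
    moreover have "(\<integral>\<^sup>+x. ennreal (p x) \<partial>nu_m m) = (\<integral>\<^sup>+x. ennreal (\<omega> m) * ennreal (\<pi> m x) \<partial>nu_m m)"
      using AE_nu_m_S[of m] \<omega>_pos[of m]
      by (intro nn_integral_cong_AE) (auto simp: p_S ennreal_mult' elim!: eventually_mono)
    ultimately show ?thesis by (simp add: nn_integral_cmult)
  qed
  then have "(\<integral>\<^sup>+x. ennreal (p x) \<partial>nu) = ennreal (\<Sum>m\<in>UNIV. \<omega> m)"
    using \<omega>_pos by (simp add: nn_integral_nu sum_ennreal less_imp_le)
  then show ?thesis by (simp add: \<omega>_sum)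
qed

sublocale MH: metropolis_hastings nu p q
proof -
  interpret sigma_finite_measure "nu :: (real^'p) measure" by (rule sigma_finite_nu)
  show "metropolis_hastings nu p q"
    by unfold_locales (auto simp: p_pos q_pos p_mass q_mass)
qed

lemma P_Psi_eq_kernel: "P_Psi \<Psi> \<sigma> \<gamma> D \<omega> \<pi> U x = MH.kernel x"
  unfolding P_Psi_def MH.kernel_eq_measure_of[symmetric] by (simp add: MH.accept_def[abs_def] alpha_Psi_def)

lemma prob_space_target: "prob_space (target \<omega> \<pi>)"
  by (rule prob_spaceI) (simp add: target_eq_density emeasure_density p_mass)

section \<open>Size and radial decay of the target density\<close>

lemma p_vanishes:
  assumes "\<delta> > 0"
  obtains r where "r > 0" "\<And>x. norm x \<ge> r \<Longrightarrow> p x < \<delta>"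
proof -
  have "((\<lambda>x. \<Sum>m\<in>UNIV. \<omega> m * (\<pi> m x * indicator (S m) x)) \<longlongrightarrow> (\<Sum>m\<in>(UNIV::'p set set). \<omega> m * 0)) at_infinity"
    by (intro tendsto_intros A1_iii)
  then have "(p \<longlongrightarrow> 0) at_infinity"
    by (simp add: target_dens_def[abs_def] mult.assoc)
  then have "eventually (\<lambda>x. p x < \<delta>) at_infinity"
    using assms by (intro order_tendstoD)
  then obtain r where "\<And>x. norm x \<ge> r \<Longrightarrow> p x < \<delta>"
    by (auto simp: eventually_at_infinity)
  then show thesis by (intro that[of "max 1 r"]) auto
qed

text \<open>The condition V \<ge> 1 says precisely that p(x)^\<beta> is at most c.\<close>

lemma p_bounded:
  obtains B where "B > 0" "\<And>x. p x \<le> B"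
proof (rule that[of "c powr (1 / \<beta>)"])
  fix x
  have "1 \<le> c * p x powr (- \<beta>)" using c(2)[of x] by (simp add: lyapunov_def)
  then have "p x powr \<beta> \<le> c" using p_pos[of x] by (simp add: powr_minus field_simps)
  then have "(p x powr \<beta>) powr (1 / \<beta>) \<le> c powr (1 / \<beta>)" using \<beta> by (intro powr_mono2) auto
  then show "p x \<le> c powr (1 / \<beta>)" using \<beta> p_pos[of x] by (simp add: powr_powr)
qed (use c in simp)

text \<open>(A2) freed from the supremum and transferred to \<open>p\<close>: there are finitely
  many models, hence a common radius, and x + s n(x) lies in the same \<open>S m\<close> as x, so
  the weight of the model cancels.\<close>

lemma radial_decay:
  assumes "s > 0" "\<delta> > 0"
  obtains r where "r > 0" "\<And>x. norm x \<ge> r \<Longrightarrow> p (x + s *\<^sub>R sgn x) \<le> \<delta> * p x"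
proof -
  have "\<exists>r. \<forall>x\<in>S m. norm x \<ge> r \<longrightarrow> \<pi> m (x + s *\<^sub>R sgn x) \<le> \<delta> * \<pi> m x" for m
  proof -
    have "eventually (\<lambda>r::real. (SUP x \<in> {x \<in> S m. norm x \<ge> r}. ennreal (\<pi> m (x + s *\<^sub>R sgn x) / \<pi> m x)) < ennreal \<delta>) at_top"
      using assms by (intro order_tendstoD(2)[OF A2]) auto
    then obtain r where r: "(SUP x \<in> {x \<in> S m. norm x \<ge> r}. ennreal (\<pi> m (x + s *\<^sub>R sgn x) / \<pi> m x)) < ennreal \<delta>"
      by (auto simp: eventually_at_top_linorder)
    show ?thesis
    proof (intro exI[of _ r] ballI impI)
      fix x assume x: "x \<in> S m" "norm x \<ge> r"
      have "ennreal (\<pi> m (x + s *\<^sub>R sgn x) / \<pi> m x) < ennreal \<delta>"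
        using x by (intro le_less_trans[OF SUP_upper r]) auto
      then have "\<pi> m (x + s *\<^sub>R sgn x) / \<pi> m x < \<delta>"
        using assms by (cases "\<pi> m (x + s *\<^sub>R sgn x) / \<pi> m x \<ge> 0") (auto simp: ennreal_less_iff)
      then show "\<pi> m (x + s *\<^sub>R sgn x) \<le> \<delta> * \<pi> m x"
        using \<pi>_pos[OF x(1)] by (simp add: field_simps)
    qed
  qed
  then obtain r where r: "\<And>m x. x \<in> S m \<Longrightarrow> norm x \<ge> r m \<Longrightarrow> \<pi> m (x + s *\<^sub>R sgn x) \<le> \<delta> * \<pi> m x"
    by metis
  define r0 where "r0 = max 1 (Max (range r))"
  show thesis
  proof (rule that[of r0])
    fix x :: "real^'p" assume x: "norm x \<ge> r0"
    have S: "x \<in> S (supp x)" by (simp add: mem_S_iff)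
    have "r (supp x) \<le> Max (range r)" by (rule Max_ge) auto
    then have "r (supp x) \<le> norm x" using x by (simp add: r0_def)
    note le = r[OF S this]
    have "1 + s / norm x > 0" using assms by (simp add: add_pos_nonneg)
    then have "x + s *\<^sub>R sgn x \<in> S (supp x)"
      unfolding add_scaleR_sgn by (intro S_scaleR S) simp
    then show "p (x + s *\<^sub>R sgn x) \<le> \<delta> * p x"
      using le \<omega>_pos[of "supp x"] by (simp add: p_S[of _ "supp x"] S mult.left_commute)
  qed (simp add: r0_def)
qed

text \<open>An outward step along the ray keeps the direction and does not leave the region of
  decay, so the bound applies again at the new point. Of the accumulated powers of \<delta> one
  suffices, as \<delta> \<le> 1.\<close>

lemma radial_decay_iterated:
  assumes dec: "\<And>x. norm x \<ge> r \<Longrightarrow> p (x + s *\<^sub>R sgn x) \<le> \<delta> * p x"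
    and s: "s > 0" and \<delta>: "0 < \<delta>" "\<delta> \<le> 1" and r: "r > 0" and x: "norm x \<ge> r"
  shows "p (x + (real (Suc j) * s) *\<^sub>R sgn x) \<le> \<delta> * p x"
proof (induction j)
  case 0
  then show ?case using dec[OF x] by simp
next
  case (Suc j)
  let ?y = "x + (real (Suc j) * s) *\<^sub>R sgn x"
  have k: "1 + real (Suc j) * s / norm x \<ge> 1" using s by simp
  have y: "?y = (1 + real (Suc j) * s / norm x) *\<^sub>R x" by (rule add_scaleR_sgn)
  have "norm ?y = (1 + real (Suc j) * s / norm x) * norm x" unfolding y using k by simp
  moreover have "\<dots> \<ge> 1 * norm x" using k by (intro mult_right_mono) auto
  ultimately have "norm ?y \<ge> r" using x by linarith
  moreover have sg: "sgn ?y = sgn x" unfolding y using k by (simp add: sgn_scaleR)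
  ultimately have "p (?y + s *\<^sub>R sgn x) \<le> \<delta> * p ?y" using dec[of ?y] by simp
  also have "\<dots> \<le> 1 * p ?y" using \<delta> p_pos[of ?y] by (intro mult_right_mono) auto
  finally have "p (?y + s *\<^sub>R sgn x) \<le> \<delta> * p x" using Suc by simp
  moreover have "?y + s *\<^sub>R sgn x = x + (real (Suc (Suc j)) * s) *\<^sub>R sgn x"
  proof -
    have "real (Suc (Suc j)) * s = real (Suc j) * s + s" by (simp add: algebra_simps)
    then show ?thesis by (simp only: scaleR_left_distrib add.assoc)
  qed
  ultimately show ?case by (simp only:)
qed

end

section \<open>Level sets of the target\<close>

text \<open>The translates of \<open>E\<close> by 0, \<tau>, ..., (N - 1) \<tau> are pairwise
  disjoint and all lie in [a, b + N \<tau>].\<close>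

lemma emeasure_lborel_disjoint_translates:
  fixes E :: "real set"
  assumes E [measurable]: "E \<in> sets borel" and sub: "E \<subseteq> {a..b}" and ab: "a \<le> b" and \<tau>: "\<tau> > 0"
    and disj: "\<And>e j. e \<in> E \<Longrightarrow> j \<ge> 1 \<Longrightarrow> e + real j * \<tau> \<notin> E"
  shows "of_nat N * emeasure lborel E \<le> ennreal (b - a + real N * \<tau>)"
proof -
  let ?F = "\<lambda>j. (+) (- (real j * \<tau>)) -` E"
  have F: "?F j \<in> sets borel" for j
    using measurable_sets[of "(+) (- (real j * \<tau>))" borel borel E] by simp
  have eF: "emeasure lborel (?F j) = emeasure lborel E" for j
  proof -
    have "emeasure lborel E = emeasure (distr lborel borel ((+) (- (real j * \<tau>)))) E"
      by (simp only: lborel_distr_plus)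
    then show ?thesis by (subst (asm) emeasure_distr) auto
  qed
  have no: False if "x \<in> ?F i" "x \<in> ?F j" "i < j" for i j :: nat and x
  proof -
    have "x - real j * \<tau> + real (j - i) * \<tau> = x - real i * \<tau>"
      using that(3) by (simp add: of_nat_diff algebra_simps)
    moreover have "x - real j * \<tau> + real (j - i) * \<tau> \<notin> E"
      using that by (intro disj) (auto simp: algebra_simps)
    moreover have "x - real i * \<tau> \<in> E" using that(1) by (simp add: algebra_simps)
    ultimately show False by metis
  qed
  have "of_nat N * emeasure lborel E = (\<Sum>j<N. emeasure lborel (?F j))"
    by (simp add: eF)
  also have "\<dots> = emeasure lborel (\<Union>j<N. ?F j)"
  proof (rule sum_emeasure)
    show "disjoint_family_on ?F {..<N}"
      unfolding disjoint_family_on_def using no by (metis disjoint_iff nat_neq_iff)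
  qed (use F in auto)
  also have "\<dots> \<le> emeasure lborel {a..b + real N * \<tau>}"
  proof (rule emeasure_mono)
    show "(\<Union>j<N. ?F j) \<subseteq> {a..b + real N * \<tau>}"
    proof safe
      fix x j assume x: "- (real j * \<tau>) + x \<in> E" and "j < N"
      have "a \<le> x - real j * \<tau>" "x - real j * \<tau> \<le> b" using x sub by auto
      moreover have "0 \<le> real j * \<tau>" "real j * \<tau> \<le> real N * \<tau>" using \<open>j < N\<close> \<tau> by auto
      ultimately show "x \<in> {a..b + real N * \<tau>}" by auto
    qed
  qed simp
  also have "\<dots> = ennreal (b - a + real N * \<tau>)"
    using ab \<tau> by (subst emeasure_lborel_Icc) (auto simp: algebra_simps intro: add_increasing2)
  finally show ?thesis .
qed

text \<open>The Jacobian of a dilation differs between models, but for ratios between 1 and 2 it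
  never exceeds 2 to the dimension, so one constant serves the whole sum.\<close>

lemma nu_dilation_le:
  fixes T :: "(real^'p::finite) set"
  assumes [measurable]: "T \<in> sets borel" and l: "1 \<le> l" "l \<le> 2"
  shows "emeasure nu T \<le> 2 ^ CARD('p) * (\<integral>\<^sup>+z. indicator T (l *\<^sub>R z) \<partial>nu)"
proof -
  have "emeasure nu T = (\<Sum>m\<in>UNIV. \<integral>\<^sup>+z. indicator T z \<partial>nu_m m)" by (simp add: emeasure_nu)
  also have "\<dots> \<le> (\<Sum>m\<in>UNIV. 2 ^ CARD('p) * (\<integral>\<^sup>+z. indicator T (l *\<^sub>R z) \<partial>nu_m m))"
  proof (intro sum_mono)
    fix m :: "'p set"
    have "(\<integral>\<^sup>+z. indicator T z \<partial>nu_m m) = ennreal (l ^ card m) * (\<integral>\<^sup>+z. indicator T (l *\<^sub>R z) \<partial>nu_m m)"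
      using l by (intro nn_integral_nu_m_scale) auto
    also have "\<dots> \<le> 2 ^ CARD('p) * (\<integral>\<^sup>+z. indicator T (l *\<^sub>R z) \<partial>nu_m m)"
    proof (intro mult_right_mono)
      have "l ^ card m \<le> 2 ^ card m" using l by (intro power_mono) auto
      also have "\<dots> \<le> 2 ^ CARD('p)" by (intro power_increasing card_mono) auto
      finally have "ennreal (l ^ card m) \<le> ennreal (2 ^ CARD('p))" by (rule ennreal_leI)
      then show "ennreal (l ^ card m) \<le> 2 ^ CARD('p)" by (simp add: ennreal_power[symmetric])
    qed simp
    finally show "(\<integral>\<^sup>+z. indicator T z \<partial>nu_m m) \<le> 2 ^ CARD('p) * (\<integral>\<^sup>+z. indicator T (l *\<^sub>R z) \<partial>nu_m m)" .
  qed
  also have "\<dots> = 2 ^ CARD('p) * (\<integral>\<^sup>+z. indicator T (l *\<^sub>R z) \<partial>nu)"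
    by (simp add: nn_integral_nu sum_distrib_left)
  finally show ?thesis .
qed

text \<open>Hyperplanes are null in the active coordinates. Applied with the coordinates of a fixed
  point, this discards the z whose difference from that point would drop out of
  \<open>S m\<close>.\<close>

lemma AE_nu_m_neq:
  assumes "i \<in> m"
  shows "AE z in nu_m m. z $ i \<noteq> d"
proof (rule AE_I)
  show "emeasure (nu_m m) {z. \<forall>j. z $ j \<in> (if j = i then {d} else UNIV)} = 0"
    using assms by (subst emeasure_nu_m_box) (auto intro!: prod_zero exI[of _ i])
qed (auto intro!: vec_box_borel split: if_splits)

context shrinkage_target
begin

text \<open>Averaging over the dilations \<open>z \<mapsto> l z\<close> reduces the claim to one-dimensional slices along
  rays. On such a slice, translates of the layer by multiples of \<open>1/N\<close> are disjoint because \<open>p\<close>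
  decays by a factor \<open>1/L\<^sup>2\<close> over each step.\<close>

lemma boundary_layer_small:
  assumes K: "K > 0" and L: "L \<ge> 1" and \<epsilon>: "\<epsilon> > 0"
  obtains r where "r > 0" "\<And>x y. norm x \<ge> r \<Longrightarrow> y > 0 \<Longrightarrow>
    emeasure nu {z \<in> cball x K. y / L < p z \<and> p z < L * y} \<le> ennreal \<epsilon>"
proof -
  obtain B where B: "B > 0" "\<And>x::real^'p. emeasure nu (cball x (2 * K + 1)) \<le> ennreal B"
    using nu_cball_bounded by blast
  define P where "P = (2::real) ^ CARD('p)"
  have P: "P > 0" by (simp add: P_def)
  \<comment> \<open>\<open>N\<close> is large enough for the final bound: P is the dilation
    constant, B bounds the measure of the relevant z, and 3/N is the relative size of a
    slice.\<close>
  obtain N :: nat where "P * (3 * B) / \<epsilon> < real N" using reals_Archimedean2 by blast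
  moreover have "P * (3 * B) / \<epsilon> > 0" using P B \<epsilon> by simp
  ultimately have N: "real N > 0" "P * (3 * B) / \<epsilon> < real N" by linarith+
  then have N': "P * (3 * B / real N) \<le> \<epsilon>"
    using \<epsilon> by (simp add: field_simps)
  define s where "s = 1 / real N"
  have s: "s > 0" using N by (simp add: s_def)
  define \<delta> where "\<delta> = 1 / L\<^sup>2"
  have \<delta>: "0 < \<delta>" "\<delta> \<le> 1" using L by (simp_all add: \<delta>_def)
  obtain r where r: "r > 0" "\<And>x. norm x \<ge> r \<Longrightarrow> p (x + s *\<^sub>R sgn x) \<le> \<delta> * p x"
    using radial_decay[OF s \<delta>(1)] by blast
  show thesis
  \<comment> \<open>This radius keeps \<open>cball x K\<close> in the region of radial decay, and
    |x| \<ge> 2K + 1 ensures that every z with some dilate l z in the layer has norm at least |x| /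
    2.\<close>
  proof (rule that[of "r + 2 * K + 1"])
    fix x :: "real^'p" and y :: real assume x: "norm x \<ge> r + 2 * K + 1" and y: "y > 0"
    have x1: "norm x \<ge> 1" "norm x > 0" "norm x \<ge> 2 * K + 1" "norm x - K \<ge> r" using x K r by auto
    define T where "T = {z \<in> cball x K. y / L < p z \<and> p z < L * y}"
    \<comment> \<open>Dilations with these ratios displace points at distance about |x| by about 1,
      so all relevant z stay within bounded distance of x.\<close>
    define I where "I = {1..1 + 1 / norm x}"
    have T [measurable]: "T \<in> sets borel" unfolding T_def by measurable
    have I2: "l \<le> 2" if "l \<in> I" for l using that x1 by (auto simp: I_def intro: order_trans)
    have slice: "(\<integral>\<^sup>+l. indicator I l * indicator T (l *\<^sub>R z) \<partial>lborel) \<le>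
        ennreal (3 / (real N * norm x)) * indicator (cball x (2 * K + 1)) z" for z
    proof (cases "\<exists>l\<in>I. l *\<^sub>R z \<in> T")
      case False
      then have "indicator I l * indicator T (l *\<^sub>R z) = (0::ennreal)" for l
        by (auto simp: indicator_def)
      then show ?thesis by (simp only:) simp
    next
      case True
      then obtain l where l: "l \<in> I" "l *\<^sub>R z \<in> T" by blast
      have l1: "1 \<le> l" "l \<le> 1 + 1 / norm x" using l by (auto simp: I_def)
      have near: "norm (e *\<^sub>R z) \<ge> norm x - K" "norm (e *\<^sub>R z) \<le> norm x + K" "norm (e *\<^sub>R z - x) \<le> K"
        if "e *\<^sub>R z \<in> T" for e
      proof -
        show 1: "norm (e *\<^sub>R z - x) \<le> K" using that by (simp add: T_def dist_norm norm_minus_commute)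
        show "norm (e *\<^sub>R z) \<ge> norm x - K" "norm (e *\<^sub>R z) \<le> norm x + K"
          using 1 norm_triangle_ineq3[of "e *\<^sub>R z" x] by linarith+
      qed
      have nlz: "norm (l *\<^sub>R z) = l * norm z" using l1 by simp
      have z_low: "norm z \<ge> norm x / 2"
      proof -
        have "norm x / 2 * (1 + 1 / norm x) = norm x / 2 + 1 / 2"
          using x1 by (simp add: distrib_left)
        then have "norm x / 2 * (1 + 1 / norm x) \<le> norm x - K"
          using x1 by linarith
        also have "\<dots> \<le> l * norm z" using near(1)[OF l(2)] unfolding nlz .
        also have "\<dots> \<le> (1 + 1 / norm x) * norm z" using l1 by (intro mult_right_mono) auto
        finally have "(norm x / 2) * (1 + 1 / norm x) \<le> norm z * (1 + 1 / norm x)" by (simp add: mult.commute)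
        moreover have "1 + 1 / norm x > 0" using x1 by (simp add: add_pos_pos)
        ultimately show ?thesis by (simp only: mult_le_cancel_right_pos)
      qed
      then have z0: "norm z > 0" using x1 by linarith
      have z_near: "z \<in> cball x (2 * K + 1)"
      proof -
        have "1 * norm z \<le> l * norm z" using l1 by (intro mult_right_mono) auto
        then have zu: "norm z \<le> norm x + K" using near(2)[OF l(2)] unfolding nlz by simp
        have "norm (z - x) \<le> norm (z - l *\<^sub>R z) + norm (l *\<^sub>R z - x)"
          using norm_triangle_ineq[of "z - l *\<^sub>R z" "l *\<^sub>R z - x"] by simp
        also have "z - l *\<^sub>R z = (1 - l) *\<^sub>R z" by (simp add: algebra_simps)
        also have "norm ((1 - l) *\<^sub>R z) = (l - 1) * norm z" using l1 by (simp add: abs_if)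
        also have "\<dots> \<le> (1 / norm x) * (norm x + K)" using l1 zu by (intro mult_mono) auto
        also have "\<dots> \<le> 1 + K" using x1 K by (simp add: field_simps)
        finally have "norm (z - x) \<le> 2 * K + 1" using near(3)[OF l(2)] by simp
        then show ?thesis by (simp add: dist_norm norm_minus_commute)
      qed
      define E where "E = {l \<in> I. l *\<^sub>R z \<in> T}"
      have E: "E \<in> sets borel"
      proof -
        have "(\<lambda>l. l *\<^sub>R z) \<in> borel \<rightarrow>\<^sub>M borel" by measurable
        from measurable_sets[OF this T] have "{l. l *\<^sub>R z \<in> T} \<in> sets borel" by (simp add: vimage_def)
        moreover have "E = I \<inter> {l. l *\<^sub>R z \<in> T}" by (auto simp: E_def)
        ultimately show ?thesis by (simp add: I_def)
      qed
      \<comment> \<open>A step \<open>s\<close> along the ray through z is a step s / |z| in the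
        ratio l. As N s = 1, the N disjoint translates of \<open>E\<close> fit into a length 1/|x| +
        1/|z|, which is at most 3/|x|.\<close>
      have "of_nat N * emeasure lborel E \<le> ennreal ((1 + 1 / norm x) - 1 + real N * (s / norm z))"
      proof (rule emeasure_lborel_disjoint_translates[OF E])
        show "E \<subseteq> {1..1 + 1 / norm x}" by (auto simp: E_def I_def)
        show "0 < s / norm z" using s z0 by simp
        fix e and j :: nat assume e: "e \<in> E" and "j \<ge> 1"
        then obtain i where j: "j = Suc i" by (cases j) auto
        have eT: "e *\<^sub>R z \<in> T" and e1: "e \<ge> 1" using e by (auto simp: E_def I_def)
        have "sgn (e *\<^sub>R z) = sgn z" using e1 by (simp add: sgn_scaleR)
        then have eq: "(e + real j * (s / norm z)) *\<^sub>R z = e *\<^sub>R z + (real (Suc i) * s) *\<^sub>R sgn (e *\<^sub>R z)"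
          by (simp add: j sgn_div_norm scaleR_left_distrib divide_inverse)
        have "p ((e + real j * (s / norm z)) *\<^sub>R z) \<le> \<delta> * p (e *\<^sub>R z)"
          unfolding eq
          by (rule radial_decay_iterated[OF r(2) s \<delta> r(1)]) (use near(1)[OF eT] x1 in auto)
        also have "\<dots> < \<delta> * (L * y)" using eT \<delta> by (intro mult_strict_left_mono) (auto simp: T_def)
        also have "\<dots> = y / L" using L by (simp add: \<delta>_def power2_eq_square)
        finally show "e + real j * (s / norm z) \<notin> E" by (auto simp: E_def T_def)
      qed (use x1 in auto)
      also have "(1 + 1 / norm x) - 1 + real N * (s / norm z) = 1 / norm x + 1 / norm z"
        using N by (simp add: s_def)
      also have "ennreal \<dots> \<le> ennreal (3 / norm x)"
      proof (rule ennreal_leI)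
        have "1 / norm z \<le> 1 / (norm x / 2)" using z_low x1 z0 by (intro divide_left_mono mult_pos_pos) auto
        then show "1 / norm x + 1 / norm z \<le> 3 / norm x" by (simp add: field_simps)
      qed
      finally have "of_nat N * emeasure lborel E \<le> ennreal (3 / norm x)" .
      then have "ennreal (1 / real N) * (of_nat N * emeasure lborel E) \<le> ennreal (1 / real N) * ennreal (3 / norm x)"
        by (intro mult_left_mono) auto
      moreover have "ennreal (1 / real N) * of_nat N = 1"
        using N by (simp add: ennreal_of_nat_eq_real_of_nat flip: ennreal_mult')
      ultimately have le: "emeasure lborel E \<le> ennreal (3 / (real N * norm x))"
        using x1 by (simp add: mult.assoc[symmetric] flip: ennreal_mult')
      have "(\<integral>\<^sup>+l. indicator I l * indicator T (l *\<^sub>R z) \<partial>lborel) = (\<integral>\<^sup>+l. indicator E l \<partial>lborel)"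
        by (intro nn_integral_cong) (auto simp: indicator_def E_def)
      also have "\<dots> = emeasure lborel E" using E by simp
      finally show ?thesis using le z_near by simp
    qed
    interpret nu: sigma_finite_measure "nu :: (real^'p) measure" by (rule sigma_finite_nu)
    interpret pair_sigma_finite "nu :: (real^'p) measure" lborel ..
    have [measurable]: "(\<lambda>w. fst w *\<^sub>R snd w) \<in> (borel :: real measure) \<Otimes>\<^sub>M (borel :: (real^'p) measure) \<rightarrow>\<^sub>M borel"
      by measurable
    have [measurable]: "I \<in> sets borel" by (simp add: I_def)
    have ind: "(\<lambda>w. indicator I (snd w) * indicator T (snd w *\<^sub>R fst w) :: ennreal) \<in>
        borel_measurable (nu \<Otimes>\<^sub>M lborel)"
      by measurable
    \<comment> \<open>Averaging over \<open>I\<close> costs its length 1/|x|, and the slice bound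
      3/(N |x|) carries the same factor, so the estimate is uniform in x.\<close>
    have "ennreal (1 / norm x) * emeasure nu T = (\<integral>\<^sup>+l. emeasure nu T * indicator I l \<partial>lborel)"
      by (simp add: nn_integral_cmult I_def mult.commute)
    also have "\<dots> \<le> (\<integral>\<^sup>+l. ennreal P * (\<integral>\<^sup>+z. indicator I l * indicator T (l *\<^sub>R z) \<partial>nu) \<partial>lborel)"
    proof (intro nn_integral_mono)
      fix l
      show "emeasure nu T * indicator I l \<le> ennreal P * (\<integral>\<^sup>+z. indicator I l * indicator T (l *\<^sub>R z) \<partial>nu)"
        using nu_dilation_le[OF T, of l] I2[of l]
        by (cases "l \<in> I") (auto simp: I_def P_def ennreal_power[symmetric])
    qed
    also have "\<dots> = ennreal P * (\<integral>\<^sup>+l. \<integral>\<^sup>+z. indicator I l * indicator T (l *\<^sub>R z) \<partial>nu \<partial>lborel)"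
      by (intro nn_integral_cmult) measurable
    also have "(\<integral>\<^sup>+l. \<integral>\<^sup>+z. indicator I l * indicator T (l *\<^sub>R z) \<partial>nu \<partial>lborel) =
       (\<integral>\<^sup>+z. \<integral>\<^sup>+l. indicator I l * indicator T (l *\<^sub>R z) \<partial>lborel \<partial>nu)"
      using Fubini[OF ind] by simp
    also have "\<dots> \<le> (\<integral>\<^sup>+z. ennreal (3 / (real N * norm x)) * indicator (cball x (2 * K + 1)) z \<partial>nu)"
      by (intro nn_integral_mono slice)
    also have "\<dots> = ennreal (3 / (real N * norm x)) * emeasure nu (cball x (2 * K + 1))"
      by (rule nn_integral_cmult_indicator) simp
    also have "\<dots> \<le> ennreal (3 / (real N * norm x)) * ennreal B"
      by (intro mult_left_mono B) simp
    finally have "ennreal (1 / norm x) * emeasure nu T \<le> ennreal P * (ennreal (3 / (real N * norm x)) * ennreal B)"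
      by (simp add: mult_left_mono)
    also have "\<dots> = ennreal (1 / norm x) * ennreal (P * (3 * B / real N))"
      using P B x1 N by (simp flip: ennreal_mult')
    finally have "ennreal (norm x) * (ennreal (1 / norm x) * emeasure nu T) \<le>
        ennreal (norm x) * (ennreal (1 / norm x) * ennreal (P * (3 * B / real N)))"
      by (rule mult_left_mono) simp
    moreover have cancel: "ennreal (norm x) * (ennreal (1 / norm x) * A) = A" for A
      using x1 by (simp add: mult.assoc[symmetric] flip: ennreal_mult')
    ultimately have "emeasure nu T \<le> ennreal (P * (3 * B / real N))"
      by (simp only: cancel)
    also have "\<dots> \<le> ennreal \<epsilon>" using N' by (rule ennreal_leI)
    finally show "emeasure nu {z \<in> cball x K. y / L < p z \<and> p z < L * y} \<le> ennreal \<epsilon>"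
      by (simp add: T_def)
  qed (use r K in auto)
qed

text \<open>All the balls \<open>cball x K\<close> lie in one ball of finite measure, where the sets
  on which \<open>p\<close> is below 1/(n + 1) decrease to the empty set because \<open>p\<close> is
  positive everywhere. Continuity from above gives the claim uniformly in x.\<close>

lemma low_region_small:
  assumes K: "K > 0" and L: "L > 0" and \<epsilon>: "\<epsilon> > 0"
  obtains \<delta> where "\<delta> > 0" "\<And>x y. norm x \<le> r \<Longrightarrow> y < \<delta> \<Longrightarrow>
    emeasure nu {z \<in> cball x K. p z < L * y} \<le> ennreal \<epsilon>"
proof -
  let ?A = "\<lambda>n. {z \<in> cball 0 (r + K). p z < 1 / real (Suc n)}"
  obtain B where B: "\<And>x::real^'p. emeasure nu (cball x (r + K)) \<le> ennreal B"
    using nu_cball_bounded by blast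
  have "(\<lambda>n. emeasure nu (?A n)) \<longlonglongrightarrow> emeasure nu (\<Inter>n. ?A n)"
  proof (rule Lim_emeasure_decseq)
    show "decseq ?A"
      by (auto simp: decseq_def elim!: less_le_trans intro!: frac_le)
    show "emeasure nu (?A n) \<noteq> \<infinity>" for n
    proof -
      have "emeasure nu (?A n) \<le> emeasure nu (cball (0 :: real^'p) (r + K))" by (intro emeasure_mono) auto
      then show ?thesis using B[of 0] by (auto simp: top_unique)
    qed
  qed (auto simp: image_subset_iff)
  moreover have "(\<Inter>n. ?A n) = {}"
  proof -
    have "\<exists>n. z \<notin> ?A n" for z
      using reals_Archimedean[OF p_pos[of z]] by (auto simp: inverse_eq_divide not_less intro: less_imp_le)
    then show ?thesis by blast
  qed
  ultimately have "(\<lambda>n. emeasure nu (?A n)) \<longlonglongrightarrow> 0" by simp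
  then have "eventually (\<lambda>n. emeasure nu (?A n) < ennreal \<epsilon>) sequentially"
    using \<epsilon> by (intro order_tendstoD(2)) auto
  then obtain n where n: "emeasure nu (?A n) < ennreal \<epsilon>"
    by (auto simp: eventually_sequentially)
  show thesis
  proof (rule that[of "1 / (L * real (Suc n))"])
    fix x :: "real^'p" and y assume x: "norm x \<le> r" and y: "y < 1 / (L * real (Suc n))"
    have "L * y < L * (1 / (L * real (Suc n)))" using y L by (rule mult_strict_left_mono)
    also have "\<dots> = 1 / real (Suc n)" using L by simp
    finally have "L * y < 1 / real (Suc n)" .
    then have "{z \<in> cball x K. p z < L * y} \<subseteq> ?A n"
      using x norm_triangle_ineq2[of _ x]
      by (auto simp: dist_norm norm_minus_commute) (smt (verit) norm_triangle_ineq2)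
    then have "emeasure nu {z \<in> cball x K. p z < L * y} \<le> emeasure nu (?A n)"
      by (intro emeasure_mono) auto
    then show "emeasure nu {z \<in> cball x K. p z < L * y} \<le> ennreal \<epsilon>" using n by (meson less_imp_le order_trans)
  qed (use L in simp)
qed

end

text \<open>Normalization is Lipschitz away from 0: replacing |w| by \<open>a\<close> doubles the
  error, and dividing by |w| \<ge> a/2 brings the factor 2/a.\<close>

lemma norm_sgn_diff_le:
  fixes w n :: "'a::real_normed_vector"
  assumes "norm n = 1" "a > 0" "norm (w - a *\<^sub>R n) \<le> a / 2"
  shows "norm (sgn w - n) \<le> 4 * norm (w - a *\<^sub>R n) / a"
proof -
  let ?d = "norm (w - a *\<^sub>R n)"
  have aw: "\<bar>norm w - a\<bar> \<le> ?d"
    using norm_triangle_ineq3[of w "a *\<^sub>R n"] assms by simp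
  then have w: "norm w \<ge> a / 2" using assms by linarith
  then have w0: "norm w > 0" using assms by linarith
  have "sgn w - n = (1 / norm w) *\<^sub>R ((w - a *\<^sub>R n) + (a - norm w) *\<^sub>R n)"
    using w0 by (simp add: sgn_div_norm divide_inverse algebra_simps)
  then have "norm (sgn w - n) = norm ((w - a *\<^sub>R n) + (a - norm w) *\<^sub>R n) / norm w"
    using w0 by simp
  also have "\<dots> \<le> (?d + \<bar>a - norm w\<bar> * norm n) / norm w"
    using w0 by (intro divide_right_mono order_trans[OF norm_triangle_ineq]) auto
  also have "\<dots> \<le> (2 * ?d) / norm w"
    using aw w0 assms by (intro divide_right_mono) auto
  also have "\<dots> \<le> (2 * ?d) / (a / 2)"
    using w w0 assms by (intro divide_left_mono mult_pos_pos) auto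
  also have "\<dots> = 4 * ?d / a" by simp
  finally show ?thesis .
qed

text \<open>The mass is (2h) to the number of active coordinates, since the inactive ones of y
  vanish and the cube contains their Dirac mass. The minimum with 1 removes the dependence on
  \<open>m\<close>.\<close>

lemma emeasure_nu_m_cube_ge:
  fixes y :: "real^'p::finite"
  assumes h: "h > 0" and y: "\<And>i. i \<notin> m \<Longrightarrow> y $ i = 0"
  shows "ennreal (min 1 (2 * h) ^ CARD('p)) \<le> emeasure (nu_m m) {z. \<forall>i. z $ i \<in> {y $ i - h..y $ i + h}}"
proof -
  have "emeasure (nu_m m) {z. \<forall>i. z $ i \<in> {y $ i - h..y $ i + h}} = ennreal (2 * h) ^ card m"
  proof -
    have "indicator {y $ i - h..y $ i + h} 0 = (1::ennreal)" if "i \<in> - m" for i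
      using y[of i] h that by simp
    then have "(\<Prod>i\<in>-m. indicator {y $ i - h..y $ i + h} 0) = (1::ennreal)"
      by (rule prod.neutral[rule_format])
    moreover have "emeasure lborel {y $ i - h..y $ i + h} = ennreal (2 * h)" for i
      using h by (subst emeasure_lborel_Icc) auto
    ultimately show ?thesis by (subst emeasure_nu_m_box) simp_all
  qed
  also have "\<dots> = ennreal ((2 * h) ^ card m)" using h by (simp add: ennreal_power)
  finally have eq: "emeasure (nu_m m) {z. \<forall>i. z $ i \<in> {y $ i - h..y $ i + h}} = ennreal ((2 * h) ^ card m)" .
  have "min 1 (2 * h) ^ CARD('p) \<le> min 1 (2 * h) ^ card m"
    using h by (intro power_decreasing card_mono) auto
  also have "\<dots> \<le> (2 * h) ^ card m" using h by (intro power_mono) auto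
  finally show ?thesis unfolding eq by (rule ennreal_leI)
qed

context shrinkage_target
begin

lemma q_section_measurable [measurable]: "q x \<in> borel_measurable borel"
  using measurable_compose[OF measurable_Pair1' q_measurable, of x] by simp

lemma superlevel_borel [measurable]: "{z \<in> cball x K. a \<le> p z} \<in> sets borel"
proof -
  have "{z \<in> space borel. a \<le> p z} \<in> sets borel" by measurable
  moreover have "{z \<in> cball x K. a \<le> p z} = cball x K \<inter> {z \<in> space borel. a \<le> p z}" by auto
  ultimately show ?thesis by simp
qed

text \<open>By (A3) the cone \<open>W\<close>, which contains a cube of fixed size near \<open>x\<close>, lies in the superlevel set
  of \<open>x - u n(x)\<close>, and (A2) makes the density there much larger than at \<open>x\<close>.\<close>

lemma interior_cone:
  obtains \<eta> K where "\<eta> > 0" "K > 0"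
    "\<And>L. L > 0 \<Longrightarrow> \<exists>r>0. \<forall>x. norm x \<ge> r \<longrightarrow>
      ennreal \<eta> \<le> (\<integral>\<^sup>+z. ennreal (q x z) * indicator {z \<in> cball x K. L * p x \<le> p z} z \<partial>nu)"
proof -
  obtain b R \<epsilon> u where bR: "b > 0" "R > 0" "\<epsilon> > 0" "0 < u" "u < b" and
    A3': "\<And>m x y. x \<in> S m \<Longrightarrow> norm x \<ge> R \<Longrightarrow> y \<in> S m \<Longrightarrow> y \<in> W b u \<epsilon> m x \<Longrightarrow> \<pi> m (x - u *\<^sub>R sgn x) \<le> \<pi> m y"
    using A3 by (auto simp: Ball_def)
  \<comment> \<open>\<open>a\<close> is the midpoint of the lengths s allowed in \<open>W\<close>. A
    deviation of at most a/2 keeps the length of \<open>w\<close> in (0, b - u), and one of at most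
    a \<epsilon> / 4 keeps its direction within \<epsilon> of n(x), by
    \<open>norm_sgn_diff_le\<close>. By the l1 bound, the cube of half-side \<open>h\<close> lies in
    the ball of radius \<open>d\<close>.\<close>
  define a where "a = (b - u) / 2"
  define d where "d = min (a / 2) (a * \<epsilon> / 4)"
  define h where "h = d / real CARD('p)"
  define K where "K = u + a + d"
  have a: "a > 0" using bR by (simp add: a_def)
  have d: "d > 0" "d \<le> a / 2" "d \<le> a * \<epsilon> / 4" using a bR by (auto simp: d_def)
  have h: "h > 0" using d by (simp add: h_def)
  obtain \<kappa> where \<kappa>: "\<kappa> > 0" "\<And>x z. norm (z - x) \<le> K \<Longrightarrow> \<kappa> \<le> q x z"
    using q_lower[of K] by blast
  define w0 where "w0 = min 1 (2 * h) ^ CARD('p)"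
  have w0: "w0 > 0" using h by (simp add: w0_def)
  show thesis
  proof (rule that[of "\<kappa> * w0" K])
    show "\<kappa> * w0 > 0" "K > 0" using \<kappa> w0 bR a d by (auto simp: K_def)
    fix L :: real assume L: "L > 0"
    obtain r where r: "r > 0" "\<And>x. norm x \<ge> r \<Longrightarrow> p (x + u *\<^sub>R sgn x) \<le> (1 / L) * p x"
      using radial_decay[of u "1 / L"] bR L by auto
    show "\<exists>r>0. \<forall>x. norm x \<ge> r \<longrightarrow>
      ennreal (\<kappa> * w0) \<le> (\<integral>\<^sup>+z. ennreal (q x z) * indicator {z \<in> cball x K. L * p x \<le> p z} z \<partial>nu)"
    proof (intro exI[of _ "R + r + u"] conjI allI impI)
      fix x :: "real^'p" assume x: "norm x \<ge> R + r + u"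
      let ?m = "supp x" and ?n = "sgn x"
      \<comment> \<open>\<open>x'\<close> is the comparison point of (A3), and x is reached from it
        by an outward step u, so radial decay at \<open>x'\<close> gives L p(x) \<le> p(x'). The
        cube is centred at y = x' - a n(x), on the axis of the cone.\<close>
      define x' where "x' = x - u *\<^sub>R ?n"
      define y where "y = x - (u + a) *\<^sub>R ?n"
      have nx: "norm x \<ge> R" "norm x > u" "norm x > 0" "x \<noteq> 0" using x r bR by auto
      have xS: "x \<in> S ?m" by (simp add: mem_S_iff)
      have n1: "norm ?n = 1" using nx by (simp add: norm_sgn)
      have x'_eq: "x' = (1 - u / norm x) *\<^sub>R x"
        using add_scaleR_sgn[of x "- u"] by (simp add: x'_def)
      have k: "1 - u / norm x > 0" using nx by simp
      have x'S: "x' \<in> S ?m" unfolding x'_eq using k by (intro S_scaleR xS) (metis less_irrefl)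
      have sx': "sgn x' = ?n" unfolding x'_eq using k by (simp add: sgn_scaleR)
      have "norm x' = (1 - u / norm x) * norm x" unfolding x'_eq using k by simp
      also have "\<dots> = norm x - u" using nx by (simp add: field_simps)
      finally have nx': "norm x' \<ge> r" using x bR by simp
      have px: "L * p x \<le> p x'"
      proof -
        have "p (x' + u *\<^sub>R sgn x') \<le> (1 / L) * p x'" by (rule r(2)[OF nx'])
        then have "p x \<le> (1 / L) * p x'" unfolding sx' by (simp add: x'_def)
        then show ?thesis using L by (simp add: field_simps)
      qed
      let ?C = "{z. \<forall>i. z $ i \<in> {y $ i - h..y $ i + h}}"
      have C [measurable]: "?C \<in> sets borel" by measurable
      have Cd: "norm (z - y) \<le> d" if "z \<in> ?C" for z
      proof -
        have "norm (z - y) \<le> (\<Sum>i\<in>UNIV. \<bar>(z - y) $ i\<bar>)" by (rule norm_le_l1_cart)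
        also have "\<dots> \<le> (\<Sum>i\<in>(UNIV::'p set). h)"
          using that by (intro sum_mono) (auto simp: abs_le_iff algebra_simps)
        also have "\<dots> = d" by (simp add: h_def)
        finally show ?thesis .
      qed
      have Ck: "norm (z - x) \<le> K" if "z \<in> ?C" for z
      proof -
        have "z - x = (z - y) - (u + a) *\<^sub>R ?n" by (simp add: y_def)
        then have "norm (z - x) \<le> norm (z - y) + norm ((u + a) *\<^sub>R ?n)" by (metis norm_triangle_ineq4)
        then show ?thesis using Cd[OF that] n1 a bR by (simp add: K_def)
      qed
      \<comment> \<open>\<open>W\<close> requires directions in \<open>S m\<close>, so the
        coordinates of w = x' - z in the support must not vanish. The z excluded by
        \<open>ne\<close> form a null set.\<close>
      have good: "L * p x \<le> p z"
        if z: "z \<in> ?C" "z \<in> S ?m" and ne: "\<And>i. i \<in> ?m \<Longrightarrow> z $ i \<noteq> x' $ i" for z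
      proof -
        define w where "w = x' - z"
        have wy: "w - a *\<^sub>R ?n = y - z" by (simp add: w_def x'_def y_def algebra_simps)
        have wd: "norm (w - a *\<^sub>R ?n) \<le> d" using Cd[OF z(1)] by (simp add: wy norm_minus_commute)
        have "\<bar>norm w - a\<bar> \<le> d"
          using norm_triangle_ineq3[of w "a *\<^sub>R ?n"] wd n1 a by simp
        moreover have "b - u = 2 * a" by (simp add: a_def)
        ultimately have nw: "0 < norm w" "norm w < b - u" using d a by linarith+
        have wS: "w \<in> S ?m"
          using ne[symmetric] z(2) x'S by (auto simp: S_def w_def)
        have "norm (sgn w - ?n) \<le> 4 * norm (w - a *\<^sub>R ?n) / a"
          using wd d a n1 by (intro norm_sgn_diff_le) auto
        also have "\<dots> \<le> 4 * (a * \<epsilon> / 4) / a"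
          using wd d a by (intro divide_right_mono mult_left_mono) auto
        also have "\<dots> = \<epsilon>" using a by simp
        finally have sg: "norm (sgn w - ?n) \<le> \<epsilon>" .
        have "z = (norm x - u) *\<^sub>R ?n - norm w *\<^sub>R sgn w"
          using nx nw by (simp add: sgn_div_norm w_def x'_def algebra_simps)
        moreover have "sgn w \<in> S ?m"
          using nw wS by (simp add: sgn_div_norm S_scaleR)
        moreover have "norm (sgn w) = 1" using nw by (simp add: norm_sgn)
        ultimately have "z \<in> W b u \<epsilon> ?m x"
          unfolding W_def using nw sg by (intro CollectI exI[of _ "norm w"] exI[of _ "sgn w"] conjI) auto
        then have "\<pi> ?m x' \<le> \<pi> ?m z"
          unfolding x'_def using xS nx(1) z(2) by (intro A3')
        then have "p x' \<le> p z" using \<omega>_pos[of ?m] by (simp add: p_S[OF x'S] p_S[OF z(2)])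
        then show ?thesis using px by simp
      qed
      have "AE z in nu_m ?m. \<forall>i\<in>?m. z $ i \<noteq> x' $ i"
        by (intro AE_finite_allI AE_nu_m_neq) auto
      then have ae: "AE z in nu_m ?m. ennreal \<kappa> * indicator ?C z \<le>
          ennreal (q x z) * indicator {z \<in> cball x K. L * p x \<le> p z} z"
        using AE_nu_m_S[of ?m]
      proof eventually_elim
        case (elim z)
        show ?case
        proof (cases "z \<in> ?C")
          case True
          then have "z \<in> {z \<in> cball x K. L * p x \<le> p z}"
            using good[OF True elim(2)] elim(1) Ck[OF True] by (simp add: dist_norm norm_minus_commute)
          then show ?thesis using \<kappa>(2)[OF Ck[OF True]] by (auto intro: ennreal_leI simp: indicator_def)
        qed simp
      qed
      have "ennreal (\<kappa> * w0) = ennreal \<kappa> * ennreal w0" using \<kappa> w0 by (simp add: ennreal_mult)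
      also have "\<dots> \<le> ennreal \<kappa> * emeasure (nu_m ?m) ?C"
        unfolding w0_def
        by (intro mult_left_mono emeasure_nu_m_cube_ge h) (auto simp: y_def supp_def sgn_div_norm)
      also have "\<dots> = (\<integral>\<^sup>+z. ennreal \<kappa> * indicator ?C z \<partial>nu_m ?m)"
        by (simp add: nn_integral_cmult)
      also have "\<dots> \<le> (\<integral>\<^sup>+z. ennreal (q x z) * indicator {z \<in> cball x K. L * p x \<le> p z} z \<partial>nu_m ?m)"
        by (rule nn_integral_mono_AE[OF ae])
      also have "\<dots> \<le> (\<Sum>m\<in>UNIV. \<integral>\<^sup>+z. ennreal (q x z) * indicator {z \<in> cball x K. L * p x \<le> p z} z \<partial>nu_m m)"
        by (rule member_le_sum) auto
      also have "\<dots> = (\<integral>\<^sup>+z. ennreal (q x z) * indicator {z \<in> cball x K. L * p x \<le> p z} z \<partial>nu)"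
        by (subst nn_integral_nu) simp_all
      finally show "ennreal (\<kappa> * w0) \<le> (\<integral>\<^sup>+z. ennreal (q x z) * indicator {z \<in> cball x K. L * p x \<le> p z} z \<partial>nu)" .
    qed (use r bR in auto)
  qed
qed

text \<open>\<eta> and K0 come before K, L and \<epsilon>, so that these may be chosen in terms of
  \<eta>. Far out the cone and the layer estimate apply; for bounded x with small p(x), the part of
  the ball where p(z) < L p(x) has small measure, which settles both claims.\<close>

lemma level_set_estimates:
  obtains \<eta> K0 where "\<eta> > 0" "\<eta> \<le> 1" "K0 > 0"
    "\<And>K L \<epsilon>. K \<ge> K0 \<Longrightarrow> L \<ge> 1 \<Longrightarrow> \<epsilon> > 0 \<Longrightarrow> \<exists>\<delta>>0. \<forall>x. p x < \<delta> \<longrightarrow>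
       emeasure nu {z \<in> cball x K. p x / L < p z \<and> p z < L * p x} \<le> ennreal \<epsilon> \<and>
       ennreal \<eta> \<le> (\<integral>\<^sup>+z. ennreal (q x z) * indicator {z \<in> cball x K. L * p x \<le> p z} z \<partial>nu)"
proof -
  obtain \<eta> K1 where \<eta>: "\<eta> > 0" "K1 > 0" and cone: "\<And>L. L > 0 \<Longrightarrow> \<exists>r>0. \<forall>x. norm x \<ge> r \<longrightarrow>
      ennreal \<eta> \<le> (\<integral>\<^sup>+z. ennreal (q x z) * indicator {z \<in> cball x K1. L * p x \<le> p z} z \<partial>nu)"
    using interior_cone by blast
  obtain C a where C: "C > 0" "a > 0" and qu: "\<And>x z. q x z \<le> C * exp (- a * (norm (z - x))\<^sup>2)"
    using q_upper by blast
  \<comment> \<open>With 1/(4C) the proposal leaves \<open>cball x K\<close> with probability at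
    most 1/4. For bounded x the region of low density is allowed another 1/4, which leaves 1/2 for
    the superlevel set.\<close>
  obtain K2 where K2: "K2 > 0" and tail: "\<And>K x :: real^'p. K \<ge> K2 \<Longrightarrow>
    (\<integral>\<^sup>+z. ennreal (exp (- a * (norm (z - x))\<^sup>2)) * indicator (- cball x K) z \<partial>nu) \<le> ennreal (1 / (4 * C))"
    using nu_gaussian_tail[OF C(2), of "1 / (4 * C)"] C by auto
  show thesis
  proof (rule that[of "min \<eta> (1/2)" "max K1 K2"])
    fix K L \<epsilon> :: real assume K: "K \<ge> max K1 K2" and L: "L \<ge> 1" and \<epsilon>: "\<epsilon> > 0"
    have K0: "K > 0" using K K2 by simp
    obtain r1 where r1: "r1 > 0" "\<And>x. norm x \<ge> r1 \<Longrightarrow>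
      ennreal \<eta> \<le> (\<integral>\<^sup>+z. ennreal (q x z) * indicator {z \<in> cball x K1. L * p x \<le> p z} z \<partial>nu)"
      using cone[of L] L by auto
    obtain r2 where r2: "r2 > 0" "\<And>x y. norm x \<ge> r2 \<Longrightarrow> y > 0 \<Longrightarrow>
       emeasure nu {z \<in> cball x K. y / L < p z \<and> p z < L * y} \<le> ennreal \<epsilon>"
      using boundary_layer_small[OF K0 L \<epsilon>] by blast
    define r where "r = max r1 r2"
    define e where "e = min \<epsilon> (1 / (4 * C))"
    have e: "e > 0" using \<epsilon> C by (simp add: e_def)
    have L0: "L > 0" using L by simp
    obtain \<delta> where \<delta>: "\<delta> > 0" "\<And>x y. norm x \<le> r \<Longrightarrow> y < \<delta> \<Longrightarrow>
       emeasure nu {z \<in> cball x K. p z < L * y} \<le> ennreal e"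
      using low_region_small[OF K0 L0 e, of r] by blast
    have "emeasure nu {z \<in> cball x K. p x / L < p z \<and> p z < L * p x} \<le> ennreal \<epsilon> \<and>
       ennreal (min \<eta> (1/2)) \<le> (\<integral>\<^sup>+z. ennreal (q x z) * indicator {z \<in> cball x K. L * p x \<le> p z} z \<partial>nu)"
      if x: "p x < \<delta>" for x
    proof (cases "norm x \<ge> r")
      case True
      have "ennreal (min \<eta> (1/2)) \<le> ennreal \<eta>" by (intro ennreal_leI) simp
      also have "\<dots> \<le> (\<integral>\<^sup>+z. ennreal (q x z) * indicator {z \<in> cball x K1. L * p x \<le> p z} z \<partial>nu)"
        using True by (intro r1) (simp add: r_def)
      also have "\<dots> \<le> (\<integral>\<^sup>+z. ennreal (q x z) * indicator {z \<in> cball x K. L * p x \<le> p z} z \<partial>nu)"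
        using K by (intro nn_integral_mono) (auto simp: indicator_def)
      finally show ?thesis using r2(2)[OF _ p_pos, of x x] True by (simp add: r_def)
    next
      case False
      then have low: "emeasure nu {z \<in> cball x K. p z < L * p x} \<le> ennreal e"
        using x by (intro \<delta>) auto
      have "emeasure nu {z \<in> cball x K. p x / L < p z \<and> p z < L * p x} \<le> emeasure nu {z \<in> cball x K. p z < L * p x}"
        by (intro emeasure_mono) auto
      also have "\<dots> \<le> ennreal \<epsilon>"
        using low by (rule order_trans) (auto intro: ennreal_leI simp: e_def)
      finally have 1: "emeasure nu {z \<in> cball x K. p x / L < p z \<and> p z < L * p x} \<le> ennreal \<epsilon>" .
      let ?I = "\<lambda>A. \<integral>\<^sup>+z. ennreal (q x z) * indicator A z \<partial>nu"
      let ?G = "{z \<in> cball x K. L * p x \<le> p z}" and ?B = "{z \<in> cball x K. p z < L * p x}"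
      have qC: "q x z \<le> C" for z
      proof -
        have "C * exp (- a * (norm (z - x))\<^sup>2) \<le> C * 1" using C by (intro mult_left_mono) auto
        then show ?thesis using qu[of x z] by simp
      qed
      have "?I ?B \<le> (\<integral>\<^sup>+z. ennreal C * indicator ?B z \<partial>nu)"
        using qC by (intro nn_integral_mono mult_right_mono ennreal_leI) auto
      also have "\<dots> = ennreal C * emeasure nu ?B" by (simp add: nn_integral_cmult)
      also have "\<dots> \<le> ennreal C * ennreal (1 / (4 * C))"
        using low by (intro mult_left_mono) (auto elim!: order_trans intro!: ennreal_leI simp: e_def)
      also have "\<dots> = ennreal (1/4)" using C by (simp flip: ennreal_mult')
      finally have IB: "?I ?B \<le> ennreal (1/4)" .
      have "?I (- cball x K) \<le> (\<integral>\<^sup>+z. ennreal C * (ennreal (exp (- a * (norm (z - x))\<^sup>2)) * indicator (- cball x K) z) \<partial>nu)"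
        using qu C by (intro nn_integral_mono) (auto simp: indicator_def simp flip: ennreal_mult' intro!: ennreal_leI)
      also have "\<dots> = ennreal C * (\<integral>\<^sup>+z. ennreal (exp (- a * (norm (z - x))\<^sup>2)) * indicator (- cball x K) z \<partial>nu)"
        by (rule nn_integral_cmult) measurable
      also have "\<dots> \<le> ennreal C * ennreal (1 / (4 * C))" using K by (intro mult_left_mono tail) auto
      also have "\<dots> = ennreal (1/4)" using C by (simp flip: ennreal_mult')
      finally have IO: "?I (- cball x K) \<le> ennreal (1/4)" .
      have "1 = ?I UNIV" by (simp add: q_mass)
      also have "\<dots> = (\<integral>\<^sup>+z. (ennreal (q x z) * indicator ?G z + ennreal (q x z) * indicator ?B z)
          + ennreal (q x z) * indicator (- cball x K) z \<partial>nu)"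
        by (intro nn_integral_cong) (auto simp: indicator_def)
      also have "\<dots> = ?I ?G + ?I ?B + ?I (- cball x K)"
        by (simp add: nn_integral_add)
      also have "\<dots> \<le> ?I ?G + ennreal (1/4) + ennreal (1/4)"
        by (intro add_mono IB IO order_refl)
      also have "\<dots> = ?I ?G + ennreal (1/2)"
        by (simp add: add.assoc flip: ennreal_plus)
      finally have "ennreal 1 - ennreal (1/2) \<le> ?I ?G"
        by (simp add: ennreal_minus_le_iff add.commute)
      then have "ennreal (1/2) \<le> ?I ?G" by (subst (asm) ennreal_minus) auto
      then have "ennreal (min \<eta> (1/2)) \<le> ?I ?G" by (rule order_trans[rotated]) (intro ennreal_leI, simp)
      then show ?thesis using 1 by simp
    qed
    then show "\<exists>\<delta>>0. \<forall>x. p x < \<delta> \<longrightarrow>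
       emeasure nu {z \<in> cball x K. p x / L < p z \<and> p z < L * p x} \<le> ennreal \<epsilon> \<and>
       ennreal (min \<eta> (1/2)) \<le> (\<integral>\<^sup>+z. ennreal (q x z) * indicator {z \<in> cball x K. L * p x \<le> p z} z \<partial>nu)"
      using \<delta>(1) by blast
  qed (use \<eta> K2 in auto)
qed

end

section \<open>Drift and minorization\<close>

text \<open>Here a = q(x,z), a' = q(z,x), t = p(z)/p(x), and n is the contribution of z to
  PV(x)/V(x). Its accepted part is at most a t^(-\<beta>), small for large t, and at most a'
  t^(1-\<beta>), small for small t; both 0 < \<beta> and \<beta> < 1 enter here.\<close>

lemma weighted_acceptance_bounds:
  fixes a a' t \<beta> :: real
  assumes pos: "a > 0" "a' > 0" "t > 0" and \<beta>: "0 < \<beta>" "\<beta> < 1"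
  defines "n \<equiv> min a (t * a') * t powr (- \<beta>) + (a - min a (t * a'))"
  shows "n \<le> a + max a a'"
    and "a \<le> L * a' \<Longrightarrow> 0 < L \<Longrightarrow> L \<le> t \<Longrightarrow> n \<le> L powr (- \<beta>) * a"
    and "a' \<le> M * a \<Longrightarrow> 0 < L \<Longrightarrow> t \<le> 1 / L \<Longrightarrow> n \<le> a + M * L powr (\<beta> - 1) * a"
proof -
  have m0: "min a (t * a') > 0" using pos by simp
  have upper: "min a (t * a') * t powr (- \<beta>) \<le> t powr (1 - \<beta>) * a'"
  proof -
    have "min a (t * a') * t powr (- \<beta>) \<le> (t * a') * t powr (- \<beta>)"
      by (intro mult_right_mono) auto
    also have "\<dots> = t powr (1 - \<beta>) * a'"
      using pos by (simp add: powr_diff powr_minus field_simps)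
    finally show ?thesis .
  qed
  have "min a (t * a') * t powr (- \<beta>) \<le> max a a'"
  proof (cases "t \<ge> 1")
    case True
    have "t powr (- \<beta>) \<le> 1" using True \<beta> powr_mono[of "- \<beta>" 0 t] by simp
    then have "min a (t * a') * t powr (- \<beta>) \<le> a * 1" using pos m0 by (intro mult_mono) auto
    then show ?thesis by simp
  next
    case False
    have "t powr (1 - \<beta>) \<le> 1" using False pos \<beta> by (intro powr_le1) auto
    then have "t powr (1 - \<beta>) * a' \<le> 1 * a'" using pos by (intro mult_right_mono) auto
    then show ?thesis using upper by simp
  qed
  then show "n \<le> a + max a a'" using m0 unfolding n_def by linarith
  show "n \<le> L powr (- \<beta>) * a" if "a \<le> L * a'" "0 < L" "L \<le> t"
  proof -
    have "L * a' \<le> t * a'" using that pos by (intro mult_right_mono) auto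
    then have "min a (t * a') = a" using that by simp
    moreover have "t powr (- \<beta>) \<le> L powr (- \<beta>)" using that \<beta> by (intro powr_mono2') auto
    ultimately show ?thesis using pos by (simp add: n_def mult.commute)
  qed
  show "n \<le> a + M * L powr (\<beta> - 1) * a" if "a' \<le> M * a" "0 < L" "t \<le> 1 / L"
  proof -
    have "t powr (1 - \<beta>) * a' \<le> (1 / L) powr (1 - \<beta>) * (M * a)"
      using that pos \<beta> by (intro mult_mono powr_mono2) auto
    also have "(1 / L) powr (1 - \<beta>) = L powr (\<beta> - 1)"
      using that by (simp add: powr_divide powr_diff field_simps)
    finally have "t powr (1 - \<beta>) * a' \<le> M * L powr (\<beta> - 1) * a" by (simp only: mult_ac)
    then show ?thesis using upper m0 unfolding n_def by linarith
  qed
qed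

context shrinkage_target
begin

text \<open>The integrand of PV(x)/V(x) against \<open>nu\<close>: acceptance of z multiplies V by
  (p(z)/p(x))^(-\<beta>), rejection leaves it unchanged.\<close>

definition V_ratio :: "real ^ 'p \<Rightarrow> real ^ 'p \<Rightarrow> real" where
  "V_ratio x z = MH.move x z * (p z / p x) powr (- \<beta>) + (q x z - MH.move x z)"

lemma V_ratio_nonneg: "V_ratio x z \<ge> 0"
  using MH.move_bounds[of x z] by (simp add: V_ratio_def less_imp_le)

lemma V_ratio_measurable [measurable]: "V_ratio x \<in> borel_measurable borel"
proof -
  have [measurable]: "MH.move x \<in> borel_measurable borel"
    using measurable_compose[OF measurable_Pair1' MH.move_measurable, of x] by simp
  show ?thesis unfolding V_ratio_def[abs_def] by measurable
qed

lemma nn_integral_V_kernel: "(\<integral>\<^sup>+z. ennreal (V z) \<partial>MH.kernel x) = ennreal (V x) * (\<integral>\<^sup>+z. ennreal (V_ratio x z) \<partial>nu)"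
proof -
  have [measurable]: "MH.move x \<in> borel_measurable borel"
    using measurable_compose[OF measurable_Pair1' MH.move_measurable, of x] by simp
  have Vz: "V z = V x * (p z / p x) powr (- \<beta>)" for z
    using p_pos[of x] p_pos[of z] by (simp add: lyapunov_def powr_divide)
  have "(\<integral>\<^sup>+z. ennreal (V z) \<partial>MH.kernel x) =
     (\<integral>\<^sup>+z. ennreal (MH.move x z) * ennreal (V z) \<partial>nu) + (\<integral>\<^sup>+z. ennreal (q x z - MH.move x z) * ennreal (V x) \<partial>nu)"
    by (simp add: MH.nn_integral_kernel MH.stay_def nn_integral_multc)
  also have "\<dots> = (\<integral>\<^sup>+z. ennreal (MH.move x z) * ennreal (V z) + ennreal (q x z - MH.move x z) * ennreal (V x) \<partial>nu)"
    by (rule nn_integral_add[symmetric]) measurable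
  also have "\<dots> = (\<integral>\<^sup>+z. ennreal (V x) * ennreal (V_ratio x z) \<partial>nu)"
  proof (intro nn_integral_cong)
    fix z
    have "MH.move x z * V z + (q x z - MH.move x z) * V x = V x * V_ratio x z"
      unfolding Vz[of z] V_ratio_def by (simp add: algebra_simps)
    then show "ennreal (MH.move x z) * ennreal (V z) + ennreal (q x z - MH.move x z) * ennreal (V x) =
        ennreal (V x) * ennreal (V_ratio x z)"
      using MH.move_bounds[of x z] V_pos[of x] V_pos[of z] V_ratio_nonneg[of x z]
      by (simp add: less_imp_le flip: ennreal_mult ennreal_plus)
  qed
  also have "\<dots> = ennreal (V x) * (\<integral>\<^sup>+z. ennreal (V_ratio x z) \<partial>nu)"
    by (rule nn_integral_cmult) measurable
  finally show ?thesis .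
qed

lemma V_ratio_bounds:
  shows "V_ratio x z \<le> q x z + max (q x z) (q z x)"
    and "q x z \<le> L * q z x \<Longrightarrow> 0 < L \<Longrightarrow> L * p x \<le> p z \<Longrightarrow> V_ratio x z \<le> L powr (- \<beta>) * q x z"
    and "q z x \<le> M * q x z \<Longrightarrow> 0 < L \<Longrightarrow> p z \<le> p x / L \<Longrightarrow> V_ratio x z \<le> q x z + M * L powr (\<beta> - 1) * q x z"
proof -
  note b = weighted_acceptance_bounds[OF q_pos[of x z] q_pos[of z x] divide_pos_pos[OF p_pos[of z] p_pos[of x]] \<beta>]
  show "V_ratio x z \<le> q x z + max (q x z) (q z x)"
    unfolding V_ratio_def MH.move_def by (rule b(1))
  show "q x z \<le> L * q z x \<Longrightarrow> 0 < L \<Longrightarrow> L * p x \<le> p z \<Longrightarrow> V_ratio x z \<le> L powr (- \<beta>) * q x z"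
    unfolding V_ratio_def MH.move_def using p_pos[of x] by (intro b(2)) (auto simp: field_simps)
  show "q z x \<le> M * q x z \<Longrightarrow> 0 < L \<Longrightarrow> p z \<le> p x / L \<Longrightarrow> V_ratio x z \<le> q x z + M * L powr (\<beta> - 1) * q x z"
    unfolding V_ratio_def MH.move_def using p_pos[of x] by (intro b(3)) (auto simp: field_simps)
qed

lemma V_ratio_gaussian:
  obtains C a where "C > 0" "a > 0" "\<And>x z. q x z \<le> C * exp (- a * (norm (z - x))\<^sup>2)"
    "\<And>x z. V_ratio x z \<le> 2 * C * exp (- a * (norm (z - x))\<^sup>2)"
proof -
  obtain C a where C: "C > 0" "a > 0" and qu: "\<And>x z. q x z \<le> C * exp (- a * (norm (z - x))\<^sup>2)"
    using q_upper by blast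
  show thesis
  proof (rule that[OF C qu])
    fix x z
    show "V_ratio x z \<le> 2 * C * exp (- a * (norm (z - x))\<^sup>2)"
      using V_ratio_bounds(1)[of x z] qu[of x z] qu[of z x] by (simp add: norm_minus_commute)
  qed
qed

text \<open>A crude bound valid everywhere. It handles the points where p(x) is not small, at which
  V is bounded.\<close>

lemma V_kernel_bounded_ratio:
  obtains B where "B > 0" "\<And>x. (\<integral>\<^sup>+z. ennreal (V z) \<partial>MH.kernel x) \<le> ennreal (B * V x)"
proof -
  obtain C a where C: "C > 0" "a > 0" and Vr: "\<And>x z. V_ratio x z \<le> 2 * C * exp (- a * (norm (z - x))\<^sup>2)"
    using V_ratio_gaussian by metis
  define G where "G = (sqrt (pi / a) + 1) ^ CARD('p)"
  have G: "G > 0" using C by (simp add: G_def add_nonneg_pos)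
  show thesis
  proof (rule that[of "2 * C * G"])
    fix x
    have "(\<integral>\<^sup>+z. ennreal (V_ratio x z) \<partial>nu) \<le> (\<integral>\<^sup>+z. ennreal (2 * C) * ennreal (exp (- a * (norm (z - x))\<^sup>2)) \<partial>nu)"
      using Vr C by (intro nn_integral_mono) (simp add: ennreal_leI flip: ennreal_mult')
    also have "\<dots> = ennreal (2 * C) * (\<integral>\<^sup>+z. ennreal (exp (- a * (norm (z - x))\<^sup>2)) \<partial>nu)"
      by (rule nn_integral_cmult) measurable
    also have "\<dots> \<le> ennreal (2 * C) * ennreal G"
      unfolding G_def by (intro mult_left_mono nn_integral_nu_gaussian_le C) simp
    finally have "ennreal (V x) * (\<integral>\<^sup>+z. ennreal (V_ratio x z) \<partial>nu) \<le> ennreal (V x) * (ennreal (2 * C) * ennreal G)"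
      by (rule mult_left_mono) simp
    then show "(\<integral>\<^sup>+z. ennreal (V z) \<partial>MH.kernel x) \<le> ennreal (2 * C * G * V x)"
      using C G V_pos[of x] by (simp add: nn_integral_V_kernel mult_ac flip: ennreal_mult')
  qed (use C G in simp)
qed

text \<open>The favourable set removes at least \<eta> from the total proposal mass 1. The terms
  with \<open>d\<close>, the layer and the tail give back at most \<eta>/8 each, so the rate 1 -
  \<eta>/2 is safe.\<close>

lemma drift_small_density:
  obtains l \<delta> where "0 \<le> l" "l < 1" "\<delta> > 0"
    "\<And>x. p x < \<delta> \<Longrightarrow> (\<integral>\<^sup>+z. ennreal (V z) \<partial>MH.kernel x) \<le> ennreal (l * V x)"
proof -
  obtain \<eta> K0 where \<eta>: "\<eta> > 0" "\<eta> \<le> 1" "K0 > 0" and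
    level: "\<And>K L \<epsilon>. K \<ge> K0 \<Longrightarrow> L \<ge> 1 \<Longrightarrow> \<epsilon> > 0 \<Longrightarrow> \<exists>\<delta>>0. \<forall>x. p x < \<delta> \<longrightarrow>
       emeasure nu {z \<in> cball x K. p x / L < p z \<and> p z < L * p x} \<le> ennreal \<epsilon> \<and>
       ennreal \<eta> \<le> (\<integral>\<^sup>+z. ennreal (q x z) * indicator {z \<in> cball x K. L * p x \<le> p z} z \<partial>nu)"
    using level_set_estimates by blast
  obtain C a where C: "C > 0" "a > 0" and qu: "\<And>x z. q x z \<le> C * exp (- a * (norm (z - x))\<^sup>2)"
    and Vr: "\<And>x z. V_ratio x z \<le> 2 * C * exp (- a * (norm (z - x))\<^sup>2)"
    using V_ratio_gaussian by metis
  \<comment> \<open>\<open>V_ratio\<close> is at most 2C times a Gaussian, so layer and tail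
    contribute at most 2 C e = \<eta>/8 each.\<close>
  define e where "e = \<eta> / (16 * C)"
  have e: "e > 0" "2 * C * e = \<eta> / 8" using \<eta> C by (simp_all add: e_def)
  obtain K1 where K1: "K1 > 0" and tail: "\<And>K x :: real^'p. K \<ge> K1 \<Longrightarrow>
    (\<integral>\<^sup>+z. ennreal (exp (- a * (norm (z - x))\<^sup>2)) * indicator (- cball x K) z \<partial>nu) \<le> ennreal e"
    using nu_gaussian_tail[OF C(2) e(1)] by blast
  define K where "K = max K0 K1"
  have K: "K \<ge> K0" "K \<ge> K1" by (auto simp: K_def)
  obtain \<kappa> where \<kappa>: "\<kappa> > 0" "\<And>x z. norm (z - x) \<le> K \<Longrightarrow> \<kappa> \<le> q x z" using q_lower[of K] by blast
  define M where "M = C / \<kappa>"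
  have M: "M > 0" using C \<kappa> by (simp add: M_def)
  have qC: "q x z \<le> C" for x z
  proof -
    have "C * exp (- a * (norm (z - x))\<^sup>2) \<le> C * 1" using C by (intro mult_left_mono) auto
    then show ?thesis using qu[of x z] by simp
  qed
  have qM: "q z x \<le> M * q x z" if "norm (z - x) \<le> K" for x z
  proof -
    have "M * \<kappa> \<le> M * q x z" using M \<kappa>(2)[OF that] by (intro mult_left_mono) auto
    then show ?thesis using qC[of z x] \<kappa> by (simp add: M_def)
  qed
  \<comment> \<open>The first term weighs accepted moves to much lower density, the second moves to
    much higher density.\<close>
  have "((\<lambda>L. M * L powr (\<beta> - 1) + L powr (- \<beta>)) \<longlongrightarrow> M * 0 + 0) at_top"
    using \<beta> by (intro tendsto_intros tendsto_neg_powr filterlim_ident) auto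
  then have "eventually (\<lambda>L. M * L powr (\<beta> - 1) + L powr (- \<beta>) < \<eta> / 8) at_top"
    using \<eta> by (intro order_tendstoD(2)) auto
  then obtain L0 where L0: "\<And>L. L \<ge> L0 \<Longrightarrow> M * L powr (\<beta> - 1) + L powr (- \<beta>) < \<eta> / 8"
    by (auto simp: eventually_at_top_linorder)
  \<comment> \<open>L \<ge> M forces acceptance on the superlevel set, since there p(z)/p(x) is at
    least q(x,z)/q(z,x).\<close>
  define L where "L = max (max 1 M) L0"
  have L: "L \<ge> 1" "L \<ge> M" "L > 0" by (auto simp: L_def)
  define d where "d = M * L powr (\<beta> - 1) + L powr (- \<beta>)"
  have d: "0 \<le> d" "d \<le> \<eta> / 8" "L powr (- \<beta>) \<le> d" "M * L powr (\<beta> - 1) \<le> d"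
    using L0[of L] M by (auto simp: d_def L_def)
  obtain \<delta> where \<delta>: "\<delta> > 0" and layer: "\<And>x. p x < \<delta> \<Longrightarrow>
      emeasure nu {z \<in> cball x K. p x / L < p z \<and> p z < L * p x} \<le> ennreal e"
    and good: "\<And>x. p x < \<delta> \<Longrightarrow>
      ennreal \<eta> \<le> (\<integral>\<^sup>+z. ennreal (q x z) * indicator {z \<in> cball x K. L * p x \<le> p z} z \<partial>nu)"
    using level[OF K(1) L(1) e(1)] by blast
  show thesis
  proof (rule that[of "1 - \<eta> / 2" \<delta>])
    fix x assume x: "p x < \<delta>"
    let ?G = "{z \<in> cball x K. L * p x \<le> p z}" and ?B = "{z \<in> cball x K. p x / L < p z \<and> p z < L * p x}"
    let ?q = "\<lambda>z. ennreal (q x z)" and ?k = "\<lambda>z. ennreal (exp (- a * (norm (z - x))\<^sup>2))"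
    \<comment> \<open>Each regime is covered by its own terms: \<open>d * q\<close> on the
      superlevel set, the constant 2C in the layer, the Gaussian outside the ball, and below the
      layer q + d q, where rejection may retain all of q.\<close>
    have le: "ennreal (V_ratio x z) \<le> ?q z * indicator (- ?G) z + ennreal d * ?q z +
        ennreal (2 * C) * indicator ?B z + ennreal (2 * C) * (?k z * indicator (- cball x K) z)" for z
    proof -
      consider (far) "z \<notin> cball x K" | (high) "z \<in> ?G" | (mid) "z \<in> ?B"
        | (low) "z \<in> cball x K" "z \<notin> ?G" "z \<notin> ?B" by blast
      then show ?thesis
      proof cases
        case far
        have "ennreal (V_ratio x z) \<le> ennreal (2 * C) * ?k z"
          using Vr[of x z] C by (simp add: ennreal_leI flip: ennreal_mult')
        then show ?thesis using far by (auto intro: add_increasing)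
      next
        case high
        then have xz: "norm (z - x) \<le> K" "norm (x - z) \<le> K" by (auto simp: dist_norm norm_minus_commute)
        have "q x z \<le> M * q z x" by (rule qM[OF xz(2)])
        also have "\<dots> \<le> L * q z x" using L q_pos[of z x] by (intro mult_right_mono) auto
        finally have "V_ratio x z \<le> L powr (- \<beta>) * q x z" using high L by (intro V_ratio_bounds(2)) auto
        also have "\<dots> \<le> d * q x z" using d q_pos[of x z] by (intro mult_right_mono) auto
        finally have "ennreal (V_ratio x z) \<le> ennreal d * ?q z"
          using d by (simp add: ennreal_leI flip: ennreal_mult')
        then show ?thesis using high by (auto intro: add_increasing add_increasing2)
      next
        case mid
        have "exp (- a * (norm (z - x))\<^sup>2) \<le> 1" using C by simp
        then have "2 * C * exp (- a * (norm (z - x))\<^sup>2) \<le> 2 * C * 1" using C by (intro mult_left_mono) auto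
        then have "ennreal (V_ratio x z) \<le> ennreal (2 * C)" using Vr[of x z] by (intro ennreal_leI) auto
        then show ?thesis using mid by (auto intro: add_increasing add_increasing2)
      next
        case low
        then have xz: "norm (z - x) \<le> K" by (auto simp: dist_norm norm_minus_commute)
        have "p x / L \<le> p x / 1" using L p_pos[of x] by (intro divide_left_mono) auto
        moreover have "1 * p x \<le> L * p x" using L p_pos[of x] by (intro mult_right_mono) auto
        ultimately have "p z \<le> p x / L" using low by auto
        then have "V_ratio x z \<le> q x z + M * L powr (\<beta> - 1) * q x z"
          using qM[OF xz] L by (intro V_ratio_bounds(3)) auto
        also have "\<dots> \<le> q x z + d * q x z" using d q_pos[of x z] by (intro add_left_mono mult_right_mono) auto
        finally have "ennreal (V_ratio x z) \<le> ennreal (q x z + d * q x z)" by (rule ennreal_leI)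
        also have "\<dots> = ?q z + ennreal d * ?q z"
          using d q_pos[of x z] by (simp add: ennreal_mult' less_imp_le)
        finally show ?thesis using low by (auto intro: add_increasing2)
      qed
    qed
    have rest: "(\<integral>\<^sup>+z. ?q z * indicator (- ?G) z \<partial>nu) \<le> ennreal (1 - \<eta>)"
    proof -
      have "1 = (\<integral>\<^sup>+z. ?q z * indicator (- ?G) z + ?q z * indicator ?G z \<partial>nu)"
        unfolding q_mass[of x, symmetric] by (intro nn_integral_cong) (auto simp: indicator_def)
      also have "\<dots> = (\<integral>\<^sup>+z. ?q z * indicator (- ?G) z \<partial>nu) + (\<integral>\<^sup>+z. ?q z * indicator ?G z \<partial>nu)"
        by (rule nn_integral_add) measurable
      finally have total: "(\<integral>\<^sup>+z. ?q z * indicator (- ?G) z \<partial>nu) + (\<integral>\<^sup>+z. ?q z * indicator ?G z \<partial>nu) = ennreal 1"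
        by (simp only: ennreal_1)
      have "(\<integral>\<^sup>+z. ?q z * indicator (- ?G) z \<partial>nu) + ennreal \<eta> \<le> ennreal 1"
        unfolding total[symmetric] by (rule add_left_mono[OF good[OF x]])
      then have "(\<integral>\<^sup>+z. ?q z * indicator (- ?G) z \<partial>nu) \<le> ennreal 1 - ennreal \<eta>"
        by (simp only: ennreal_le_minus_iff) simp
      then show ?thesis using \<eta> by (subst (asm) ennreal_minus) auto
    qed
    have "(\<integral>\<^sup>+z. ennreal (V_ratio x z) \<partial>nu) \<le> (\<integral>\<^sup>+z. ?q z * indicator (- ?G) z + ennreal d * ?q z +
        ennreal (2 * C) * indicator ?B z + ennreal (2 * C) * (?k z * indicator (- cball x K) z) \<partial>nu)"
      by (intro nn_integral_mono le)
    also have "\<dots> = (\<integral>\<^sup>+z. ?q z * indicator (- ?G) z \<partial>nu) + ennreal d * (\<integral>\<^sup>+z. ?q z \<partial>nu) +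
        ennreal (2 * C) * emeasure nu ?B + ennreal (2 * C) * (\<integral>\<^sup>+z. ?k z * indicator (- cball x K) z \<partial>nu)"
      by (simp add: nn_integral_add nn_integral_cmult nn_integral_cmult_indicator)
    also have "\<dots> \<le> ennreal (1 - \<eta>) + ennreal d * 1 + ennreal (2 * C) * ennreal e + ennreal (2 * C) * ennreal e"
      by (intro add_mono mult_left_mono rest layer[OF x] tail[OF K(2)]) (simp_all add: q_mass)
    also have "\<dots> = ennreal ((1 - \<eta>) + d + 2 * C * e + 2 * C * e)"
      using \<eta> d C e(1) by (simp add: ennreal_mult'[symmetric] flip: ennreal_plus)
    also have "\<dots> \<le> ennreal (1 - \<eta> / 2)"
      unfolding e(2) using d \<eta> by (intro ennreal_leI) simp
    finally have "ennreal (V x) * (\<integral>\<^sup>+z. ennreal (V_ratio x z) \<partial>nu) \<le> ennreal (V x) * ennreal (1 - \<eta> / 2)"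
      by (rule mult_left_mono) simp
    then show "(\<integral>\<^sup>+z. ennreal (V z) \<partial>MH.kernel x) \<le> ennreal ((1 - \<eta> / 2) * V x)"
      using \<eta> V_pos[of x] by (simp add: nn_integral_V_kernel mult.commute flip: ennreal_mult')
  qed (use \<eta> \<delta> in auto)
qed

text \<open>Where p(x) is at least \<delta>, V is at most c \<delta>^(-\<beta>), and the crude bound
  turns this into the constant \<open>K\<close>.\<close>

lemma drift_condition:
  obtains l K where "0 \<le> l" "l < 1" "K > 0"
    "\<And>x. (\<integral>\<^sup>+z. ennreal (V z) \<partial>MH.kernel x) \<le> ennreal (l * V x + K)"
proof -
  obtain l \<delta> where l: "0 \<le> l" "l < 1" and \<delta>: "\<delta> > 0" and
    small: "\<And>x. p x < \<delta> \<Longrightarrow> (\<integral>\<^sup>+z. ennreal (V z) \<partial>MH.kernel x) \<le> ennreal (l * V x)"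
    using drift_small_density by blast
  obtain B where B: "B > 0" "\<And>x. (\<integral>\<^sup>+z. ennreal (V z) \<partial>MH.kernel x) \<le> ennreal (B * V x)"
    using V_kernel_bounded_ratio by blast
  define K where "K = B * (c * \<delta> powr (- \<beta>))"
  have K: "K > 0" using B c \<delta> by (simp add: K_def)
  show thesis
  proof (rule that[OF l K])
    fix x
    show "(\<integral>\<^sup>+z. ennreal (V z) \<partial>MH.kernel x) \<le> ennreal (l * V x + K)"
    proof (cases "p x < \<delta>")
      case True
      show ?thesis using K by (intro order_trans[OF small[OF True]] ennreal_leI) simp
    next
      case False
      have "p x powr (- \<beta>) \<le> \<delta> powr (- \<beta>)" using False \<beta> \<delta> by (intro powr_mono2') auto
      then have "B * V x \<le> K" unfolding K_def lyapunov_def using B c by (intro mult_left_mono) auto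
      moreover have "0 \<le> l * V x" using l V_pos[of x] by simp
      ultimately show ?thesis by (intro order_trans[OF B(2)] ennreal_leI) simp
    qed
  qed
qed

section \<open>Minorization through the atom at the origin\<close>

lemma nu_origin: "1 \<le> emeasure nu {0 :: real^'p}"
proof -
  have "{0} = {z :: real^'p. \<forall>i. z $ i \<in> {0}}" by (auto simp: vec_eq_iff)
  then have "emeasure (nu_m {}) {0 :: real^'p} = 1"
    using emeasure_nu_m_box[of "\<lambda>_. {0}" "{}"] by simp
  moreover have "emeasure (nu_m {}) {0 :: real^'p} \<le> (\<Sum>m\<in>UNIV. emeasure (nu_m m) {0 :: real^'p})"
    by (rule member_le_sum) auto
  ultimately show ?thesis by (simp add: emeasure_nu)
qed

lemma minorization: "\<exists>e>0. \<forall>x. V x \<le> R \<longrightarrow> e \<le> measure (MH.kernel x) {0}"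
proof -
  \<comment> \<open>This solves c \<delta>^(-\<beta>) = max 1 R, so V(x) \<le> R forces p(x) \<ge>
    \<delta>. The maximum with 1 keeps the quotient positive for every R.\<close>
  define \<delta> where "\<delta> = (c / max 1 R) powr (1 / \<beta>)"
  have \<delta>: "\<delta> > 0" using c by (simp add: \<delta>_def)
  obtain r where r: "r > 0" "\<And>x. norm x \<ge> r \<Longrightarrow> p x < \<delta>" using p_vanishes[OF \<delta>] by blast
  obtain B where B: "B > 0" "\<And>x. p x \<le> B" using p_bounded by blast
  obtain \<kappa> where \<kappa>: "\<kappa> > 0" "\<And>x z. norm (z - x) \<le> r \<Longrightarrow> \<kappa> \<le> q x z" using q_lower[of r] by blast
  have "min \<kappa> (p 0 / B * \<kappa>) \<le> measure (MH.kernel x) {0}" if x: "V x \<le> R" for x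
  proof -
    have "\<not> p x < \<delta>"
    proof
      assume "p x < \<delta>"
      then have "p x powr \<beta> < \<delta> powr \<beta>" using \<beta> p_pos[of x] by (intro powr_less_mono2) auto
      also have "\<dots> = c / max 1 R" using \<beta> c by (simp add: \<delta>_def powr_powr)
      finally have "max 1 R * p x powr \<beta> < c" by (simp add: field_simps)
      moreover have "p x powr \<beta> > 0" using p_pos[of x] by simp
      ultimately have "max 1 R < c / p x powr \<beta>" by (simp only: pos_less_divide_eq)
      then have "max 1 R < c * p x powr (- \<beta>)" by (simp only: powr_minus divide_inverse)
      then show False using x by (simp add: lyapunov_def)
    qed
    then have nx: "norm x \<le> r" using r(2)[of x] by force
    \<comment> \<open>The second argument of the minimum in \<open>move x 0\<close> stays away from
      0 because \<open>p\<close> is bounded above.\<close>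
    have "p 0 / B * \<kappa> \<le> p 0 / p x * q 0 x"
      using nx B(2)[of x] B(1) p_pos[of x] p_pos[of 0] \<kappa>(1)
      by (intro mult_mono divide_left_mono \<kappa>) auto
    moreover have "\<kappa> \<le> q x 0" using nx by (intro \<kappa>) auto
    ultimately have "min \<kappa> (p 0 / B * \<kappa>) \<le> MH.move x 0"
      unfolding MH.move_def by (intro min.mono)
    also have "\<dots> \<le> measure (MH.kernel x) {0}" by (rule MH.kernel_atom_lower[OF nu_origin])
    finally show ?thesis .
  qed
  moreover have "min \<kappa> (p 0 / B * \<kappa>) > 0" using \<kappa> B p_pos[of 0] by simp
  ultimately show ?thesis by blast
qed

lemma geometric_ergodicity:
  "\<exists>C>0. \<exists>lam\<in>{0<..<1}. \<forall>n x.
    V_norm_diff V (iter_kernel (P_Psi \<Psi> \<sigma> \<gamma> D \<omega> \<pi> U) n x) (target \<omega> \<pi>) \<le> ennreal (C * V x * lam ^ n)"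
proof -
  have eq: "P_Psi \<Psi> \<sigma> \<gamma> D \<omega> \<pi> U = MH.kernel" by (rule ext) (rule P_Psi_eq_kernel)
  obtain l K where l: "0 \<le> l" "l < 1" "K > 0" and
    drift: "\<And>x. (\<integral>\<^sup>+z. ennreal (V z) \<partial>MH.kernel x) \<le> ennreal (l * V x + K)"
    using drift_condition by blast
  show ?thesis
    unfolding eq
  proof (rule harris_theorem[OF MH.kernel_measurable MH.prob_space_kernel prob_space_target _ _ V_measurable c(2) drift l minorization])
    show "sets (target \<omega> \<pi>) = sets borel" by (simp add: target_def)
    show "(\<integral>\<^sup>+x. \<integral>\<^sup>+y. f y \<partial>MH.kernel x \<partial>target \<omega> \<pi>) = (\<integral>\<^sup>+x. f x \<partial>target \<omega> \<pi>)"
      if "f \<in> borel_measurable borel" for f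
      unfolding target_eq_density by (rule MH.invariant[OF that])
  qed
qed

end

theorem theorem3p1:
  fixes \<omega> :: "'p::finite set \<Rightarrow> real"
    and \<pi> U V :: "'p set \<Rightarrow> real ^ 'p \<Rightarrow> real"
    and \<sigma> \<gamma> D \<beta> c :: real
    and \<Psi> :: thresholding
  assumes params: "\<sigma> > 0" "\<gamma> > 0" "D > 0"
    and weights: "\<And>m. \<omega> m \<ge> 0" "(\<Sum>m\<in>UNIV. \<omega> m) = 1"
    and dens_meas: "\<And>m. \<pi> m \<in> borel_measurable borel"
    and dens_prob: "\<And>m. prob_space (density (nu_m m) (\<lambda>x. ennreal (\<pi> m x)))"
    and dens_form: "\<And>m. \<exists>k>0. \<forall>x\<in>S m. \<pi> m x = k * exp (- U m x - V m x)"
    and U_C1: "\<And>m. C1 (U m)"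
    and A1_i: "\<And>m. \<omega> m > 0" "\<And>m x. x \<in> S m \<Longrightarrow> \<pi> m x > 0"
    and A1_ii: "\<And>m. continuous_on (S m) (\<pi> m)"
    and A1_iii: "\<And>m. ((\<lambda>x. \<pi> m x * indicator (S m) x) \<longlongrightarrow> 0) at_infinity"
    and A2: "\<And>m s. s > 0 \<Longrightarrow>
      ((\<lambda>r::real. SUP x \<in> {x \<in> S m. norm x \<ge> r}. ennreal (\<pi> m (x + s *\<^sub>R sgn x) / \<pi> m x)) \<longlongrightarrow> 0) at_top"
    and A3: "\<exists>b>0. \<exists>R>0. \<exists>\<epsilon>>0. \<exists>u\<in>{0<..<b}. \<forall>m. \<forall>x\<in>S m. norm x \<ge> R \<longrightarrow>
      (\<forall>y\<in>S m \<inter> W b u \<epsilon> m x. \<pi> m (x - u *\<^sub>R sgn x) \<le> \<pi> m y)"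
    and \<beta>: "0 < \<beta>" "\<beta> < 1"
    and c: "c > 0" "\<And>x. lyapunov c \<beta> \<omega> \<pi> x \<ge> 1"
  shows "\<exists>C>0. \<exists>lam\<in>{0<..<1}. \<forall>n x.
    V_norm_diff (lyapunov c \<beta> \<omega> \<pi>) (iter_kernel (P_Psi \<Psi> \<sigma> \<gamma> D \<omega> \<pi> U) n x) (target \<omega> \<pi>)
      \<le> ennreal (C * lyapunov c \<beta> \<omega> \<pi> x * lam ^ n)"
proof -
  interpret shrinkage_target \<Psi> \<sigma> \<gamma> D U \<omega> \<pi> \<beta> c
    by (intro shrinkage_target.intro thresholded_langevin.intro shrinkage_target_axioms.intro) (fact assms)+
  show ?thesis by (rule geometric_ergodicity)
qed

end
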